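(* Let $d\ge 1$, let $K$ be a finite index set, let $\{\{I_{j,k}\}_{j\in\mathbb N,k\in K},I_\bullet\}$ be an admissible partition of $\mathbb R^d$, let $s\ge 0$, and let $\varphi_\bullet,\varphi\in L^2(\mathbb R^d)$ be a pair of functions that is $s$-admissible with respect to this partition. Then there exists $\nu_0>0$ such that for each $\nu\in(0,\nu_0)$ the system $$\{T_\lambda\varphi_\bullet:\lambda\in\nu\mathbb Z^d\}\cup\{\varphi_{j,k,\lambda}: j\in\mathbb N,\ k\in K,\ \lambda\in\nu\mathbb Z^d\}$$ is a frame representing the $H^s(\mathbb R^d)$ norm; precisely, there exist $A,B>0$ such that for each $f\in H^s(\mathbb R^d)$ $$A\|f\|_s^2\le\sum_{\lambda\in\nu\mathbb Z^d}|\langle f,T_\lambda\varphi_\bullet\rangle|^2+\sum_{j\in\mathbb N,\,k\in K,\,\lambda\in\nu\mathbb Z^d}2^{2js}|\langle f,\varphi_{j,k,\lambda}\rangle|^2\le B\|f\|_s^2 .$$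
   Context: $\mathbb N=\{0,1,2,\dots\}$. Fourier transform: $\widehat u(\omega)=\int e^{-2\pi i x\cdot\omega}u(x)\,dx$. $T_xf(t)=f(t-x)$. $\langle\cdot,\cdot\rangle$ is the $L^2(\mathbb R^d)$ inner product. $\|f\|_s=\|(1+|\omega|)^s\widehat f(\omega)\|_{L^2}$ is the $H^s$-norm. $d(\omega,A)$ is the Euclidean distance from $\omega$ to the set $A$. Pointwise conditions on Fourier transforms of $L^2$ functions are understood almost everywhere. Admissible partition of $\mathbb R^d$: a family $\{\{I_{j,k}\}_{j\in\mathbb N,k\in K},I_\bullet\}$ with $K$ finite such that (i) $I_{j,k}$ and $I_\bullet$ are non-empty connected subsets of $\mathbb R^d$; (ii) $\bigcup_{j,k}I_{j,k}\cup I_\bullet=\mathbb R^d$; (iii) $I_\bullet$ is a neighborhood of the origin and $I_{j,k}\cap\mathbb Z^d\ne\emptyset$ for all $j,k$; (iv) there is $N\in\mathbb N$ such that for each $(\bar j,\bar k)$ there are at most $N$ indices $(j,k)$ with $I_{\bar j,\bar k}\cap I_{j,k}\neq\emptyset$; (v) there are $c_{\min},c_{\max}>0$ such that $c_{\min}<|\omega|/2^j<c_{\max}$ for all $\omega\in I_{j,k}$, uniformly in $j,k$. Set $Z_{j,k}=I_{j,k}\cap\mathbb Z^d$. For $\nu>0$, $j\in\mathbb N$, $k\in K$, $\lambda\in\nu\mathbb Z^d$, $$\varphi_{j,k,\lambda}=T_{\lambda/2^j}\Big(\frac1{2^{jd/2}}\sum_{\eta\in Z_{j,k}}e^{2\pi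 i\eta\cdot t}\varphi(t)\Big).$$ $s$-admissibility of $(\varphi_\bullet,\varphi)$ (for Sobolev norms): put $\Phi_\bullet=\widehat{\varphi_\bullet}$ and $\Phi_{j,k}(\omega)=\sum_{\eta\in Z_{j,k}}\widehat\varphi(\omega-\eta)$. Then (i) there are $\alpha>d/2$ and a constant $C>0$ (independent of $j,k,\omega$) such that $|\Phi_\bullet(\omega)|\le C(1+|\omega|)^{-\alpha}$ for all $\omega$, $|\Phi_{j,k}(\omega)|\le C\,2^{jd/2}(1+d(\omega,I_{j,k}))^{-(\alpha+s)}$ for $\omega\notin I_{j,k}$, and $|\Phi_{j,k}(\omega)|\le C$ for all $\omega\in\mathbb R^d$; (ii) there is a constant $a>0$ such that $|\Phi_\bullet(\omega)|\ge a$ if $\omega\in I_\bullet$, and otherwise there exist $\bar j,\bar k$ with $\omega\in I_{\bar j,\bar k}$ and $|\Phi_{\bar j,\bar k}(\omega)|\ge a$, where $a$ does not depend on $\bar j,\bar k$. *)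

theory Defs
  imports "HOL-Analysis.Analysis"
begin

subsection \<open>Square-integrable functions and the Fourier transform\<close>

definition L2 :: "('a::euclidean_space \<Rightarrow> complex) set" where
  "L2 = {f \<in> borel_measurable lebesgue. integrable lebesgue (\<lambda>x. (cmod (f x))\<^sup>2)}"

definition L2_inner :: "('a::euclidean_space \<Rightarrow> complex) \<Rightarrow> ('a \<Rightarrow> complex) \<Rightarrow> complex" where
  "L2_inner f g = (LINT x|lebesgue. f x * cnj (g x))"

text \<open>Squared distance; the nonnegative integral yields \<open>\<infinity>\<close>, not 0, if the difference is not in \<open>L2\<close>.\<close>
definition L2_dist_sq :: "('a::euclidean_space \<Rightarrow> complex) \<Rightarrow> ('a \<Rightarrow> complex) \<Rightarrow> ennreal" where
  "L2_dist_sq f g = (\<integral>\<^sup>+x. ennreal ((cmod (f x - g x))\<^sup>2) \<partial>lebesgue)"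

definition fourier_integral :: "('a::euclidean_space \<Rightarrow> complex) \<Rightarrow> 'a \<Rightarrow> complex" where
  "fourier_integral u \<omega> = (LINT x|lebesgue. cis (- 2 * pi * (x \<bullet> \<omega>)) * u x)"

text \<open>
  The Fourier transform on \<open>L2\<close> is the continuous extension of the integral transform on
  \<open>L1 \<inter> L2\<close>: \<open>g\<close> is a transform of \<open>f\<close> if some sequence in \<open>L1 \<inter> L2\<close> tends to \<open>f\<close> in \<open>L2\<close>
  while its integral transforms tend to \<open>g\<close> in \<open>L2\<close>. By Plancherel's theorem such a \<open>g\<close> exists
  and is unique up to null sets. The function \<open>fourier_L2\<close> selects a representative, so only
  almost-everywhere statements about its values are meaningful.
\<close>
definition is_fourier_L2 :: "('a::euclidean_space \<Rightarrow> complex) \<Rightarrow> ('a \<Rightarrow> complex) \<Rightarrow> bool" where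
  "is_fourier_L2 f g \<longleftrightarrow> g \<in> L2 \<and>
     (\<exists>u::nat \<Rightarrow> 'a \<Rightarrow> complex.
        (\<forall>n. integrable lebesgue (u n) \<and> u n \<in> L2) \<and>
        (\<lambda>n. L2_dist_sq (u n) f) \<longlonglongrightarrow> 0 \<and>
        (\<lambda>n. L2_dist_sq (fourier_integral (u n)) g) \<longlonglongrightarrow> 0)"

definition fourier_L2 :: "('a::euclidean_space \<Rightarrow> complex) \<Rightarrow> 'a \<Rightarrow> complex" where
  "fourier_L2 f = (SOME g. is_fourier_L2 f g)"

text \<open>For \<open>s \<ge> 0\<close> the Sobolev space is a subspace of \<open>L2\<close>; the definitions are only used there.\<close>
definition sobolev :: "real \<Rightarrow> ('a::euclidean_space \<Rightarrow> complex) set" where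
  "sobolev s = {f \<in> L2. (\<lambda>\<omega>. complex_of_real ((1 + norm \<omega>) powr s) * fourier_L2 f \<omega>) \<in> L2}"

definition sobolev_norm :: "real \<Rightarrow> ('a::euclidean_space \<Rightarrow> complex) \<Rightarrow> real" where
  "sobolev_norm s f = sqrt (LINT \<omega>|lebesgue. (cmod (complex_of_real ((1 + norm \<omega>) powr s) * fourier_L2 f \<omega>))\<^sup>2)"

subsection \<open>Admissible partitions\<close>

definition int_lattice :: "(real ^ 'n) set" where
  "int_lattice = {x. \<forall>i. x $ i \<in> \<int>}"

definition scaled_lattice :: "real \<Rightarrow> (real ^ 'n) set" where
  "scaled_lattice \<nu> = (\<lambda>x. \<nu> *\<^sub>R x) ` int_lattice"

text \<open>The members of a partition may overlap, subject to the bound \<open>N\<close>.\<close>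
definition admissible_partition ::
    "'k set \<Rightarrow> (nat \<Rightarrow> 'k \<Rightarrow> (real ^ 'n) set) \<Rightarrow> (real ^ 'n) set \<Rightarrow> bool" where
  "admissible_partition K I I\<^sub>0 \<longleftrightarrow>
     finite K \<and>
     (\<forall>j. \<forall>k\<in>K. I j k \<noteq> {} \<and> connected (I j k)) \<and> I\<^sub>0 \<noteq> {} \<and> connected I\<^sub>0 \<and>
     (\<Union>j. \<Union>k\<in>K. I j k) \<union> I\<^sub>0 = UNIV \<and>
     0 \<in> interior I\<^sub>0 \<and> (\<forall>j. \<forall>k\<in>K. I j k \<inter> int_lattice \<noteq> {}) \<and>
     (\<exists>N::nat. \<forall>j'. \<forall>k'\<in>K.
        finite {(j, k). k \<in> K \<and> I j' k' \<inter> I j k \<noteq> {}} \<and>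
        card {(j, k). k \<in> K \<and> I j' k' \<inter> I j k \<noteq> {}} \<le> N) \<and>
     (\<exists>cmin>0. \<exists>cmax>0. \<forall>j. \<forall>k\<in>K. \<forall>\<omega>\<in>I j k.
        cmin < norm \<omega> / 2 ^ j \<and> norm \<omega> / 2 ^ j < cmax)"

subsection \<open>The function system\<close>

definition translation :: "'a::euclidean_space \<Rightarrow> ('a \<Rightarrow> complex) \<Rightarrow> 'a \<Rightarrow> complex" where
  "translation x f t = f (t - x)"

text \<open>
  In an admissible partition each \<open>I j k\<close> is bounded, so the sums over
  \<open>I j k \<inter> int_lattice\<close> below are genuine finite sums.
\<close>
definition packet ::
    "(nat \<Rightarrow> 'k \<Rightarrow> (real ^ 'n) set) \<Rightarrow> (real ^ 'n \<Rightarrow> complex) \<Rightarrow>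
     nat \<Rightarrow> 'k \<Rightarrow> real ^ 'n \<Rightarrow> real ^ 'n \<Rightarrow> complex" where
  "packet I \<phi> j k l = translation (l /\<^sub>R 2 ^ j)
     (\<lambda>t. complex_of_real (1 / 2 powr (real j * real CARD('n) / 2)) *
        (\<Sum>\<eta> \<in> I j k \<inter> int_lattice. cis (2 * pi * (\<eta> \<bullet> t)) * \<phi> t))"

definition packet_symbol ::
    "(nat \<Rightarrow> 'k \<Rightarrow> (real ^ 'n) set) \<Rightarrow> (real ^ 'n \<Rightarrow> complex) \<Rightarrow>
     nat \<Rightarrow> 'k \<Rightarrow> real ^ 'n \<Rightarrow> complex" where
  "packet_symbol I \<phi> j k \<omega> = (\<Sum>\<eta> \<in> I j k \<inter> int_lattice. fourier_L2 \<phi> (\<omega> - \<eta>))"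

definition s_admissible ::
    "real \<Rightarrow> 'k set \<Rightarrow> (nat \<Rightarrow> 'k \<Rightarrow> (real ^ 'n) set) \<Rightarrow> (real ^ 'n) set \<Rightarrow>
     (real ^ 'n \<Rightarrow> complex) \<Rightarrow> (real ^ 'n \<Rightarrow> complex) \<Rightarrow> bool" where
  "s_admissible s K I I\<^sub>0 \<phi>\<^sub>0 \<phi> \<longleftrightarrow>
     (\<exists>\<alpha> > real CARD('n) / 2. \<exists>C>0.
        (AE \<omega> in lebesgue. cmod (fourier_L2 \<phi>\<^sub>0 \<omega>) \<le> C * (1 + norm \<omega>) powr (- \<alpha>)) \<and>
        (\<forall>j. \<forall>k\<in>K. AE \<omega> in lebesgue. \<omega> \<notin> I j k \<longrightarrow>
           cmod (packet_symbol I \<phi> j k \<omega>)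
             \<le> C * 2 powr (real j * real CARD('n) / 2)
                 * (1 + infdist \<omega> (I j k)) powr (- (\<alpha> + s))) \<and>
        (\<forall>j. \<forall>k\<in>K. AE \<omega> in lebesgue. cmod (packet_symbol I \<phi> j k \<omega>) \<le> C)) \<and>
     (\<exists>a>0. AE \<omega> in lebesgue.
        if \<omega> \<in> I\<^sub>0 then a \<le> cmod (fourier_L2 \<phi>\<^sub>0 \<omega>)
        else (\<exists>j. \<exists>k\<in>K. \<omega> \<in> I j k \<and> a \<le> cmod (packet_symbol I \<phi> j k \<omega>)))"

end

theory Submission
  imports Defs
begin

text \<open>
  Let \<open>F\<close> be the Fourier transform of \<open>f\<close>. By Plancherel, the coefficients of \<open>f\<close> against the
  translates, by the multiples \<open>l / 2 ^ j\<close> of lattice points, of one packet with symbol \<open>\<Phi>\<close> are the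
  integrals of \<open>F * cnj \<Phi>\<close> against the characters of the torus of side \<open>L = 2 ^ j / \<nu>\<close>. If
  \<open>F * cnj \<Phi>\<close> were supported in the cube of side \<open>L\<close> around the origin, Parseval's identity on that
  cube (\<open>cube_parseval\<close>) would give their square sum exactly, as a constant times the integral of
  \<open>\<bar>F\<bar>\<^sup>2 \<bar>\<Phi>\<bar>\<^sup>2\<close>. The symbol of frequency level \<open>j\<close> lives at distance about \<open>2 ^ j\<close> from the origin, so
  for small \<open>\<nu>\<close> the cube contains its essential support. The part of \<open>F * cnj \<Phi>\<close> outside the cube is
  folded back onto it by periodization; \<open>alias_bessel\<close> bounds the square sum of its coefficients, and
  \<open>alias_constant\<close> shows that the decay of \<open>\<Phi>\<close> makes this error a multiple of \<open>\<nu>\<close>. The two parts are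
  put together in \<open>sampling_energy\<close>.

  Summed over all levels, the main terms are the integral of \<open>\<bar>F\<bar>\<^sup>2\<close> against the multiplier
  \<open>\<bar>\<Phi>\<^sub>0\<bar>\<^sup>2 + (\<Sum>j k. 2 powr (2 * j * s) * \<bar>\<Phi> j k\<bar>\<^sup>2)\<close>, with each summand cut off to its cube. This
  multiplier is comparable to \<open>(1 + norm \<omega>) powr (2 * s)\<close>. From below this is the covering property of
  the symbols. From above, \<open>symbol_multiplier_bound\<close> shows that at a frequency \<open>\<omega>\<close> only the
  boundedly many levels with \<open>2 ^ j\<close> comparable to \<open>norm \<omega>\<close> contribute a term of full size, while
  all the others contribute a geometrically small one. The errors sum to a multiple of \<open>\<nu>\<close> times the
  squared Sobolev norm, and for small \<open>\<nu>\<close> they are absorbed into the lower bound.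

  Parseval's identity on the cube follows from the density of trigonometric polynomials, which comes
  from the Stone-Weierstrass theorem on the torus. Plancherel's theorem in turn follows from Parseval:
  for a function \<open>u\<close> supported in a cube, the squared values of its transform on any translate of the
  lattice of step \<open>1 / L\<close> have the same sum, and integrating over the translates gives the norm of the
  transform. Density and completeness extend it to all of \<open>L2\<close>.
\<close>

text \<open>
  Countable sums of nonnegative terms are written as integrals over the counting measure, so that
  Tonelli's theorem and the Cauchy-Schwarz inequality for integrals apply to them directly.
\<close>
abbreviation lattice_sum :: "(real ^ 'n \<Rightarrow> ennreal) \<Rightarrow> ennreal" where
  "lattice_sum f \<equiv> (\<integral>\<^sup>+m. f m \<partial>count_space int_lattice)"

abbreviation energy :: "'a measure \<Rightarrow> ('a \<Rightarrow> complex) \<Rightarrow> ennreal" where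
  "energy M u \<equiv> (\<integral>\<^sup>+x. ennreal ((cmod (u x))\<^sup>2) \<partial>M)"

section \<open>Translation invariance of Lebesgue measure\<close>

text \<open>
  The affine change of variables for the completed measure is stated with one scaling factor for each
  basis vector; a translation is the case in which all factors are 1.
\<close>
lemma lebesgue_eq_distr_add: "distr lebesgue lebesgue (\<lambda>x. a + x) = (lebesgue :: 'a::euclidean_space measure)"
  and measurable_lebesgue_add: "(\<lambda>x. a + x) \<in> lebesgue \<rightarrow>\<^sub>M (lebesgue :: 'a::euclidean_space measure)"
proof -
  have eq: "(\<lambda>x. a + (\<Sum>j\<in>Basis. (1 * (x \<bullet> j)) *\<^sub>R j)) = (\<lambda>x. a + x)"
    by (simp add: euclidean_representation)
  show "distr lebesgue lebesgue (\<lambda>x. a + x) = (lebesgue :: 'a measure)"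
    using lebesgue_affine_euclidean[of "\<lambda>_. 1" a] unfolding eq
    by (simp add: density_1)
  show "(\<lambda>x. a + x) \<in> lebesgue \<rightarrow>\<^sub>M (lebesgue :: 'a measure)"
    using lebesgue_affine_measurable[of "\<lambda>_. 1" a] unfolding eq by simp
qed

lemma measurable_lebesgue_shift [measurable]:
  "(\<lambda>x. x + a) \<in> lebesgue \<rightarrow>\<^sub>M (lebesgue :: 'a::euclidean_space measure)"
  "(\<lambda>x. x - a) \<in> lebesgue \<rightarrow>\<^sub>M (lebesgue :: 'a::euclidean_space measure)"
  using measurable_lebesgue_add[of a] measurable_lebesgue_add[of "-a"] by (simp_all add: add.commute)

lemma nn_integral_lebesgue_shift:
  fixes a :: "'a::euclidean_space"
  assumes "f \<in> borel_measurable lebesgue"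
  shows "(\<integral>\<^sup>+x. f (x + a) \<partial>lebesgue) = (\<integral>\<^sup>+x. f x \<partial>lebesgue)"
  using assms by (subst (2) lebesgue_eq_distr_add[of a, symmetric])
    (simp add: nn_integral_distr measurable_lebesgue_add add.commute)

lemma integral_lebesgue_shift:
  fixes a :: "'a::euclidean_space" and f :: "'a \<Rightarrow> 'b::{banach, second_countable_topology}"
  assumes "f \<in> borel_measurable lebesgue"
  shows "integrable lebesgue (\<lambda>x. f (x + a)) \<longleftrightarrow> integrable lebesgue f"
    and "(\<integral>x. f (x + a) \<partial>lebesgue) = (\<integral>x. f x \<partial>lebesgue)"
proof -
  show "integrable lebesgue (\<lambda>x. f (x + a)) \<longleftrightarrow> integrable lebesgue f"
    using assms by (subst (2) lebesgue_eq_distr_add[of a, symmetric])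
      (simp add: integrable_distr_eq measurable_lebesgue_add add.commute)
  show "(\<integral>x. f (x + a) \<partial>lebesgue) = (\<integral>x. f x \<partial>lebesgue)"
    using assms by (subst (2) lebesgue_eq_distr_add[of a, symmetric])
      (simp add: integral_distr measurable_lebesgue_add add.commute)
qed

section \<open>Countable sums as integrals\<close>

lemma sum_le_nn_integral_count_space:
  fixes f :: "'a \<Rightarrow> ennreal"
  assumes "finite F" "F \<subseteq> A"
  shows "sum f F \<le> (\<integral>\<^sup>+x. f x \<partial>count_space A)"
proof -
  have "sum f F = (\<integral>\<^sup>+x. f x * indicator F x \<partial>count_space A)"
    using assms by (subst nn_integral_count_space'[of F]) (auto simp: indicator_def)
  also have "\<dots> \<le> (\<integral>\<^sup>+x. f x \<partial>count_space A)"
    by (intro nn_integral_mono) (auto simp: indicator_def)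
  finally show ?thesis .
qed

lemma term_le_nn_integral_count_space:
  fixes f :: "'a \<Rightarrow> ennreal"
  assumes "a \<in> A"
  shows "f a \<le> (\<integral>\<^sup>+x. f x \<partial>count_space A)"
  using sum_le_nn_integral_count_space[of "{a}" A f] assms by simp

lemma infsum_ennreal_eq_nn_integral:
  fixes f :: "'a \<Rightarrow> ennreal"
  assumes "countable A"
  shows "infsum f A = (\<integral>\<^sup>+x. f x \<partial>count_space A)"
proof -
  have inf: "infsum f A = (SUP F\<in>{F. finite F \<and> F \<subseteq> A}. sum f F)"
    by (intro nonneg_infsum_complete) auto
  show ?thesis
  proof (rule antisym)
    show "infsum f A \<le> (\<integral>\<^sup>+x. f x \<partial>count_space A)"
      unfolding inf
      by (intro SUP_least) (auto intro: sum_le_nn_integral_count_space)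
    show "(\<integral>\<^sup>+x. f x \<partial>count_space A) \<le> infsum f A"
    proof (cases "finite A")
      case True
      then show ?thesis by (simp add: nn_integral_count_space_finite)
    next
      case False
      have bij: "bij_betw (from_nat_into A) UNIV A"
        using assms False by (rule bij_betw_from_nat_into)
      have "(\<integral>\<^sup>+x. f x \<partial>count_space A) = (\<Sum>n. f (from_nat_into A n))"
        by (simp add: nn_integral_bij_count_space[OF bij, symmetric] nn_integral_count_space_nat)
      also have "\<dots> \<le> infsum f A"
      proof (rule suminf_le_const)
        show "summable (\<lambda>n. f (from_nat_into A n))" by simp
        fix n
        have "sum (\<lambda>n. f (from_nat_into A n)) {..<n} = sum f (from_nat_into A ` {..<n})"
          using bij by (subst sum.reindex) (auto simp: bij_betw_def intro: inj_on_subset)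
        also have "\<dots> \<le> infsum f A"
          unfolding inf by (rule SUP_upper) (use bij in \<open>auto simp: bij_betw_def\<close>)
        finally show "sum (\<lambda>n. f (from_nat_into A n)) {..<n} \<le> infsum f A" .
      qed
      finally show ?thesis .
    qed
  qed
qed

text \<open>
  A sum of nonnegative terms is the supremum of its finite partial sums.
\<close>
lemma nn_integral_count_space_leI:
  fixes f :: "'a \<Rightarrow> ennreal"
  assumes "countable A" and "\<And>F. finite F \<Longrightarrow> F \<subseteq> A \<Longrightarrow> sum f F \<le> c"
  shows "(\<integral>\<^sup>+x. f x \<partial>count_space A) \<le> c"
proof -
  have "infsum f A = (SUP F\<in>{F. finite F \<and> F \<subseteq> A}. sum f F)"
    by (intro nonneg_infsum_complete) auto
  also have "\<dots> \<le> c" using assms by (auto intro!: SUP_least)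
  finally show ?thesis using infsum_ennreal_eq_nn_integral[OF assms(1), of f] by simp
qed

section \<open>Tiling space by lattice translates of a cube\<close>

lemma countable_int_lattice: "countable (int_lattice :: (real ^ 'n) set)"
proof -
  have "int_lattice = range (\<lambda>f :: int ^ 'n. (\<chi> i. of_int (f $ i)) :: real ^ 'n)"
  proof (intro set_eqI iffI)
    fix x :: "real ^ 'n" assume "x \<in> int_lattice"
    then have "x = (\<chi> i. of_int ((\<chi> i. \<lfloor>x $ i\<rfloor>) $ i))"
      by (auto simp: int_lattice_def vec_eq_iff Ints_def)
    then show "x \<in> range (\<lambda>f :: int ^ 'n. (\<chi> i. of_int (f $ i)) :: real ^ 'n)" by blast
  qed (auto simp: int_lattice_def)
  then show ?thesis by (metis countable_image countableI_type)
qed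

lemma int_lattice_closed [simp]: "0 \<in> int_lattice" "m \<in> int_lattice \<Longrightarrow> - m \<in> int_lattice"
  "m \<in> int_lattice \<Longrightarrow> n \<in> int_lattice \<Longrightarrow> m + n \<in> int_lattice"
  "m \<in> int_lattice \<Longrightarrow> n \<in> int_lattice \<Longrightarrow> m - n \<in> int_lattice"
  by (auto simp: int_lattice_def)

lemma inner_int_lattice: "m \<in> int_lattice \<Longrightarrow> n \<in> int_lattice \<Longrightarrow> m \<bullet> n \<in> \<int>"
  by (auto simp: int_lattice_def inner_vec_def)

text \<open>
  The half-open form makes the translates by \<open>L\<close> times a lattice point an exact partition of space.
\<close>
definition cube :: "real \<Rightarrow> (real ^ 'n) set" where
  "cube L = {x. \<forall>i. - (L / 2) \<le> x $ i \<and> x $ i < L / 2}"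

lemma cube_borel [measurable]: "cube L \<in> sets borel"
proof -
  have "cube L = (\<Inter>i. {x. - (L / 2) \<le> x $ i} \<inter> {x. x $ i < L / 2})"
    by (auto simp: cube_def)
  also have "\<dots> \<in> sets borel"
  proof (intro sets.finite_INT sets.Int)
    fix i
    show "{x :: real ^ 'n. - (L / 2) \<le> x $ i} \<in> sets borel"
      by (intro borel_closed closed_Collect_le continuous_intros)
    show "{x :: real ^ 'n. x $ i < L / 2} \<in> sets borel"
      by (intro borel_open open_Collect_less continuous_intros)
  qed auto
  finally show ?thesis .
qed

lemma cube_lebesgue [measurable]: "cube L \<in> sets lebesgue"
  using cube_borel by (simp add: borel_measurable_if sets_completionI_sets)

lemma box_cube_cbox:
  fixes L :: real
  shows "box (\<chi> i. - (L / 2)) (\<chi> i. L / 2) \<subseteq> (cube L :: (real ^ 'n) set)"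
    and "(cube L :: (real ^ 'n) set) \<subseteq> cbox (\<chi> i. - (L / 2)) (\<chi> i. L / 2)"
  by (auto simp: cube_def mem_box_cart less_imp_le)

text \<open>
  The open and the closed box around the cube have the same volume.
\<close>
lemma emeasure_cube:
  assumes "L > 0"
  shows "emeasure lebesgue (cube L :: (real ^ 'n) set) = ennreal (L ^ CARD('n))"
proof -
  let ?a = "(\<chi> i. - (L / 2)) :: real ^ 'n" and ?b = "(\<chi> i. L / 2) :: real ^ 'n"
  have prod: "(\<Prod>b\<in>Basis. (?b - ?a) \<bullet> b) = L ^ CARD('n)"
  proof -
    have "(?b - ?a) \<bullet> b = L" if "b \<in> Basis" for b
      using that by (auto simp: Basis_vec_def inner_axis)
    then have "(\<Prod>b\<in>Basis. (?b - ?a) \<bullet> b) = (\<Prod>b\<in>(Basis :: (real ^ 'n) set). L)"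
      by (rule prod.cong[OF refl])
    then show ?thesis by simp
  qed
  have le: "?a \<bullet> b \<le> ?b \<bullet> b" if "b \<in> Basis" for b
    using that assms by (auto simp: Basis_vec_def inner_axis)
  show ?thesis
  proof (rule antisym)
    have "emeasure lebesgue (cube L :: (real ^ 'n) set) \<le> emeasure lebesgue (cbox ?a ?b)"
      by (intro emeasure_mono box_cube_cbox) auto
    also have "\<dots> = ennreal (L ^ CARD('n))"
      using le prod by (simp add: emeasure_lborel_cbox)
    finally show "emeasure lebesgue (cube L :: (real ^ 'n) set) \<le> ennreal (L ^ CARD('n))" .
    have "ennreal (L ^ CARD('n)) = emeasure lebesgue (box ?a ?b)"
      using le prod by (simp add: emeasure_lborel_box)
    also have "\<dots> \<le> emeasure lebesgue (cube L :: (real ^ 'n) set)"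
      by (intro emeasure_mono box_cube_cbox) auto
    finally show "ennreal (L ^ CARD('n)) \<le> emeasure lebesgue (cube L :: (real ^ 'n) set)" .
  qed
qed

lemma emeasure_cube_finite: "emeasure lebesgue (cube L :: (real ^ 'n) set) < \<infinity>"
proof -
  have "emeasure lebesgue (cube L :: (real ^ 'n) set) \<le> emeasure lebesgue (cbox (\<chi> i. - (L / 2)) (\<chi> i. L / 2) :: (real ^ 'n) set)"
    by (intro emeasure_mono box_cube_cbox) auto
  also have "\<dots> < \<infinity>" by (simp add: emeasure_lborel_cbox_eq)
  finally show ?thesis .
qed

lemma small_norm_in_cube:
  fixes x :: "real ^ 'n"
  shows "norm x < L / 2 \<Longrightarrow> x \<in> cube L" 
proof -
  assume *: "norm x < L / 2"
  have "- (L / 2) \<le> x $ i \<and> x $ i < L / 2" for i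
    using component_le_norm_cart[of x i] * by linarith
  then show "x \<in> cube L" unfolding cube_def by blast
qed

text \<open>
  The lattice point is found by rounding each coordinate of \<open>x / L\<close> to the nearest integer; the
  half-open cube decides the ties.
\<close>
lemma lattice_cube_unique:
  fixes x :: "real ^ 'n"
  assumes "L > 0"
  shows "\<exists>!m. m \<in> int_lattice \<and> x - L *\<^sub>R m \<in> cube L"
proof (intro ex_ex1I)
  let ?m = "(\<chi> i. of_int \<lfloor>x $ i / L + 1 / 2\<rfloor>) :: real ^ 'n"
  have "- (L / 2) \<le> x $ i - L * \<lfloor>x $ i / L + 1 / 2\<rfloor>" "x $ i - L * \<lfloor>x $ i / L + 1 / 2\<rfloor> < L / 2" for i
  proof -
    have "of_int \<lfloor>x $ i / L + 1 / 2\<rfloor> \<le> x $ i / L + 1 / 2" "x $ i / L + 1 / 2 < of_int \<lfloor>x $ i / L + 1 / 2\<rfloor> + 1"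
      by linarith+
    then have "L * of_int \<lfloor>x $ i / L + 1 / 2\<rfloor> \<le> L * (x $ i / L + 1 / 2)"
      "L * (x $ i / L + 1 / 2) < L * (of_int \<lfloor>x $ i / L + 1 / 2\<rfloor> + 1)"
      using assms by simp_all
    moreover have "L * (x $ i / L + 1 / 2) = x $ i + L / 2" using assms by (simp add: field_simps)
    ultimately show "- (L / 2) \<le> x $ i - L * \<lfloor>x $ i / L + 1 / 2\<rfloor>" "x $ i - L * \<lfloor>x $ i / L + 1 / 2\<rfloor> < L / 2"
      unfolding distrib_left by linarith+
  qed
  then have "?m \<in> int_lattice \<and> x - L *\<^sub>R ?m \<in> cube L"
    by (auto simp: int_lattice_def cube_def)
  then show "\<exists>m. m \<in> int_lattice \<and> x - L *\<^sub>R m \<in> cube L" by blast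
next
  fix m n assume m: "m \<in> int_lattice \<and> x - L *\<^sub>R m \<in> cube L" and n: "n \<in> int_lattice \<and> x - L *\<^sub>R n \<in> cube L"
  show "m = n"
  proof (subst vec_eq_iff, intro allI)
    fix i
    obtain a b where ab: "m $ i = of_int a" "n $ i = of_int b"
      using m n unfolding int_lattice_def Ints_def by blast
    have "- (L / 2) \<le> x $ i - L * a" "x $ i - L * a < L / 2" "- (L / 2) \<le> x $ i - L * b" "x $ i - L * b < L / 2"
    proof -
      have "- (L / 2) \<le> (x - L *\<^sub>R m) $ i \<and> (x - L *\<^sub>R m) $ i < L / 2"
        "- (L / 2) \<le> (x - L *\<^sub>R n) $ i \<and> (x - L *\<^sub>R n) $ i < L / 2"
        using m n by (auto simp: cube_def simp del: vector_minus_component)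
      then show "- (L / 2) \<le> x $ i - L * a" "x $ i - L * a < L / 2" "- (L / 2) \<le> x $ i - L * b" "x $ i - L * b < L / 2"
        by (simp_all add: ab)
    qed
    then have "L * (of_int a - of_int b) < L * 1" "L * (of_int b - of_int a) < L * 1"
      unfolding right_diff_distrib by linarith+
    then have "of_int a - of_int b < (1::real)" "of_int b - of_int a < (1::real)"
      using assms by (simp_all only: mult_less_cancel_left_pos)
    then have "a = b" by linarith
    then show "m $ i = n $ i" using ab by simp
  qed
qed

lemma nn_integral_lattice_uminus:
  "lattice_sum (\<lambda>m. f (- m)) = lattice_sum (\<lambda>m :: real ^ 'n. f m)"
proof -
  have "bij_betw uminus int_lattice (int_lattice :: (real ^ 'n) set)"
    by (rule bij_betw_byWitness[where f'=uminus]) auto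
  then show ?thesis by (rule nn_integral_bij_count_space)
qed

lemma lattice_sum_indicator_cube:
  fixes x :: "real ^ 'n"
  assumes L: "L > 0"
  shows "lattice_sum (\<lambda>m. indicator (cube L) (x - L *\<^sub>R m)) = (1 :: ennreal)"
    and "lattice_sum (\<lambda>m. indicator (cube L) (x + L *\<^sub>R m)) = (1 :: ennreal)"
proof -
  obtain m where m: "m \<in> int_lattice" "x - L *\<^sub>R m \<in> cube L"
    and un: "\<And>n. n \<in> int_lattice \<Longrightarrow> x - L *\<^sub>R n \<in> cube L \<Longrightarrow> n = m"
    using lattice_cube_unique[OF L, of x] by blast
  have zero: "indicator (cube L) (x - L *\<^sub>R n) = (0 :: ennreal)" if "n \<in> int_lattice" "n \<notin> {m}" for n
    using un[OF that(1)] that(2) by (auto simp: indicator_def)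
  have "lattice_sum (\<lambda>m. indicator (cube L) (x - L *\<^sub>R m))
      = (\<Sum>n\<in>{m}. indicator (cube L) (x - L *\<^sub>R n) :: ennreal)"
    by (rule nn_integral_count_space') (use m(1) zero in auto)
  then show minus: "lattice_sum (\<lambda>m. indicator (cube L) (x - L *\<^sub>R m)) = (1 :: ennreal)"
    using m(2) by simp
  then show "lattice_sum (\<lambda>m. indicator (cube L) (x + L *\<^sub>R m)) = (1 :: ennreal)"
    using nn_integral_lattice_uminus[of "\<lambda>m. indicator (cube L) (x - L *\<^sub>R m)"] by simp
qed

text \<open>
  Integrating a periodization over one cube is integrating over the whole space. This is how the sums
  over lattice translates are exchanged for integrals in the aliasing estimate and in Plancherel's theorem.
\<close>
lemma nn_integral_tile:
  fixes g :: "real ^ 'n \<Rightarrow> ennreal"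
  assumes L: "L > 0" and [measurable]: "g \<in> borel_measurable lebesgue"
  shows "(\<integral>\<^sup>+x. g x \<partial>lebesgue) =
    (\<integral>\<^sup>+x. lattice_sum (\<lambda>m. g (x + L *\<^sub>R m)) * indicator (cube L) x \<partial>lebesgue)"
proof -
  note 1 = lattice_sum_indicator_cube(1)[OF L]
  have "(\<integral>\<^sup>+x. g x \<partial>lebesgue) = (\<integral>\<^sup>+x. \<integral>\<^sup>+m. g x * indicator (cube L) (x - L *\<^sub>R m) \<partial>count_space int_lattice \<partial>lebesgue)"
  proof (intro nn_integral_cong)
    fix x :: "real ^ 'n"
    have "lattice_sum (\<lambda>m. g x * indicator (cube L) (x - L *\<^sub>R m)) = g x * 1"
      unfolding 1[of x, symmetric] by (rule nn_integral_cmult) simp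
    then show "g x = lattice_sum (\<lambda>m. g x * indicator (cube L) (x - L *\<^sub>R m))"
      by simp
  qed
  also have "\<dots> = (\<integral>\<^sup>+m. \<integral>\<^sup>+x. g x * indicator (cube L) (x - L *\<^sub>R m) \<partial>lebesgue \<partial>count_space int_lattice)"
    by (intro nn_integral_count_space_nn_integral countable_int_lattice) measurable
  also have "\<dots> = (\<integral>\<^sup>+m. \<integral>\<^sup>+x. g (x + L *\<^sub>R m) * indicator (cube L) x \<partial>lebesgue \<partial>count_space int_lattice)"
  proof (rule nn_integral_cong)
    fix m :: "real ^ 'n"
    have "(\<lambda>x. g x * indicator (cube L) (x - L *\<^sub>R m)) \<in> borel_measurable lebesgue" by measurable
    from nn_integral_lebesgue_shift[OF this, of "L *\<^sub>R m", symmetric]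
    show "(\<integral>\<^sup>+x. g x * indicator (cube L) (x - L *\<^sub>R m) \<partial>lebesgue) = (\<integral>\<^sup>+x. g (x + L *\<^sub>R m) * indicator (cube L) x \<partial>lebesgue)"
      by simp
  qed
  also have "\<dots> = (\<integral>\<^sup>+x. \<integral>\<^sup>+m. g (x + L *\<^sub>R m) * indicator (cube L) x \<partial>count_space int_lattice \<partial>lebesgue)"
    by (intro nn_integral_count_space_nn_integral[symmetric] countable_int_lattice) measurable
  also have "\<dots> = (\<integral>\<^sup>+x. lattice_sum (\<lambda>m. g (x + L *\<^sub>R m)) * indicator (cube L) x \<partial>lebesgue)"
    by (intro nn_integral_cong nn_integral_multc) auto
  finally show ?thesis .
qed

text \<open>
  Both integrals sweep a fundamental domain of the lattice once, so they agree for a periodic function.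
\<close>
lemma nn_integral_periodic_shift:
  fixes f :: "real ^ 'n \<Rightarrow> ennreal"
  assumes L: "L > 0" and [measurable]: "f \<in> borel_measurable lebesgue"
    and per: "\<And>x m. m \<in> int_lattice \<Longrightarrow> f (x + L *\<^sub>R m) = f x"
  shows "(\<integral>\<^sup>+x. f (x + a) * indicator (cube L) x \<partial>lebesgue) = (\<integral>\<^sup>+x. f x * indicator (cube L) x \<partial>lebesgue)"
proof -
  note 1 = lattice_sum_indicator_cube(2)[OF L]
  have meas: "(\<lambda>x. f x * indicator (cube L) (x - a)) \<in> borel_measurable lebesgue" by measurable
  have "(\<integral>\<^sup>+x. f (x + a) * indicator (cube L) x \<partial>lebesgue) = (\<integral>\<^sup>+x. f x * indicator (cube L) (x - a) \<partial>lebesgue)"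
    using nn_integral_lebesgue_shift[OF meas, of a] by simp
  also have "\<dots> = (\<integral>\<^sup>+x. lattice_sum (\<lambda>m. f (x + L *\<^sub>R m) * indicator (cube L) (x + L *\<^sub>R m - a)) * indicator (cube L) x \<partial>lebesgue)"
    by (rule nn_integral_tile[OF L meas])
  also have "\<dots> = (\<integral>\<^sup>+x. f x * indicator (cube L) x \<partial>lebesgue)"
  proof (rule nn_integral_cong)
    fix x :: "real ^ 'n"
    have "lattice_sum (\<lambda>m. f (x + L *\<^sub>R m) * indicator (cube L) (x + L *\<^sub>R m - a))
      = lattice_sum (\<lambda>m. f x * indicator (cube L) ((x - a) + L *\<^sub>R m))"
      by (rule nn_integral_cong) (simp add: per algebra_simps)
    also have "\<dots> = f x * 1"
      unfolding 1[of "x - a", symmetric] by (rule nn_integral_cmult) simp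
    finally show "lattice_sum (\<lambda>m. f (x + L *\<^sub>R m) * indicator (cube L) (x + L *\<^sub>R m - a)) * indicator (cube L) x = f x * indicator (cube L) x"
      by simp
  qed
  finally show ?thesis .
qed

section \<open>Characters of the torus and trigonometric polynomials\<close>

definition wave :: "real \<Rightarrow> real ^ 'n \<Rightarrow> real ^ 'n \<Rightarrow> complex" where
  "wave L n x = cis (2 * pi * (n \<bullet> x) / L)"

lemma wave_simps: "wave L m x * wave L n x = wave L (m + n) x" "cnj (wave L n x) = wave L (- n) x"
  "wave L 0 x = 1" "wave L n (x + y) = wave L n x * wave L n y"
  by (simp_all add: wave_def cis_mult cis_cnj inner_left_distrib inner_right_distrib add_divide_distrib ring_distribs)

lemma norm_wave [simp]: "cmod (wave L n x) = 1"
  by (simp add: wave_def)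

lemma wave_periodic: "L \<noteq> 0 \<Longrightarrow> n \<in> int_lattice \<Longrightarrow> m \<in> int_lattice \<Longrightarrow> wave L n (x + L *\<^sub>R m) = wave L n x"
proof -
  assume L: "L \<noteq> 0" and "n \<in> int_lattice" "m \<in> int_lattice"
  then obtain k where k: "n \<bullet> m = of_int k" using inner_int_lattice Ints_cases by metis
  have "wave L n (L *\<^sub>R m) = 1"
    using L cis_multiple_2pi[of "of_int k"] by (simp add: wave_def k mult.assoc)
  then show ?thesis by (simp add: wave_simps)
qed

lemma continuous_wave: "continuous_on UNIV (wave L n)"
proof -
  have "wave L n = (\<lambda>x. cis ((2 * pi / L) * (n \<bullet> x)))" by (simp add: wave_def fun_eq_iff)
  then show ?thesis by (simp only: cis.ctr Complex_eq) (intro continuous_intros)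
qed

lemma wave_measurable [measurable]: "wave L n \<in> borel_measurable lebesgue"
  by (rule measurable_completion) (simp add: borel_measurable_continuous_onI continuous_wave)

lemma space_cube: "space (lebesgue_on (cube L)) = cube L"
  by (simp add: space_restrict_space)

lemma finite_measure_cube: "finite_measure (lebesgue_on (cube L :: (real ^ 'n) set))"
  by (rule finite_measureI) (use emeasure_cube_finite[of L, where 'n='n] in \<open>simp add: emeasure_restrict_space space_restrict_space\<close>)

lemma emeasure_cube_space: "L > 0 \<Longrightarrow> emeasure (lebesgue_on (cube L)) (cube L :: (real ^ 'n) set) = ennreal (L ^ CARD('n))"
  by (subst emeasure_restrict_space) (simp_all add: emeasure_cube del: emeasure_completion)

lemma measure_cube: "L > 0 \<Longrightarrow> measure (lebesgue_on (cube L)) (cube L :: (real ^ 'n) set) = L ^ CARD('n)"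
  by (simp add: measure_def emeasure_cube_space)

lemma lebesgue_on_measurable [measurable (raw)]:
  "f \<in> borel_measurable lebesgue \<Longrightarrow> f \<in> borel_measurable (lebesgue_on S)"
  by (rule measurable_restrict_space1)

lemma integrable_wave: "integrable (lebesgue_on (cube L)) (wave L n)"
proof -
  interpret finite_measure "lebesgue_on (cube L :: (real ^ 'n) set)" by (rule finite_measure_cube)
  show "integrable (lebesgue_on (cube L)) (wave L n)"
    by (rule integrable_const_bound[of _ 1]) auto
qed

text \<open>
  Translation by half a period in a coordinate in which \<open>n\<close> does not vanish changes the sign of the
  wave, while it preserves the integral over a period; so the integral vanishes.
\<close>
lemma integral_wave:
  fixes n :: "real ^ 'n"
  assumes L: "L > 0" and n: "n \<in> int_lattice"
  shows "(LINT x|lebesgue_on (cube L). wave L n x) = (if n = 0 then of_real (L ^ CARD('n)) else 0)"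
proof (cases "n = 0")
  case True
  then show ?thesis using measure_cube[OF L, where 'n='n] by (simp add: wave_simps scaleR_conv_of_real space_cube)
next
  case False
  interpret finite_measure "lebesgue_on (cube L :: (real ^ 'n) set)" by (rule finite_measure_cube)
  from False obtain i where i: "n $ i \<noteq> 0" by (auto simp: vec_eq_iff)
  \<comment> \<open>Half a period of the wave in direction \<open>i\<close>.\<close>
  define a :: "real ^ 'n" where "a = axis i (L / (2 * n $ i))"
  have shift: "wave L n (x + a) = - wave L n x" for x
  proof -
    have "wave L n a = cis pi" using i L by (simp add: wave_def a_def inner_axis)
    then show ?thesis by (simp add: wave_simps)
  qed
  have zero: "(LINT x|lebesgue_on (cube L). f (wave L n x)) = 0"
    if f: "f = Re \<or> f = Im" for f
  proof -
    have lin: "f (- z) = - f z" "\<bar>f z\<bar> \<le> cmod z" for z using f abs_Re_le_cmod abs_Im_le_cmod by auto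
    have [measurable]: "f \<in> borel_measurable borel" using f by auto
    have int: "integrable (lebesgue_on (cube L)) (\<lambda>x. f (wave L n x))"
      by (rule integrable_const_bound[of _ 1]) (use lin(2)[of "wave L n _"] in auto)
    have pos: "f (wave L n x) \<ge> - 1" "f (wave L n x) \<le> 1" for x using lin(2)[of "wave L n x"] by auto
    have pos': "0 \<le> 1 + f (wave L n x)" "0 \<le> 1 - f (wave L n x)" for x
      using pos[of x] by auto
    have nn: "(\<integral>\<^sup>+x. ennreal (1 + c * f (wave L n x)) * indicator (cube L) x \<partial>lebesgue)
        = ennreal (LINT x|lebesgue_on (cube L). 1 + c * f (wave L n x))" if "c = 1 \<or> c = -1" for c
    proof -
      have "(\<integral>\<^sup>+x. ennreal (1 + c * f (wave L n x)) * indicator (cube L) x \<partial>lebesgue)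
        = (\<integral>\<^sup>+x. ennreal (1 + c * f (wave L n x)) \<partial>lebesgue_on (cube L))"
        by (simp add: nn_integral_restrict_space)
      also have "\<dots> = ennreal (LINT x|lebesgue_on (cube L). 1 + c * f (wave L n x))"
        using int pos' that
        by (intro nn_integral_eq_integral AE_I2) (auto simp: algebra_simps intro: order_trans)
      finally show ?thesis .
    qed
    have nonneg: "(LINT x|lebesgue_on (cube L). 1 + c * f (wave L n x)) \<ge> 0" if "c = 1 \<or> c = -1" for c
      using that pos' by (intro integral_nonneg_AE AE_I2) auto
    have "(\<integral>\<^sup>+x. ennreal (1 + 1 * f (wave L n (x + a))) * indicator (cube L) x \<partial>lebesgue)
       = (\<integral>\<^sup>+x. ennreal (1 + 1 * f (wave L n x)) * indicator (cube L) x \<partial>lebesgue)"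
      by (rule nn_integral_periodic_shift[OF L]) (use L n in \<open>auto simp: wave_periodic\<close>)
    then have "(\<integral>\<^sup>+x. ennreal (1 + (-1) * f (wave L n x)) * indicator (cube L) x \<partial>lebesgue)
       = (\<integral>\<^sup>+x. ennreal (1 + 1 * f (wave L n x)) * indicator (cube L) x \<partial>lebesgue)"
      by (simp add: shift lin)
    then have "(LINT x|lebesgue_on (cube L). 1 + (-1) * f (wave L n x)) = (LINT x|lebesgue_on (cube L). 1 + 1 * f (wave L n x))"
      using nn[of 1] nn[of "-1"] nonneg[of 1] nonneg[of "-1"] by simp
    then show ?thesis using int by simp
  qed
  have "Re (LINT x|lebesgue_on (cube L). wave L n x) = 0" "Im (LINT x|lebesgue_on (cube L). wave L n x) = 0"
    using zero integrable_wave[of L n] by (simp_all flip: integral_Re integral_Im)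
  then show ?thesis using False by (simp add: complex_eq_iff)
qed

text \<open>
  Closure under products and conjugates, which Stone-Weierstrass needs, is immediate by induction
  on the generation of a polynomial; \<open>trig_sum_waves\<close> recovers the form of a finite sum.
\<close>
inductive_set trig :: "real \<Rightarrow> (real ^ 'n \<Rightarrow> complex) set" for L where
  monomial: "n \<in> int_lattice \<Longrightarrow> (\<lambda>x. a * wave L n x) \<in> trig L"
| add: "p \<in> trig L \<Longrightarrow> q \<in> trig L \<Longrightarrow> (\<lambda>x. p x + q x) \<in> trig L"

lemma trig_const: "(\<lambda>x. c) \<in> trig L"
  using trig.monomial[of 0 c L] by (simp add: wave_simps)

lemma trig_mult: "p \<in> trig L \<Longrightarrow> q \<in> trig L \<Longrightarrow> (\<lambda>x. p x * q x) \<in> trig L"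
proof (induction rule: trig.induct)
  case (monomial n a)
  from \<open>q \<in> trig L\<close> monomial(1) show ?case
  proof (induction rule: trig.induct)
    case (monomial m b)
    have "(\<lambda>x. a * wave L n x * (b * wave L m x)) = (\<lambda>x. (a * b) * wave L (n + m) x)"
      by (auto simp: wave_simps(1)[symmetric])
    then show ?case using trig.monomial[of "n + m" "a * b" L] monomial by simp
  next
    case (add p q)
    then show ?case using trig.add by (fastforce simp: ring_distribs)
  qed
next
  case (add p q)
  then show ?case using trig.add by (fastforce simp: ring_distribs)
qed

lemma trig_cnj: "p \<in> trig L \<Longrightarrow> (\<lambda>x. cnj (p x)) \<in> trig L"
proof (induction rule: trig.induct)
  case (monomial n a)
  then show ?case using trig.monomial[of "- n" "cnj a" L] by (simp add: wave_simps)
next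
  case (add p q)
  then show ?case using trig.add by fastforce
qed

lemma trig_sum_waves:
  "p \<in> trig L \<Longrightarrow> \<exists>F a. finite F \<and> F \<subseteq> int_lattice \<and> p = (\<lambda>x. \<Sum>n\<in>F. a n * wave L n x)"
proof (induction rule: trig.induct)
  case (monomial n a)
  then show ?case by (intro exI[of _ "{n}"] exI[of _ "\<lambda>_. a"]) auto
next
  case (add p q)
  then obtain F a G b where F: "finite F" "F \<subseteq> int_lattice" "p = (\<lambda>x. \<Sum>n\<in>F. a n * wave L n x)"
    and G: "finite G" "G \<subseteq> int_lattice" "q = (\<lambda>x. \<Sum>n\<in>G. b n * wave L n x)" by blast
  define c where "c n = (if n \<in> F then a n else 0) + (if n \<in> G then b n else 0)" for n
  have "(\<Sum>n\<in>F. a n * wave L n x) = (\<Sum>n\<in>F\<union>G. (if n \<in> F then a n else 0) * wave L n x)"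
    "(\<Sum>n\<in>G. b n * wave L n x) = (\<Sum>n\<in>F\<union>G. (if n \<in> G then b n else 0) * wave L n x)" for x
    using F(1) G(1) by (auto intro!: sum.mono_neutral_cong_left)
  then have "(\<lambda>x. p x + q x) = (\<lambda>x. \<Sum>n\<in>F\<union>G. c n * wave L n x)"
    unfolding F(3) G(3) c_def by (simp add: ring_distribs sum.distrib)
  then show ?case using F(1,2) G(1,2) by (intro exI[of _ "F \<union> G"] exI[of _ c]) auto
qed

lemma trig_measurable: "p \<in> trig L \<Longrightarrow> p \<in> borel_measurable lebesgue"
  by (induction rule: trig.induct) measurable

section \<open>Density of trigonometric polynomials\<close>

text \<open>
  The quotient of space by \<open>L\<close> times the lattice, realised as a compact subset of \<open>complex ^ 'n\<close>.
\<close>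
definition torus_map :: "real \<Rightarrow> real ^ 'n \<Rightarrow> complex ^ 'n" where
  "torus_map L x = (\<chi> i. wave L (axis i 1) x)"

lemma axis_int_lattice [simp]: "axis i 1 \<in> int_lattice"
  by (auto simp: int_lattice_def axis_def)

lemma continuous_torus_map: "continuous_on S (torus_map L)"
  unfolding torus_map_def
  by (intro continuous_on_vec_lambda continuous_on_subset[OF continuous_wave]) auto

text \<open>
  Only boundary points of the cube are identified by the quotient map, so an interior point has no
  other preimage in the closed cube.
\<close>
lemma torus_map_inj:
  fixes x y :: "real ^ 'n"
  assumes L: "L > 0" and x: "x \<in> box (\<chi> i. - (L / 2)) (\<chi> i. L / 2)"
    and y: "y \<in> cbox (\<chi> i. - (L / 2)) (\<chi> i. L / 2)" and eq: "torus_map L x = torus_map L y"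
  shows "x = y"
proof (subst vec_eq_iff, intro allI)
  fix i
  have "cis (2 * pi * (x $ i) / L) = cis (2 * pi * (y $ i) / L)"
    using eq by (auto simp: torus_map_def wave_def vec_eq_iff inner_axis')
  then obtain k :: int where "2 * pi * (x $ i) / L = 2 * pi * (y $ i) / L + 2 * pi * k"
    using exp_eq[of "\<i> * of_real (2 * pi * (x $ i) / L)" "\<i> * of_real (2 * pi * (y $ i) / L)"]
    by (auto simp: cis_conv_exp complex_eq_iff algebra_simps)
  then have "2 * pi * (x $ i / L) = 2 * pi * (y $ i / L + k)" by (simp add: algebra_simps)
  then have "x $ i / L = y $ i / L + k" by (simp only: mult_cancel_left) simp
  then have k: "x $ i - y $ i = L * k" using L by (simp add: field_simps)
  have "- (L / 2) < x $ i" "x $ i < L / 2" "- (L / 2) \<le> y $ i" "y $ i \<le> L / 2"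
    using x y by (auto simp: mem_box_cart)
  then have "L * k < L * 1" "L * (- 1) < L * k" unfolding k[symmetric] by simp_all
  then have "of_int k < (1 :: real)" "- 1 < (of_int k :: real)"
    using L by (simp_all only: mult_less_cancel_left_pos)
  then have "k = 0" by linarith
  then show "x $ i = y $ i" using k by simp
qed

text \<open>
  Stone-Weierstrass on the image of the closed cube, for the real functions whose pullback is a
  trigonometric polynomial. They separate points because the real parts of the
  coordinates and of their multiples by the imaginary unit are among them.
\<close>
lemma torus_uniform_approximation:
  fixes G :: "complex ^ 'n \<Rightarrow> real"
  assumes L: "L > 0" and G: "continuous_on UNIV G" and e: "e > 0"
  shows "\<exists>p\<in>trig L. \<forall>x\<in>cube L. cmod (of_real (G (torus_map L x)) - p x) < e"
proof -
  let ?S = "torus_map L ` cbox (\<chi> i. - (L / 2)) (\<chi> i. L / 2) :: (complex ^ 'n) set"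
  let ?R = "{f. continuous_on ?S f \<and> (\<exists>p\<in>trig L. \<forall>x. complex_of_real (f (torus_map L x)) = p x)}"
  interpret function_ring_on ?R ?S
  proof
    show "compact ?S" by (intro compact_continuous_image continuous_torus_map compact_cbox)
    show "(\<lambda>_. c) \<in> ?R" for c using trig_const[of "of_real c" L] by (auto intro!: bexI[of _ "\<lambda>_. of_real c"])
    show "(\<lambda>x. f x + g x) \<in> ?R" if "f \<in> ?R" "g \<in> ?R" for f g
    proof -
      from that obtain p q where "p \<in> trig L" "q \<in> trig L" "\<forall>x. complex_of_real (f (torus_map L x)) = p x"
        "\<forall>x. complex_of_real (g (torus_map L x)) = q x" by auto
      then have "\<exists>p\<in>trig L. \<forall>x. complex_of_real (f (torus_map L x) + g (torus_map L x)) = p x"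
        by (intro bexI[OF _ trig.add[of p L q]]) auto
      then show ?thesis using that by (auto intro: continuous_on_add)
    qed
    show "(\<lambda>x. f x * g x) \<in> ?R" if "f \<in> ?R" "g \<in> ?R" for f g
    proof -
      from that obtain p q where "p \<in> trig L" "q \<in> trig L" "\<forall>x. complex_of_real (f (torus_map L x)) = p x"
        "\<forall>x. complex_of_real (g (torus_map L x)) = q x" by auto
      then have "\<exists>p\<in>trig L. \<forall>x. complex_of_real (f (torus_map L x) * g (torus_map L x)) = p x"
        by (intro bexI[OF _ trig_mult[of p L q]]) auto
      then show ?thesis using that by (auto intro: continuous_on_mult)
    qed
    have coord: "(\<lambda>z. Re (c * z $ i)) \<in> ?R" for c i
    proof -
      let ?p = "\<lambda>x. (1 / 2 * c) * wave L (axis i 1) x"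
      have p: "?p \<in> trig L" by (intro trig.monomial) simp
      have "complex_of_real (Re (c * torus_map L x $ i)) = ?p x + cnj (?p x)" for x
        unfolding complex_add_cnj by (simp add: torus_map_def)
      then show ?thesis
        using trig.add[OF p trig_cnj[OF p]]
        by (auto intro!: continuous_intros)
    qed
    show "\<exists>f\<in>?R. f x \<noteq> f y" if "x \<noteq> y" for x y
    proof -
      from that obtain i where i: "x $ i \<noteq> y $ i" by (auto simp: vec_eq_iff)
      then have "Re (1 * x $ i) \<noteq> Re (1 * y $ i) \<or> Re (\<i> * x $ i) \<noteq> Re (\<i> * y $ i)"
        by (auto simp: complex_eq_iff)
      then show ?thesis
        using bexI[OF _ coord[of 1 i], of "\<lambda>f. f x \<noteq> f y"] bexI[OF _ coord[of \<i> i], of "\<lambda>f. f x \<noteq> f y"]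
        by argo
    qed
  qed auto
  have "continuous_on ?S G" using G continuous_on_subset by blast
  from Stone_Weierstrass_basic[OF this e] obtain g where g: "g \<in> ?R" "\<forall>x\<in>?S. \<bar>G x - g x\<bar> < e" by blast
  then obtain p where p: "p \<in> trig L" "\<forall>x. complex_of_real (g (torus_map L x)) = p x" by auto
  have "cmod (of_real (G (torus_map L x)) - p x) < e" if "x \<in> cube L" for x
  proof -
    have "\<bar>G (torus_map L x) - g (torus_map L x)\<bar> < e"
      using g(2) that box_cube_cbox(2)[of L] by blast
    then show ?thesis using p(2)[rule_format, of x, symmetric]
      by (simp flip: of_real_diff)
  qed
  then show ?thesis using p by blast
qed

text \<open>
  The factor 2 replaces square roots of \<open>ennreal\<close> values in all triangle inequalities for the
  squared distance.
\<close>
lemma ennreal_norm_sq_triangle: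
  fixes a b c :: complex
  shows "ennreal ((cmod (a - c))\<^sup>2) \<le> 2 * ennreal ((cmod (a - b))\<^sup>2) + 2 * ennreal ((cmod (b - c))\<^sup>2)"
proof -
  have "cmod (a - c) \<le> cmod (a - b) + cmod (b - c)" using norm_triangle_ineq[of "a - b" "b - c"] by simp
  then have "(cmod (a - c))\<^sup>2 \<le> (cmod (a - b) + cmod (b - c))\<^sup>2" by (intro power_mono) auto
  also have "\<dots> \<le> 2 * (cmod (a - b))\<^sup>2 + 2 * (cmod (b - c))\<^sup>2"
    using sum_squares_bound[of "cmod (a - b)" "cmod (b - c)"] by (simp add: power2_sum)
  finally show ?thesis
    by (simp add: ennreal_leI flip: ennreal_plus ennreal_mult' ennreal_numeral)
qed

lemma nn_integral_sq_triangle: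
  fixes u v w :: "'a \<Rightarrow> complex"
  assumes [measurable]: "u \<in> borel_measurable M" "v \<in> borel_measurable M" "w \<in> borel_measurable M"
  shows "energy M (\<lambda>x. u x - w x)
     \<le> 2 * energy M (\<lambda>x. u x - v x) + 2 * energy M (\<lambda>x. v x - w x)"
proof -
  have "energy M (\<lambda>x. u x - w x)
     \<le> (\<integral>\<^sup>+x. 2 * ennreal ((cmod (u x - v x))\<^sup>2) + 2 * ennreal ((cmod (v x - w x))\<^sup>2) \<partial>M)"
    by (intro nn_integral_mono ennreal_norm_sq_triangle)
  then show ?thesis by (simp add: nn_integral_add nn_integral_cmult)
qed

text \<open>
  Membership in the closure of the trigonometric polynomials in the square-integrable functions on
  the cube; the lemmas below enlarge this class step by step to all of them.
\<close>
definition trig_approximable :: "real \<Rightarrow> (real ^ 'n \<Rightarrow> complex) \<Rightarrow> bool" where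
  "trig_approximable L u \<longleftrightarrow> u \<in> borel_measurable (lebesgue_on (cube L)) \<and>
     (\<forall>e>0. \<exists>p\<in>trig L. energy (lebesgue_on (cube L)) (\<lambda>x. u x - p x) < ennreal e)"

lemma trig_approximable_closure:
  fixes u :: "real ^ 'n \<Rightarrow> complex"
  assumes [measurable]: "u \<in> borel_measurable (lebesgue_on (cube L))"
    and cl: "\<And>e. e > 0 \<Longrightarrow> \<exists>v. trig_approximable L v \<and> (energy (lebesgue_on (cube L)) (\<lambda>x. u x - v x)) < ennreal e"
  shows "trig_approximable L u"
  unfolding trig_approximable_def
proof (intro conjI allI impI)
  fix e :: real assume e: "e > 0"
  then obtain v where v: "trig_approximable L v" "energy (lebesgue_on (cube L)) (\<lambda>x. u x - v x) < ennreal (e / 4)"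
    using cl[of "e / 4"] by auto
  then obtain p where p: "p \<in> trig L" "energy (lebesgue_on (cube L)) (\<lambda>x. v x - p x) < ennreal (e / 4)"
    using e unfolding trig_approximable_def by (meson divide_pos_pos zero_less_numeral)
  have [measurable]: "v \<in> borel_measurable (lebesgue_on (cube L))" "p \<in> borel_measurable (lebesgue_on (cube L))"
    using v(1) trig_measurable[OF p(1)] by (auto simp: trig_approximable_def intro: lebesgue_on_measurable)
  have "energy (lebesgue_on (cube L)) (\<lambda>x. u x - p x)
    \<le> 2 * energy (lebesgue_on (cube L)) (\<lambda>x. u x - v x) + 2 * energy (lebesgue_on (cube L)) (\<lambda>x. v x - p x)"
    by (rule nn_integral_sq_triangle) measurable
  also have "\<dots> < 2 * ennreal (e / 4) + 2 * ennreal (e / 4)"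
    using v(2) p(2) by (intro add_strict_mono ennreal_mult_strict_left_mono) auto
  also have "\<dots> = ennreal e"
    using e by (simp flip: ennreal_plus ennreal_mult' ennreal_numeral)
  finally show "\<exists>p\<in>trig L. energy (lebesgue_on (cube L)) (\<lambda>x. u x - p x) < ennreal e"
    using p(1) by blast
qed fact

lemma trig_approximable_limit:
  fixes u :: "real ^ 'n \<Rightarrow> complex"
  assumes [measurable]: "u \<in> borel_measurable (lebesgue_on (cube L))"
    and v: "\<And>k. trig_approximable L (v k)"
    and lim: "\<And>x. x \<in> cube L \<Longrightarrow> (\<lambda>k. v k x) \<longlonglongrightarrow> u x"
    and w[measurable]: "w \<in> borel_measurable (lebesgue_on (cube L))" "(\<integral>\<^sup>+x. w x \<partial>lebesgue_on (cube L)) < \<infinity>"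
    and dom: "\<And>k x. x \<in> cube L \<Longrightarrow> ennreal ((cmod (u x - v k x))\<^sup>2) \<le> w x"
  shows "trig_approximable L u"
proof (rule trig_approximable_closure)
  fix e :: real assume e: "e > 0"
  have [measurable]: "v k \<in> borel_measurable (lebesgue_on (cube L))" for k
    using v by (auto simp: trig_approximable_def)
  have "(\<lambda>k. \<integral>\<^sup>+x. ennreal ((cmod (u x - v k x))\<^sup>2) \<partial>lebesgue_on (cube L)) \<longlonglongrightarrow> (\<integral>\<^sup>+x. 0 \<partial>lebesgue_on (cube L :: (real ^ 'n) set))"
  proof (rule nn_integral_dominated_convergence[where w=w])
    show "AE x in lebesgue_on (cube L). (\<lambda>k. ennreal ((cmod (u x - v k x))\<^sup>2)) \<longlonglongrightarrow> 0"
    proof (rule AE_I2)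
      fix x :: "real ^ 'n" assume "x \<in> space (lebesgue_on (cube L))"
      then have "(\<lambda>k. v k x) \<longlonglongrightarrow> u x" using lim by (simp add: space_cube)
      then have "(\<lambda>k. ennreal ((cmod (u x - v k x))\<^sup>2)) \<longlonglongrightarrow> ennreal ((cmod (u x - u x))\<^sup>2)"
        by (intro tendsto_intros)
      then show "(\<lambda>k. ennreal ((cmod (u x - v k x))\<^sup>2)) \<longlonglongrightarrow> 0" by simp
    qed
  qed (use w dom in \<open>auto simp: space_cube\<close>)
  then have "\<forall>\<^sub>F k in sequentially. energy (lebesgue_on (cube L)) (\<lambda>x. u x - v k x) < ennreal e"
    using e by (intro order_tendstoD) auto
  then obtain k where "energy (lebesgue_on (cube L)) (\<lambda>x. u x - v k x) < ennreal e"
    by (auto simp: eventually_sequentially)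
  then show "\<exists>v. trig_approximable L v \<and> (energy (lebesgue_on (cube L)) (\<lambda>x. u x - v x)) < ennreal e"
    using v by blast
qed fact

lemma trig_approximable_torus:
  fixes G :: "complex ^ 'n \<Rightarrow> real"
  assumes L: "L > 0" and G: "continuous_on UNIV G"
  shows "trig_approximable L (\<lambda>x. of_real (G (torus_map L x)))"
proof -
  have "continuous_on UNIV (\<lambda>x. complex_of_real (G (torus_map L x)))"
    using continuous_on_compose2[OF G continuous_torus_map[of UNIV L]] by (intro continuous_intros) auto
  then have "(\<lambda>x. complex_of_real (G (torus_map L x))) \<in> borel_measurable lebesgue"
    by (intro measurable_completion) (simp add: borel_measurable_continuous_onI)
  then have meas[measurable]: "(\<lambda>x. complex_of_real (G (torus_map L x))) \<in> borel_measurable (lebesgue_on (cube L))"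
    by (rule lebesgue_on_measurable)
  show ?thesis unfolding trig_approximable_def
  proof (intro conjI allI impI meas)
    fix e :: real assume e: "e > 0"
    \<comment> \<open>An error of \<open>d\<close> on the cube has square integral \<open>e / 2\<close>, strictly below \<open>e\<close>.\<close>
    define d where "d = sqrt (e / (2 * L ^ CARD('n)))"
    have d: "d > 0" using e L by (simp add: d_def)
    obtain p where p: "p \<in> trig L" "\<forall>x\<in>cube L. cmod (of_real (G (torus_map L x)) - p x) < d"
      using torus_uniform_approximation[OF L G d] by blast
    have "energy (lebesgue_on (cube L)) (\<lambda>x. of_real (G (torus_map L x)) - p x)
      \<le> (\<integral>\<^sup>+x. ennreal (d\<^sup>2) \<partial>lebesgue_on (cube L :: (real ^ 'n) set))"
      using p(2) by (intro nn_integral_mono ennreal_leI power_mono) (auto simp: space_cube less_imp_le)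
    also have "\<dots> = ennreal (d\<^sup>2) * ennreal (L ^ CARD('n))"
      using emeasure_cube_space[OF L, where 'n='n] by (simp add: space_cube)
    also have "\<dots> = ennreal (e / 2)"
      using e L by (simp add: d_def flip: ennreal_mult)
    also have "\<dots> < ennreal e" using e by (simp add: ennreal_lessI)
    finally show "\<exists>p\<in>trig L. energy (lebesgue_on (cube L)) (\<lambda>x. of_real (G (torus_map L x)) - p x) < ennreal e"
      using p(1) by blast
  qed
qed

text \<open>
  The complement of \<open>T\<close> in the closed cube has a compact image \<open>C\<close> in the torus, and an interior point
  of the cube is in \<open>T\<close> exactly if its image is off \<open>C\<close>. The indicator of \<open>T\<close> is therefore a pointwise
  limit of continuous functions of the distance to \<open>C\<close> on the torus.
\<close>
lemma trig_approximable_open: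
  fixes T :: "(real ^ 'n) set"
  assumes L: "L > 0" and T: "open T" "T \<subseteq> box (\<chi> i. - (L / 2)) (\<chi> i. L / 2)"
  shows "trig_approximable L (indicator T)"
proof -
  let ?Q = "cbox (\<chi> i. - (L / 2)) (\<chi> i. L / 2) :: (real ^ 'n) set"
  define C where "C = torus_map L ` (?Q - T)"
  have "compact (?Q - T)" using T(1) by (intro compact_diff compact_cbox)
  then have "compact C" unfolding C_def by (intro compact_continuous_image continuous_torus_map)
  then have C: "closed C" by (rule compact_imp_closed)
  have "(\<chi> i. L / 2) \<in> ?Q - T" using T(2) L by (auto simp: mem_box_cart)
  then have C0: "C \<noteq> {}" unfolding C_def by blast
  define G where "G k z = min 1 (real k * infdist z C)" for k z
  have G: "continuous_on UNIV (G k)" for k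
    unfolding G_def by (intro continuous_intros)
  have lim: "(\<lambda>k. of_real (G k (torus_map L x))) \<longlonglongrightarrow> (indicator T x :: complex)" if x: "x \<in> cube L" for x
  proof (cases "x \<in> T")
    case False
    then have "torus_map L x \<in> C" using x box_cube_cbox(2)[of L] unfolding C_def by blast
    then have "G k (torus_map L x) = 0" for k by (simp add: G_def)
    then show ?thesis using False by simp
  next
    case True
    then have "torus_map L x \<notin> C" unfolding C_def using T(2) torus_map_inj[OF L, of x] by blast
    then have pos: "infdist (torus_map L x) C > 0"
      using C C0 infdist_pos_not_in_closed by blast
    obtain k0 :: nat where k0: "real k0 * infdist (torus_map L x) C > 1"
      using reals_Archimedean3[OF pos] by blast
    have "G k (torus_map L x) = 1" if "k \<ge> k0" for k
    proof -
      have "real k0 * infdist (torus_map L x) C \<le> real k * infdist (torus_map L x) C"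
        using that pos by (intro mult_right_mono) auto
      then show ?thesis using k0 by (simp add: G_def)
    qed
    then have "\<forall>\<^sub>F k in sequentially. complex_of_real (G k (torus_map L x)) = indicator T x"
      using True by (auto simp: eventually_sequentially)
    then show ?thesis by (rule tendsto_eventually)
  qed
  have [measurable]: "T \<in> sets lebesgue" using T(1) by auto
  show ?thesis
  proof (rule trig_approximable_limit)
    show "trig_approximable L (\<lambda>x. of_real (G k (torus_map L x)))" for k
      by (rule trig_approximable_torus[OF L G])
    show "(indicator T :: _ \<Rightarrow> complex) \<in> borel_measurable (lebesgue_on (cube L))"
      by (intro lebesgue_on_measurable) auto
    show "(\<integral>\<^sup>+x. 1 \<partial>lebesgue_on (cube L :: (real ^ 'n) set)) < \<infinity>"
      using emeasure_cube_space[OF L, where 'n='n] by (simp add: space_cube)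
    show "ennreal ((cmod (indicator T x - of_real (G k (torus_map L x))))\<^sup>2) \<le> 1" for k x
    proof -
      have "0 \<le> G k (torus_map L x)" "G k (torus_map L x) \<le> 1" by (auto simp: G_def infdist_nonneg)
      then have "cmod (of_real (indicator T x - G k (torus_map L x))) \<le> 1"
        unfolding norm_of_real by (auto simp: indicator_def)
      then have "(cmod (indicator T x - of_real (G k (torus_map L x))))\<^sup>2 \<le> 1\<^sup>2"
        by (intro power_mono) (auto simp: indicator_def split: if_splits)
      then show ?thesis using ennreal_leI by fastforce
    qed
  qed (use lim in auto)
qed

text \<open>
  By outer regularity \<open>S\<close> is approximated in measure by an open set, which may be cut down to the
  open cube because the boundary has measure zero.
\<close>
lemma trig_approximable_indicator:
  fixes S :: "(real ^ 'n) set"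
  assumes L: "L > 0" and S[measurable]: "S \<in> sets lebesgue"
  shows "trig_approximable L (indicator S)"
proof (rule trig_approximable_closure)
  show "(indicator S :: _ \<Rightarrow> complex) \<in> borel_measurable (lebesgue_on (cube L))"
    by (intro lebesgue_on_measurable) auto
  fix e :: real assume e: "e > 0"
  let ?B = "box (\<chi> i. - (L / 2)) (\<chi> i. L / 2) :: (real ^ 'n) set"
  obtain T where T: "open T" "S \<subseteq> T" "T - S \<in> lmeasurable" "emeasure lebesgue (T - S) < ennreal e"
    using sets_lebesgue_outer_open[OF S e] by blast
  have [measurable]: "T \<in> sets lebesgue" using T(1) by auto
  have B[measurable]: "?B \<in> sets lebesgue" by auto
  have null: "emeasure lebesgue (cube L - ?B) = 0"
  proof -
    let ?a = "(\<chi> i. - (L / 2)) :: real ^ 'n" and ?b = "(\<chi> i. L / 2) :: real ^ 'n"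
    have "cube L - ?B \<subseteq> cbox ?a ?b - ?B" using box_cube_cbox(2)[of L] by blast
    moreover have "negligible (cbox ?a ?b - ?B)" by (rule negligible_frontier_interval)
    ultimately have "negligible (cube L - ?B)" using negligible_subset by blast
    then show ?thesis by (simp add: negligible_iff_emeasure0)
  qed
  have "energy (lebesgue_on (cube L)) (\<lambda>x. indicator S x - indicator (T \<inter> ?B) x)
     = (\<integral>\<^sup>+x. ennreal ((cmod (indicator S x - indicator (T \<inter> ?B) x))\<^sup>2) * indicator (cube L) x \<partial>lebesgue)"
    by (subst nn_integral_restrict_space) auto
  also have "\<dots> \<le> (\<integral>\<^sup>+x. indicator (T - S) x + indicator (cube L - ?B) x \<partial>lebesgue)"
    using T(2) by (intro nn_integral_mono) (auto simp: indicator_def)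
  also have "\<dots> = emeasure lebesgue (T - S) + emeasure lebesgue (cube L - ?B)"
    by (subst nn_integral_add) auto
  also have "\<dots> < ennreal e" using T(4) null by simp
  finally have "energy (lebesgue_on (cube L)) (\<lambda>x. indicator S x - indicator (T \<inter> ?B) x) < ennreal e" .
  moreover have "trig_approximable L (indicator (T \<inter> ?B))"
    using T(1) by (intro trig_approximable_open[OF L]) auto
  ultimately show "\<exists>v. trig_approximable L v \<and> (energy (lebesgue_on (cube L)) (\<lambda>x. indicator S x - v x)) < ennreal e"
    by blast
qed

lemma trig_approximable_add:
  fixes u v :: "real ^ 'n \<Rightarrow> complex"
  assumes u: "trig_approximable L u" and v: "trig_approximable L v"
  shows "trig_approximable L (\<lambda>x. u x + v x)"
proof -
  have [measurable]: "u \<in> borel_measurable (lebesgue_on (cube L))" "v \<in> borel_measurable (lebesgue_on (cube L))"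
    using u v by (auto simp: trig_approximable_def)
  show ?thesis unfolding trig_approximable_def
  proof (intro conjI allI impI)
    fix e :: real assume e: "e > 0"
    then have "e / 4 > 0" by simp
    then obtain p q where p: "p \<in> trig L" "energy (lebesgue_on (cube L)) (\<lambda>x. u x - p x) < ennreal (e / 4)"
      and q: "q \<in> trig L" "energy (lebesgue_on (cube L)) (\<lambda>x. v x - q x) < ennreal (e / 4)"
      using u v unfolding trig_approximable_def by meson
    have [measurable]: "p \<in> borel_measurable (lebesgue_on (cube L))" "q \<in> borel_measurable (lebesgue_on (cube L))"
      using trig_measurable[OF p(1)] trig_measurable[OF q(1)] by (auto intro: lebesgue_on_measurable)
    have "energy (lebesgue_on (cube L)) (\<lambda>x. (u x + v x) - (p x + q x))
      \<le> 2 * energy (lebesgue_on (cube L)) (\<lambda>x. (u x + v x) - (p x + v x))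
       + 2 * energy (lebesgue_on (cube L)) (\<lambda>x. (p x + v x) - (p x + q x))"
      by (rule nn_integral_sq_triangle) measurable
    also have "\<dots> < 2 * ennreal (e / 4) + 2 * ennreal (e / 4)"
      using p(2) q(2) by (intro add_strict_mono ennreal_mult_strict_left_mono) auto
    also have "\<dots> = ennreal e"
      using e by (simp flip: ennreal_plus ennreal_mult' ennreal_numeral)
    finally show "\<exists>p\<in>trig L. energy (lebesgue_on (cube L)) (\<lambda>x. u x + v x - p x) < ennreal e"
      by (rule bexI[OF _ trig.add[OF p(1) q(1)]])
  qed measurable
qed

lemma trig_approximable_scale:
  fixes u :: "real ^ 'n \<Rightarrow> complex"
  assumes u: "trig_approximable L u"
  shows "trig_approximable L (\<lambda>x. c * u x)"
proof -
  have [measurable]: "u \<in> borel_measurable (lebesgue_on (cube L))"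
    using u by (auto simp: trig_approximable_def)
  show ?thesis unfolding trig_approximable_def
  proof (intro conjI allI impI)
    fix e :: real assume e: "e > 0"
    define d where "d = e / ((cmod c)\<^sup>2 + 1)"
    have c1: "(cmod c)\<^sup>2 + 1 > 0" by (simp add: add_nonneg_pos)
    have d: "d > 0" using e c1 by (simp add: d_def)
    then obtain p where p: "p \<in> trig L" "energy (lebesgue_on (cube L)) (\<lambda>x. u x - p x) < ennreal d"
      using u unfolding trig_approximable_def by meson
    have [measurable]: "p \<in> borel_measurable (lebesgue_on (cube L))"
      using trig_measurable[OF p(1)] by (auto intro: lebesgue_on_measurable)
    have "energy (lebesgue_on (cube L)) (\<lambda>x. c * u x - c * p x)
      = (\<integral>\<^sup>+x. ennreal ((cmod c)\<^sup>2) * ennreal ((cmod (u x - p x))\<^sup>2) \<partial>lebesgue_on (cube L))"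
      by (intro nn_integral_cong) (simp add: norm_mult power_mult_distrib ennreal_mult' flip: right_diff_distrib)
    also have "\<dots> = ennreal ((cmod c)\<^sup>2) * energy (lebesgue_on (cube L)) (\<lambda>x. u x - p x)"
      by (rule nn_integral_cmult) measurable
    also have "\<dots> \<le> ennreal ((cmod c)\<^sup>2) * ennreal d"
      using p(2) by (intro mult_left_mono) auto
    also have "\<dots> = ennreal ((cmod c)\<^sup>2 * d)" using d by (simp add: ennreal_mult)
    also have "\<dots> < ennreal e"
      using e c1 by (intro ennreal_lessI) (auto simp: d_def field_simps)
    finally show "\<exists>p\<in>trig L. energy (lebesgue_on (cube L)) (\<lambda>x. c * u x - p x) < ennreal e"
      by (rule bexI[OF _ trig_mult[OF trig_const p(1)]])
  qed measurable
qed

lemma trig_approximable_sum: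
  assumes "\<And>i. i \<in> A \<Longrightarrow> trig_approximable L (u i)"
  shows "trig_approximable L (\<lambda>x. \<Sum>i\<in>A. u i x)"
proof -
  have 0: "trig_approximable L (\<lambda>x. 0)"
    unfolding trig_approximable_def using trig_const[of 0 L] by (auto intro!: bexI[of _ "\<lambda>_. 0"])
  from assms show ?thesis
    by (induction A rule: infinite_finite_induct) (auto intro: 0 trig_approximable_add)
qed

text \<open>
  Simple functions that are dominated by \<open>2 * cmod (u x)\<close> converge to \<open>u\<close>.
\<close>
lemma trig_approximable_L2:
  fixes u :: "real ^ 'n \<Rightarrow> complex"
  assumes L: "L > 0" and u[measurable]: "u \<in> borel_measurable (lebesgue_on (cube L))"
    and fin: "energy (lebesgue_on (cube L)) u < \<infinity>"
  shows "trig_approximable L u"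
proof -
  obtain v where v: "\<And>i. simple_function (lebesgue_on (cube L)) (v i)"
    "\<And>x. x \<in> cube L \<Longrightarrow> (\<lambda>i. v i x) \<longlonglongrightarrow> u x"
    "\<And>i x. x \<in> cube L \<Longrightarrow> cmod (v i x) \<le> 2 * cmod (u x)"
    using borel_measurable_implies_sequence_metric[OF u, of 0] by (auto simp: space_cube) metis
  have approx: "trig_approximable L (v i)" for i
  proof -
    let ?A = "\<lambda>y. v i -` {y} \<inter> cube L"
    have "?A y \<in> sets lebesgue" for y
    proof -
      have "?A y \<in> sets (lebesgue_on (cube L))"
        using simple_functionD(2)[OF v(1)[of i], of "{y}"] by (simp add: space_cube)
      then show ?thesis by (simp add: sets_restrict_space_iff cube_lebesgue)
    qed
    then have "trig_approximable L (\<lambda>x. \<Sum>y\<in>v i ` cube L. y * indicator (?A y) x)"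
      by (intro trig_approximable_sum trig_approximable_scale trig_approximable_indicator[OF L])
    then obtain e1: "\<forall>e>0. \<exists>p\<in>trig L. energy (lebesgue_on (cube L)) (\<lambda>x. (\<Sum>y\<in>v i ` cube L. y * indicator (?A y) x) - p x) < ennreal e"
      unfolding trig_approximable_def by blast
    have fin: "finite (v i ` cube L)" using v(1)[of i] by (simp add: simple_function_def space_cube)
    have eq: "(\<Sum>y\<in>v i ` cube L. y * indicator (?A y) x) = v i x" if x: "x \<in> cube L" for x
    proof -
      have "(\<Sum>y\<in>v i ` cube L. y * indicator (?A y) x) = (\<Sum>y\<in>v i ` cube L. if y = v i x then y else 0)"
        using x by (intro sum.cong) (auto simp: indicator_def)
      then show ?thesis using x fin by simp
    qed
    have "energy (lebesgue_on (cube L)) (\<lambda>x. (\<Sum>y\<in>v i ` cube L. y * indicator (?A y) x) - p x)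
      = energy (lebesgue_on (cube L)) (\<lambda>x. v i x - p x)" for p
      by (intro nn_integral_cong) (use eq in \<open>simp add: space_cube\<close>)
    then show ?thesis
      using e1 borel_measurable_simple_function[OF v(1)[of i]] unfolding trig_approximable_def by simp
  qed
  show ?thesis
  proof (rule trig_approximable_limit[OF u approx v(2)])
    show "(\<lambda>x. 9 * ennreal ((cmod (u x))\<^sup>2)) \<in> borel_measurable (lebesgue_on (cube L))" by measurable
    show "(\<integral>\<^sup>+x. 9 * ennreal ((cmod (u x))\<^sup>2) \<partial>lebesgue_on (cube L)) < \<infinity>"
      using fin by (subst nn_integral_cmult) (auto simp: ennreal_mult_less_top)
    fix i and x :: "real ^ 'n" assume x: "x \<in> cube L"
    have "cmod (u x - v i x) \<le> 3 * cmod (u x)"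
      using v(3)[OF x, of i] norm_triangle_ineq4[of "u x" "v i x"] by linarith
    then have "(cmod (u x - v i x))\<^sup>2 \<le> (3 * cmod (u x))\<^sup>2" by (intro power_mono) auto
    then have "(cmod (u x - v i x))\<^sup>2 \<le> 9 * (cmod (u x))\<^sup>2" by (simp add: power_mult_distrib)
    then have "ennreal ((cmod (u x - v i x))\<^sup>2) \<le> ennreal (9 * (cmod (u x))\<^sup>2)" by (rule ennreal_leI)
    then show "ennreal ((cmod (u x - v i x))\<^sup>2) \<le> 9 * ennreal ((cmod (u x))\<^sup>2)"
      by (simp add: ennreal_mult')
  qed
qed

section \<open>Parseval and Bessel inequalities on a cube\<close>

lemma borel_measurable_cnj [measurable]: "cnj \<in> borel_measurable borel"
  by (intro borel_measurable_continuous_onI continuous_intros)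

lemma integral_wave_sum_norm_sq:
  fixes a :: "real ^ 'n \<Rightarrow> complex"
  assumes L: "L > 0" and F: "finite F" "F \<subseteq> int_lattice"
  shows "integrable (lebesgue_on (cube L)) (\<lambda>x. (cmod (\<Sum>n\<in>F. a n * wave L n x))\<^sup>2)"
    and "(LINT x|lebesgue_on (cube L). (cmod (\<Sum>n\<in>F. a n * wave L n x))\<^sup>2) = L ^ CARD('n) * (\<Sum>n\<in>F. (cmod (a n))\<^sup>2)"
proof -
  let ?p = "\<lambda>x. \<Sum>n\<in>F. a n * wave L n x"
  have eq: "complex_of_real ((cmod (?p x))\<^sup>2) = (\<Sum>n\<in>F. \<Sum>m\<in>F. (a n * cnj (a m)) * wave L (n - m) x)" for x
  proof -
    have "complex_of_real ((cmod (?p x))\<^sup>2) = ?p x * cnj (?p x)"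
      by (rule complex_norm_square)
    also have "\<dots> = (\<Sum>n\<in>F. \<Sum>m\<in>F. (a n * wave L n x) * cnj (a m * wave L m x))"
      by (simp add: sum_product)
    also have "\<dots> = (\<Sum>n\<in>F. \<Sum>m\<in>F. (a n * cnj (a m)) * wave L (n - m) x)"
      by (intro sum.cong refl) (simp add: wave_simps(1)[of L _ x "- _", simplified] wave_simps(2))
    finally show ?thesis .
  qed
  have int: "integrable (lebesgue_on (cube L)) (\<lambda>x. complex_of_real ((cmod (?p x))\<^sup>2))"
    unfolding eq by (intro Bochner_Integration.integrable_sum integrable_mult_right integrable_wave)
  show i: "integrable (lebesgue_on (cube L)) (\<lambda>x. (cmod (?p x))\<^sup>2)"
    using int by (simp only: complex_of_real_integrable_eq)
  have inner: "(\<Sum>m\<in>F. (a n * cnj (a m)) * (LINT x|lebesgue_on (cube L). wave L (n - m) x))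
      = of_real (L ^ CARD('n)) * of_real ((cmod (a n))\<^sup>2)" if "n \<in> F" for n
  proof -
    have "(\<Sum>m\<in>F. (a n * cnj (a m)) * (LINT x|lebesgue_on (cube L). wave L (n - m) x))
      = (\<Sum>m\<in>F. if m = n then a n * cnj (a n) * of_real (L ^ CARD('n)) else 0)"
    proof (intro sum.cong refl)
      fix m assume "m \<in> F"
      then have "n - m \<in> int_lattice" using F(2) that by (intro int_lattice_closed(4)) auto
      from integral_wave[OF L this]
      show "(a n * cnj (a m)) * (LINT x|lebesgue_on (cube L). wave L (n - m) x)
        = (if m = n then a n * cnj (a n) * of_real (L ^ CARD('n)) else 0)" by auto
    qed
    also have "\<dots> = of_real (L ^ CARD('n)) * of_real ((cmod (a n))\<^sup>2)"
      using F(1) that by (simp only: sum.delta if_True complex_norm_square) (simp add: mult.commute)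
    finally show ?thesis .
  qed
  have "complex_of_real (LINT x|lebesgue_on (cube L). (cmod (?p x))\<^sup>2)
     = (LINT x|lebesgue_on (cube L). complex_of_real ((cmod (?p x))\<^sup>2))"
    by (simp only: integral_complex_of_real)
  also have "\<dots> = (\<Sum>n\<in>F. \<Sum>m\<in>F. (a n * cnj (a m)) * (LINT x|lebesgue_on (cube L). wave L (n - m) x))"
    unfolding eq by (simp add: integrable_wave)
  also have "\<dots> = complex_of_real (L ^ CARD('n) * (\<Sum>n\<in>F. (cmod (a n))\<^sup>2))"
    using inner by (simp add: sum_distrib_left)
  finally show "(LINT x|lebesgue_on (cube L). (cmod (?p x))\<^sup>2) = L ^ CARD('n) * (\<Sum>n\<in>F. (cmod (a n))\<^sup>2)"
    by (simp only: of_real_eq_iff)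
qed

text \<open>
  The integral runs over the whole space, so that a function that is not supported in the cube has
  the Fourier coefficients of its periodization.
\<close>
definition wave_coeff :: "real \<Rightarrow> (real ^ 'n \<Rightarrow> complex) \<Rightarrow> real ^ 'n \<Rightarrow> complex" where
  "wave_coeff L h n = (LINT x|lebesgue. h x * cnj (wave L n x))"

lemma integrable_mult_wave:
  assumes "integrable lebesgue h"
  shows "integrable lebesgue (\<lambda>x. h x * cnj (wave L n x))"
proof (rule Bochner_Integration.integrable_bound[OF assms])
  show "(\<lambda>x. h x * cnj (wave L n x)) \<in> borel_measurable lebesgue"
    using borel_measurable_integrable[OF assms] by measurable
qed (simp add: norm_mult)

lemma wave_coeff_diff:
  assumes "integrable lebesgue g" "integrable lebesgue h"
  shows "wave_coeff L (\<lambda>x. g x - h x) n = wave_coeff L g n - wave_coeff L h n"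
  using integrable_mult_wave[OF assms(1)] integrable_mult_wave[OF assms(2)]
  unfolding wave_coeff_def left_diff_distrib by simp

lemma measurable_nn_integral_count_space:
  fixes f :: "'i \<Rightarrow> 'a \<Rightarrow> ennreal"
  assumes "countable I" and [measurable]: "\<And>i. i \<in> I \<Longrightarrow> f i \<in> borel_measurable M"
  shows "(\<lambda>x. \<integral>\<^sup>+i. f i x \<partial>count_space I) \<in> borel_measurable M"
proof (cases "finite I")
  case True
  then show ?thesis by (simp add: nn_integral_count_space_finite)
next
  case False
  then have [simp]: "I \<noteq> {}" by auto
  have *: "bij_betw (from_nat_into I) UNIV I"
    using assms(1) False by (rule bij_betw_from_nat_into)
  have "(\<integral>\<^sup>+i. f i x \<partial>count_space I) = (\<Sum>n. f (from_nat_into I n) x)" for x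
    by (simp add: nn_integral_bij_count_space[symmetric, OF *] nn_integral_count_space_nat)
  moreover have "(\<lambda>x. \<Sum>n. f (from_nat_into I n) x) \<in> borel_measurable M"
    by (intro borel_measurable_suminf_order assms) (simp add: from_nat_into)
  ultimately show ?thesis by simp
qed

text \<open>
  Bessel's inequality for the periodization of \<open>h\<close>, without forming it. A finite square sum of
  coefficients is the integral of \<open>h\<close> against the conjugate of the trigonometric polynomial \<open>p\<close> with
  these coefficients. Since \<open>p\<close> is periodic, tiling turns that integral into one over the cube, where
  Cauchy-Schwarz is applied twice: to the sum over translates, which splits off \<open>G\<close> from \<open>b\<close>, and to
  the integral, which splits off \<open>p\<close>. The square norm of \<open>p\<close> is the square sum itself up to the
  volume, and one factor cancels. Splitting the sum over translates this way puts the square of \<open>b\<close>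
  under the lattice sum, which then converges as soon as \<open>b\<close> decays faster than with exponent half the
  dimension.
\<close>
lemma alias_bessel:
  fixes h :: "real ^ 'n \<Rightarrow> complex" and G b :: "real ^ 'n \<Rightarrow> real"
  assumes L: "L > 0" and h: "integrable lebesgue h"
    and [measurable]: "G \<in> borel_measurable lebesgue" "b \<in> borel_measurable lebesgue"
    and nonneg: "\<And>x. G x \<ge> 0" "\<And>x. b x \<ge> 0"
    and le: "AE x in lebesgue. cmod (h x) \<le> G x * b x"
    and \<kappa>: "\<And>x. x \<in> cube L \<Longrightarrow> lattice_sum (\<lambda>m. ennreal ((b (x + L *\<^sub>R m))\<^sup>2)) \<le> \<kappa>"
  shows "lattice_sum (\<lambda>n. ennreal ((cmod (wave_coeff L h n))\<^sup>2))
     \<le> ennreal (L ^ CARD('n)) * \<kappa> * (\<integral>\<^sup>+x. ennreal ((G x)\<^sup>2) \<partial>lebesgue)"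
proof (rule nn_integral_count_space_leI[OF countable_int_lattice])
  fix F :: "(real ^ 'n) set" assume F: "finite F" "F \<subseteq> int_lattice"
  define c where "c = wave_coeff L h"
  define S where "S = (\<Sum>n\<in>F. (cmod (c n))\<^sup>2)"
  \<comment> \<open>The polynomial dual to the coefficients: pairing it with \<open>h\<close> gives their square sum.\<close>
  define p where "p x = (\<Sum>n\<in>F. c n * wave L n x)" for x
  have S0: "S \<ge> 0" by (auto simp: S_def intro!: sum_nonneg)
  have p[measurable]: "p \<in> borel_measurable lebesgue" unfolding p_def by measurable
  have [measurable]: "h \<in> borel_measurable lebesgue" using h by auto
  have per: "p (x + L *\<^sub>R m) = p x" if "m \<in> int_lattice" for x m
    unfolding p_def using that F(2) L by (intro sum.cong refl) (auto simp: wave_periodic)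
  define X where "X x = lattice_sum (\<lambda>m. ennreal (G (x + L *\<^sub>R m)) * ennreal (b (x + L *\<^sub>R m)))" for x
  have [measurable]: "X \<in> borel_measurable lebesgue"
    unfolding X_def by (intro measurable_nn_integral_count_space countable_int_lattice) measurable
  have "complex_of_real S = (\<Sum>n\<in>F. cnj (c n) * (LINT x|lebesgue. h x * cnj (wave L n x)))"
    unfolding S_def of_real_sum complex_norm_square by (simp add: c_def wave_coeff_def mult.commute)
  also have "\<dots> = (LINT x|lebesgue. (\<Sum>n\<in>F. cnj (c n) * (h x * cnj (wave L n x))))"
    using integrable_mult_wave[OF h] by (subst Bochner_Integration.integral_sum) auto
  also have "\<dots> = (LINT x|lebesgue. h x * cnj (p x))"
    unfolding p_def cnj_sum sum_distrib_left by (simp add: mult_ac)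
  finally have "S = cmod (LINT x|lebesgue. h x * cnj (p x))" using S0 by (metis abs_of_nonneg norm_of_real)
  also have "ennreal (cmod (LINT x|lebesgue. h x * cnj (p x))) \<le> (\<integral>\<^sup>+x. ennreal (cmod (h x * cnj (p x))) \<partial>lebesgue)"
  proof (rule integral_norm_bound_ennreal)
    have "integrable lebesgue (\<lambda>x. \<Sum>n\<in>F. cnj (c n) * (h x * cnj (wave L n x)))"
      by (intro Bochner_Integration.integrable_sum integrable_mult_right integrable_mult_wave h)
    then show "integrable lebesgue (\<lambda>x. h x * cnj (p x))"
      unfolding p_def cnj_sum sum_distrib_left by (simp add: mult_ac)
  qed
  finally have S1: "ennreal S \<le> (\<integral>\<^sup>+x. ennreal (cmod (h x * cnj (p x))) \<partial>lebesgue)" .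
  also have "\<dots> \<le> (\<integral>\<^sup>+x. ennreal (G x) * ennreal (b x) * ennreal (cmod (p x)) \<partial>lebesgue)"
    using le nonneg by (intro nn_integral_mono_AE)
      (auto elim!: eventually_mono simp: norm_mult mult_right_mono ennreal_leI simp flip: ennreal_mult)
  also have "\<dots> = (\<integral>\<^sup>+x. lattice_sum (\<lambda>m. ennreal (G (x + L *\<^sub>R m)) * ennreal (b (x + L *\<^sub>R m)) * ennreal (cmod (p (x + L *\<^sub>R m)))) * indicator (cube L) x \<partial>lebesgue)"
    by (rule nn_integral_tile[OF L]) measurable
  also have "\<dots> = (\<integral>\<^sup>+x. lattice_sum (\<lambda>m. ennreal (G (x + L *\<^sub>R m)) * ennreal (b (x + L *\<^sub>R m)) * ennreal (cmod (p x))) * indicator (cube L) x \<partial>lebesgue)"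
    by (intro nn_integral_cong arg_cong2[where f="(*)"] refl) (simp add: per)
  also have "\<dots> = (\<integral>\<^sup>+x. X x * ennreal (cmod (p x)) \<partial>lebesgue_on (cube L))"
    unfolding X_def by (simp add: nn_integral_restrict_space nn_integral_multc)
  finally have S2: "ennreal S \<le> (\<integral>\<^sup>+x. X x * ennreal (cmod (p x)) \<partial>lebesgue_on (cube L))" .
  have X2: "(X x)\<^sup>2 \<le> lattice_sum (\<lambda>m. ennreal ((G (x + L *\<^sub>R m))\<^sup>2)) * \<kappa>" if "x \<in> cube L" for x
  proof -
    have "(X x)\<^sup>2 \<le> lattice_sum (\<lambda>m. (ennreal (G (x + L *\<^sub>R m)))\<^sup>2) * lattice_sum (\<lambda>m. (ennreal (b (x + L *\<^sub>R m)))\<^sup>2)"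
      unfolding X_def by (rule Cauchy_Schwarz_nn_integral) auto
    also have "\<dots> \<le> lattice_sum (\<lambda>m. ennreal ((G (x + L *\<^sub>R m))\<^sup>2)) * \<kappa>"
      using \<kappa>[OF that] nonneg by (intro mult_mono) (auto simp: ennreal_power)
    finally show ?thesis .
  qed
  let ?D = "L ^ CARD('n)" and ?E = "\<integral>\<^sup>+x. ennreal ((G x)\<^sup>2) \<partial>lebesgue"
  have "(ennreal S)\<^sup>2 \<le> (\<integral>\<^sup>+x. X x * ennreal (cmod (p x)) \<partial>lebesgue_on (cube L))\<^sup>2"
    using S2 by (rule power_mono) simp
  also have "\<dots> \<le> (\<integral>\<^sup>+x. (X x)\<^sup>2 \<partial>lebesgue_on (cube L)) * (\<integral>\<^sup>+x. (ennreal (cmod (p x)))\<^sup>2 \<partial>lebesgue_on (cube L))"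
    by (rule Cauchy_Schwarz_nn_integral) measurable
  also have "(\<integral>\<^sup>+x. (ennreal (cmod (p x)))\<^sup>2 \<partial>lebesgue_on (cube L)) = ennreal (?D * S)"
    using integral_wave_sum_norm_sq[OF L F, of c] unfolding p_def S_def
    by (simp add: ennreal_power nn_integral_eq_integral)
  also have "(\<integral>\<^sup>+x. (X x)\<^sup>2 \<partial>lebesgue_on (cube L)) * ennreal (?D * S) \<le> (\<kappa> * ?E) * ennreal (?D * S)"
  proof (rule mult_right_mono)
    have "(\<integral>\<^sup>+x. (X x)\<^sup>2 \<partial>lebesgue_on (cube L)) = (\<integral>\<^sup>+x. (X x)\<^sup>2 * indicator (cube L) x \<partial>lebesgue)"
      by (simp add: nn_integral_restrict_space)
    also have "\<dots> \<le> (\<integral>\<^sup>+x. \<kappa> * (lattice_sum (\<lambda>m. ennreal ((G (x + L *\<^sub>R m))\<^sup>2)) * indicator (cube L) x) \<partial>lebesgue)"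
      using X2 by (intro nn_integral_mono) (auto simp: indicator_def mult.commute)
    also have "\<dots> = \<kappa> * (\<integral>\<^sup>+x. lattice_sum (\<lambda>m. ennreal ((G (x + L *\<^sub>R m))\<^sup>2)) * indicator (cube L) x \<partial>lebesgue)"
    proof (rule nn_integral_cmult)
      have "(\<lambda>x. \<integral>\<^sup>+m. ennreal ((G (x + L *\<^sub>R m))\<^sup>2) \<partial>count_space int_lattice) \<in> borel_measurable lebesgue"
        by (rule measurable_nn_integral_count_space[OF countable_int_lattice]) measurable
      then show "(\<lambda>x. lattice_sum (\<lambda>m. ennreal ((G (x + L *\<^sub>R m))\<^sup>2)) * indicator (cube L) x) \<in> borel_measurable lebesgue"
        by measurable
    qed
    also have "\<dots> = \<kappa> * ?E" by (subst nn_integral_tile[OF L]) measurable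
    finally show "(\<integral>\<^sup>+x. (X x)\<^sup>2 \<partial>lebesgue_on (cube L)) \<le> \<kappa> * ?E" .
  qed simp
  finally have S3: "ennreal S * ennreal S \<le> ennreal S * (ennreal ?D * \<kappa> * ?E)"
    using L S0 by (simp add: power2_eq_square[of "ennreal S"] ennreal_mult mult_ac)
  have "(\<Sum>n\<in>F. ennreal ((cmod (wave_coeff L h n))\<^sup>2)) = ennreal S"
    unfolding S_def c_def by (subst sum_ennreal) auto
  also have "\<dots> \<le> ennreal ?D * \<kappa> * ?E"
  proof (cases "S = 0")
    case False
    then have "ennreal S \<noteq> 0" "ennreal S < top" using S0 by auto
    then show ?thesis using S3 by (subst (asm) ennreal_mult_le_mult_iff) auto
  qed simp
  finally show "(\<Sum>n\<in>F. ennreal ((cmod (wave_coeff L h n))\<^sup>2)) \<le> ennreal ?D * \<kappa> * ?E" .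
qed

lemma integrable_of_square_integrable:
  fixes u :: "'a \<Rightarrow> complex"
  assumes [measurable]: "u \<in> borel_measurable M" "S \<in> sets M" and S: "emeasure M S < \<infinity>"
    and supp: "\<And>x. x \<in> space M \<Longrightarrow> x \<notin> S \<Longrightarrow> u x = 0"
    and fin: "energy M u < \<infinity>"
  shows "integrable M u"
proof (rule integrableI_bounded)
  have "(\<integral>\<^sup>+x. ennreal (cmod (u x)) \<partial>M) \<le> (\<integral>\<^sup>+x. indicator S x + ennreal ((cmod (u x))\<^sup>2) \<partial>M)"
  proof (rule nn_integral_mono)
    fix x assume x: "x \<in> space M"
    have "t \<le> 1 + t\<^sup>2" if "t \<ge> 0" for t :: real
      using sum_squares_bound[of t 1] that by (simp add: power2_eq_square) 
    then have "ennreal (cmod (u x)) \<le> ennreal (1 + (cmod (u x))\<^sup>2)" by (intro ennreal_leI) auto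
    then show "ennreal (cmod (u x)) \<le> indicator S x + ennreal ((cmod (u x))\<^sup>2)"
      using supp[OF x] by (cases "x \<in> S") auto
  qed
  also have "\<dots> = emeasure M S + energy M u"
    by (subst nn_integral_add) auto
  also have "\<dots> < \<infinity>" using S fin by (simp add: ennreal_add_less_top)
  finally show "(\<integral>\<^sup>+x. ennreal (cmod (u x)) \<partial>M) < \<infinity>" .
qed fact

text \<open>
  No trigonometric polynomial with frequencies in \<open>F\<close> is closer to \<open>u\<close> than the partial Fourier sum.
\<close>
lemma wave_sum_approximation_error:
  fixes u :: "real ^ 'n \<Rightarrow> complex"
  assumes L: "L > 0" and F: "finite F" "F \<subseteq> int_lattice"
    and [measurable]: "u \<in> borel_measurable (lebesgue_on (cube L))"
    and fin: "integrable (lebesgue_on (cube L)) (\<lambda>x. (cmod (u x))\<^sup>2)"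
    and u: "integrable (lebesgue_on (cube L)) u"
  shows "integrable (lebesgue_on (cube L)) (\<lambda>x. (cmod (u x - (\<Sum>n\<in>F. a n * wave L n x)))\<^sup>2)"
    and "(LINT x|lebesgue_on (cube L). (cmod (u x))\<^sup>2)
      \<le> (\<Sum>n\<in>F. (cmod (LINT x|lebesgue_on (cube L). u x * cnj (wave L n x)))\<^sup>2) / L ^ CARD('n)
       + (LINT x|lebesgue_on (cube L). (cmod (u x - (\<Sum>n\<in>F. a n * wave L n x)))\<^sup>2)"
proof -
  let ?M = "lebesgue_on (cube L) :: (real ^ 'n) measure" and ?D = "L ^ CARD('n)"
  let ?p = "\<lambda>x. \<Sum>n\<in>F. a n * wave L n x"
  define c where "c n = (LINT x|?M. u x * cnj (wave L n x))" for n
  have D: "?D > 0" using L by simp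
  have int: "integrable ?M (\<lambda>x. u x * cnj (wave L n x))" for n
    by (rule Bochner_Integration.integrable_bound[OF u]) (auto simp: norm_mult intro: lebesgue_on_measurable)
  have eq: "u x * cnj (?p x) = (\<Sum>n\<in>F. cnj (a n) * (u x * cnj (wave L n x)))" for x
    by (simp add: sum_distrib_left mult_ac)
  have intp: "integrable ?M (\<lambda>x. u x * cnj (?p x))"
    unfolding eq using int by auto
  have cross: "(LINT x|?M. u x * cnj (?p x)) = (\<Sum>n\<in>F. cnj (a n) * c n)"
    unfolding eq c_def using int by simp
  have sq: "(cmod (u x - ?p x))\<^sup>2 = (cmod (u x))\<^sup>2 - 2 * Re (u x * cnj (?p x)) + (cmod (?p x))\<^sup>2" for x
  proof -
    have "(cmod (z - w))\<^sup>2 = (cmod z)\<^sup>2 - 2 * Re (z * cnj w) + (cmod w)\<^sup>2" for z w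
      unfolding cmod_power2 by (simp add: power2_eq_square algebra_simps)
    then show ?thesis .
  qed
  note pint = integral_wave_sum_norm_sq[OF L F, of a]
  show "integrable ?M (\<lambda>x. (cmod (u x - ?p x))\<^sup>2)"
    unfolding sq using fin intp pint(1) by (intro Bochner_Integration.integrable_add Bochner_Integration.integrable_diff integrable_mult_right integrable_Re)
  have "(LINT x|?M. (cmod (u x - ?p x))\<^sup>2) =
     (LINT x|?M. (cmod (u x))\<^sup>2) - 2 * Re (\<Sum>n\<in>F. cnj (a n) * c n) + ?D * (\<Sum>n\<in>F. (cmod (a n))\<^sup>2)"
  proof -
    define r where "r x = u x * cnj (?p x)" for x
    have r: "integrable ?M r" "(LINT x|?M. r x) = (\<Sum>n\<in>F. cnj (a n) * c n)"
      using intp cross by (simp_all only: r_def[abs_def])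
    have "(LINT x|?M. (cmod (u x - ?p x))\<^sup>2) = (LINT x|?M. (cmod (u x))\<^sup>2 - 2 * Re (r x) + (cmod (?p x))\<^sup>2)"
      by (simp only: sq r_def)
    also have "\<dots> = (LINT x|?M. (cmod (u x))\<^sup>2) - 2 * (LINT x|?M. Re (r x)) + (LINT x|?M. (cmod (?p x))\<^sup>2)"
      using fin integrable_Re[OF r(1)] pint(1) by simp
    also have "(LINT x|?M. Re (r x)) = Re (\<Sum>n\<in>F. cnj (a n) * c n)"
      using r by (simp only: integral_Re)
    finally show ?thesis by (simp only: pint(2))
  qed
  moreover have "- (\<Sum>n\<in>F. (cmod (c n))\<^sup>2) / ?D \<le> - 2 * Re (\<Sum>n\<in>F. cnj (a n) * c n) + ?D * (\<Sum>n\<in>F. (cmod (a n))\<^sup>2)"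
  proof -
    have "- (cmod (c n))\<^sup>2 / ?D \<le> - 2 * Re (cnj (a n) * c n) + ?D * (cmod (a n))\<^sup>2" for n
    proof -
      have "0 \<le> (cmod (?D * a n - c n))\<^sup>2 / ?D" using D by simp
      also have "(cmod (?D * a n - c n))\<^sup>2 = ?D * ?D * (cmod (a n))\<^sup>2 - 2 * ?D * Re (cnj (a n) * c n) + (cmod (c n))\<^sup>2"
        unfolding cmod_power2 by (simp add: power2_eq_square algebra_simps)
      also have "\<dots> / ?D = ?D * (cmod (a n))\<^sup>2 - 2 * Re (cnj (a n) * c n) + (cmod (c n))\<^sup>2 / ?D"
      proof -
        have "(d * d * x - 2 * d * y + z) / d = d * x - 2 * y + z / d" if "d > 0" for d x y z :: real
          using that by (simp add: field_simps)
        from this[OF D] show ?thesis .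
      qed
      finally show ?thesis by simp
    qed
    then have "(\<Sum>n\<in>F. - (cmod (c n))\<^sup>2 / ?D) \<le> (\<Sum>n\<in>F. - 2 * Re (cnj (a n) * c n) + ?D * (cmod (a n))\<^sup>2)"
      by (rule sum_mono)
    then show ?thesis
      by (simp add: sum.distrib sum_subtractf sum_distrib_left sum_divide_distrib sum_negf)
  qed
  ultimately show "(LINT x|?M. (cmod (u x))\<^sup>2)
      \<le> (\<Sum>n\<in>F. (cmod (LINT x|?M. u x * cnj (wave L n x)))\<^sup>2) / ?D + (LINT x|?M. (cmod (u x - ?p x))\<^sup>2)"
    unfolding c_def[symmetric] by simp
qed

text \<open>
  The upper bound is \<open>alias_bessel\<close> with the indicator of the cube as \<open>b\<close>, for which there is no
  overlap. The lower bound is the density of trigonometric polynomials together with the minimality of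
  partial Fourier sums.
\<close>
lemma cube_parseval:
  fixes u :: "real ^ 'n \<Rightarrow> complex"
  assumes L: "L > 0" and [measurable]: "u \<in> borel_measurable lebesgue"
    and supp: "\<And>x. x \<notin> cube L \<Longrightarrow> u x = 0"
    and fin: "energy lebesgue u < \<infinity>"
  shows "integrable lebesgue u"
    and "lattice_sum (\<lambda>n. ennreal ((cmod (wave_coeff L u n))\<^sup>2))
      = ennreal (L ^ CARD('n)) * energy lebesgue u"
proof -
  let ?M = "lebesgue_on (cube L) :: (real ^ 'n) measure" and ?D = "L ^ CARD('n)"
  let ?T = "\<integral>\<^sup>+n. ennreal ((cmod (wave_coeff L u n))\<^sup>2) \<partial>count_space int_lattice"
  have D: "?D > 0" using L by simp
  show u: "integrable lebesgue u"
    using emeasure_cube_finite[of L, where 'n='n] supp fin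
    by (intro integrable_of_square_integrable[of u lebesgue "cube L"]) auto
  have uM: "integrable ?M u"
    using integrable_mult_indicator[OF _ u, of "cube L"] by (subst integrable_restrict_space) auto
  have nnM: "energy ?M u = energy lebesgue u"
    using supp by (subst nn_integral_restrict_space) (auto intro!: nn_integral_cong simp: indicator_def)
  have sq: "integrable ?M (\<lambda>x. (cmod (u x))\<^sup>2)"
    using fin unfolding nnM[symmetric] by (intro integrableI_bounded) auto
  have coeff: "(LINT x|?M. u x * cnj (wave L n x)) = wave_coeff L u n" for n
    unfolding wave_coeff_def using supp
    by (subst integral_restrict_space) (auto intro!: Bochner_Integration.integral_cong simp: indicator_def)
  have le: "?T \<le> ennreal ?D * energy lebesgue u"
  proof -
    have "?T \<le> ennreal ?D * 1 * energy lebesgue u"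
    proof (rule alias_bessel[OF L u, where b="indicator (cube L)"])
      show "AE x in lebesgue. cmod (u x) \<le> cmod (u x) * indicator (cube L) x"
        using supp by (intro AE_I2) (auto simp: indicator_def)
      fix x :: "real ^ 'n" assume x: "x \<in> cube L"
      have "m = 0" if "m \<in> int_lattice" "x + L *\<^sub>R m \<in> cube L" for m
      proof -
        have "- m \<in> int_lattice \<and> x - L *\<^sub>R (- m) \<in> cube L" "0 \<in> int_lattice \<and> x - L *\<^sub>R 0 \<in> cube L"
          using that x by auto
        then have "- m = 0" using lattice_cube_unique[OF L, of x] by blast
        then show ?thesis by simp
      qed
      then have zero: "ennreal ((indicator (cube L) (x + L *\<^sub>R m))\<^sup>2) = 0" if "m \<in> int_lattice" "m \<notin> {0}" for m
        using that by (auto simp: indicator_def)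
      have "lattice_sum (\<lambda>m. ennreal ((indicator (cube L) (x + L *\<^sub>R m))\<^sup>2))
        = (\<Sum>m\<in>{0}. ennreal ((indicator (cube L) (x + L *\<^sub>R m))\<^sup>2))"
        by (rule nn_integral_count_space') (use zero in auto)
      then show "lattice_sum (\<lambda>m. ennreal ((indicator (cube L) (x + L *\<^sub>R m))\<^sup>2)) \<le> 1"
        by (simp add: indicator_def)
    qed auto
    then show ?thesis by simp
  qed
  then have Tfin: "?T < \<infinity>" using fin by (auto simp: ennreal_mult_less_top intro: le_less_trans)
  then obtain t where t: "?T = ennreal t" "t \<ge> 0" by (cases ?T) auto
  let ?U = "LINT x|?M. (cmod (u x))\<^sup>2"
  have U: "energy lebesgue u = ennreal ?U"
    unfolding nnM[symmetric] using sq by (intro nn_integral_eq_integral) auto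
  have "?U \<le> t / ?D"
  proof (rule field_le_epsilon)
    fix e :: real assume e: "e > 0"
    have "trig_approximable L u"
      using fin unfolding nnM[symmetric] by (intro trig_approximable_L2[OF L]) auto
    then obtain p where p: "p \<in> trig L" "energy ?M (\<lambda>x. u x - p x) < ennreal e"
      using e unfolding trig_approximable_def by blast
    obtain F a where F: "finite F" "F \<subseteq> int_lattice" and pF: "p = (\<lambda>x. \<Sum>n\<in>F. a n * wave L n x)"
      using trig_sum_waves[OF p(1)] by blast
    note err = wave_sum_approximation_error[OF L F _ sq uM, of a]
    have i: "integrable ?M (\<lambda>x. (cmod (u x - p x))\<^sup>2)" unfolding pF by (rule err) measurable
    have "ennreal (LINT x|?M. (cmod (u x - p x))\<^sup>2) < ennreal e"
      using p(2) i by (subst (asm) nn_integral_eq_integral) auto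
    then have "(LINT x|?M. (cmod (u x - p x))\<^sup>2) \<le> e" using e by (simp add: ennreal_less_iff)
    moreover have "?U \<le> (\<Sum>n\<in>F. (cmod (wave_coeff L u n))\<^sup>2) / ?D + (LINT x|?M. (cmod (u x - p x))\<^sup>2)"
      unfolding pF coeff[symmetric] by (rule err(2)) measurable
    moreover have "(\<Sum>n\<in>F. (cmod (wave_coeff L u n))\<^sup>2) \<le> t"
    proof -
      have "ennreal (\<Sum>n\<in>F. (cmod (wave_coeff L u n))\<^sup>2) = (\<Sum>n\<in>F. ennreal ((cmod (wave_coeff L u n))\<^sup>2))"
        by (subst sum_ennreal) auto
      also have "\<dots> \<le> ?T" by (rule sum_le_nn_integral_count_space[OF F])
      finally show ?thesis using t by simp
    qed
    then have "(\<Sum>n\<in>F. (cmod (wave_coeff L u n))\<^sup>2) / ?D \<le> t / ?D" using D by (intro divide_right_mono) auto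
    ultimately show "?U \<le> t / ?D + e" by linarith
  qed
  then have "?D * ?U \<le> t" using D by (simp add: field_simps)
  then have "ennreal ?D * energy lebesgue u \<le> ?T"
    unfolding U t(1) using D by (simp add: ennreal_leI flip: ennreal_mult')
  with le show "?T = ennreal ?D * energy lebesgue u" by (rule antisym)
qed

section \<open>The Plancherel theorem for integrable functions\<close>

lemma fourier_integrand_measurable:
  fixes u :: "'a::euclidean_space \<Rightarrow> complex"
  assumes [measurable]: "u \<in> borel_measurable lebesgue"
  shows "(\<lambda>x. cis (c * (x \<bullet> \<omega>)) * u x) \<in> borel_measurable lebesgue"
proof -
  have [measurable]: "(\<lambda>x::'a. cis (c * (x \<bullet> \<omega>))) \<in> borel_measurable lebesgue"
    by (rule measurable_completion) (simp add: cis_conv_exp borel_measurable_continuous_onI continuous_intros)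
  show ?thesis by measurable
qed

lemma fourier_integrand_integrable:
  fixes u :: "'a::euclidean_space \<Rightarrow> complex"
  assumes "integrable lebesgue u"
  shows "integrable lebesgue (\<lambda>x. cis (c * (x \<bullet> \<omega>)) * u x)"
proof (rule Bochner_Integration.integrable_bound[OF assms])
  show "(\<lambda>x. cis (c * (x \<bullet> \<omega>)) * u x) \<in> borel_measurable lebesgue"
    using assms by (intro fourier_integrand_measurable) auto
qed (simp add: norm_mult)

lemma fourier_integral_add:
  assumes "integrable lebesgue u" "integrable lebesgue v"
  shows "fourier_integral (\<lambda>x. u x + v x) \<omega> = fourier_integral u \<omega> + fourier_integral v \<omega>"
  using fourier_integrand_integrable[OF assms(1), of "- 2 * pi" \<omega>] fourier_integrand_integrable[OF assms(2), of "- 2 * pi" \<omega>]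
  unfolding fourier_integral_def distrib_left by simp

lemma fourier_integral_diff:
  assumes "integrable lebesgue u" "integrable lebesgue v"
  shows "fourier_integral (\<lambda>x. u x - v x) \<omega> = fourier_integral u \<omega> - fourier_integral v \<omega>"
  using fourier_integrand_integrable[OF assms(1), of "- 2 * pi" \<omega>] fourier_integrand_integrable[OF assms(2), of "- 2 * pi" \<omega>]
  unfolding fourier_integral_def right_diff_distrib by simp

lemma fourier_integral_scale: "fourier_integral (\<lambda>x. c * u x) \<omega> = c * fourier_integral u \<omega>"
  unfolding fourier_integral_def by (simp add: mult.left_commute)

lemma fourier_integral_translation:
  assumes "u \<in> borel_measurable lebesgue"
  shows "fourier_integral (translation a u) \<omega> = cis (- 2 * pi * (a \<bullet> \<omega>)) * fourier_integral u \<omega>"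
proof -
  have [measurable]: "u \<in> borel_measurable lebesgue" by fact
  have meas: "(\<lambda>x. cis (- 2 * pi * (x \<bullet> \<omega>)) * u (x - a)) \<in> borel_measurable lebesgue"
    by (rule fourier_integrand_measurable) measurable
  have "fourier_integral (translation a u) \<omega> = (LINT x|lebesgue. cis (- 2 * pi * ((x + a) \<bullet> \<omega>)) * u (x + a - a))"
    unfolding fourier_integral_def translation_def
    by (rule integral_lebesgue_shift(2)[OF meas, of a, symmetric])
  also have "\<dots> = (LINT x|lebesgue. cis (- 2 * pi * (a \<bullet> \<omega>)) * (cis (- 2 * pi * (x \<bullet> \<omega>)) * u x))"
  proof (intro Bochner_Integration.integral_cong refl)
    fix x
    have "cis (- 2 * pi * ((x + a) \<bullet> \<omega>)) = cis (- 2 * pi * (a \<bullet> \<omega>)) * cis (- 2 * pi * (x \<bullet> \<omega>))"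
      unfolding cis_mult inner_add_left by (intro arg_cong[where f=cis]) (simp add: distrib_left)
    then show "cis (- 2 * pi * ((x + a) \<bullet> \<omega>)) * u (x + a - a)
      = cis (- 2 * pi * (a \<bullet> \<omega>)) * (cis (- 2 * pi * (x \<bullet> \<omega>)) * u x)"
      by (simp only: add_diff_cancel_right' mult.assoc)
  qed
  finally show ?thesis unfolding fourier_integral_def by simp
qed

lemma fourier_integral_modulation:
  "fourier_integral (\<lambda>t. cis (2 * pi * (\<eta> \<bullet> t)) * u t) \<omega> = fourier_integral u (\<omega> - \<eta>)"
  unfolding fourier_integral_def
proof (intro Bochner_Integration.integral_cong refl)
  fix x
  have "cis (- 2 * pi * (x \<bullet> \<omega>)) * cis (2 * pi * (\<eta> \<bullet> x)) = cis (- 2 * pi * (x \<bullet> (\<omega> - \<eta>)))"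
    unfolding cis_mult by (intro arg_cong[where f=cis]) (simp add: inner_diff_right inner_commute algebra_simps)
  then show "cis (- 2 * pi * (x \<bullet> \<omega>)) * (cis (2 * pi * (\<eta> \<bullet> x)) * u x) = cis (- 2 * pi * (x \<bullet> (\<omega> - \<eta>))) * u x"
    by (simp only: mult.assoc[symmetric])
qed

lemma fourier_integral_measurable:
  fixes u :: "'a::euclidean_space \<Rightarrow> complex"
  assumes u: "integrable lebesgue u"
  shows "fourier_integral u \<in> borel_measurable lebesgue"
proof -
  have "continuous_on UNIV (fourier_integral u)"
  proof (unfold continuous_on_sequentially, intro ballI allI impI, elim conjE)
    fix x :: "nat \<Rightarrow> 'a" and a assume x: "x \<longlonglongrightarrow> a"
    have "(\<lambda>n. LINT t|lebesgue. cis (- 2 * pi * (t \<bullet> x n)) * u t) \<longlonglongrightarrow> (LINT t|lebesgue. cis (- 2 * pi * (t \<bullet> a)) * u t)"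
    proof (rule integral_dominated_convergence)
      show "integrable lebesgue (\<lambda>t. cmod (u t))" using u by simp
      show "AE t in lebesgue. (\<lambda>n. cis (- 2 * pi * (t \<bullet> x n)) * u t) \<longlonglongrightarrow> cis (- 2 * pi * (t \<bullet> a)) * u t"
        unfolding cis_conv_exp by (intro AE_I2 tendsto_intros x)
      show "AE t in lebesgue. cmod (cis (- 2 * pi * (t \<bullet> x n)) * u t) \<le> cmod (u t)" for n
        by (simp add: norm_mult)
      show "(\<lambda>t. cis (- 2 * pi * (t \<bullet> a)) * u t) \<in> borel_measurable lebesgue"
        "(\<lambda>t. cis (- 2 * pi * (t \<bullet> x n)) * u t) \<in> borel_measurable lebesgue" for n
        using u by (intro fourier_integrand_measurable; simp)+
    qed
    then show "(fourier_integral u \<circ> x) \<longlonglongrightarrow> fourier_integral u a"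
      by (simp add: fourier_integral_def comp_def)
  qed
  then show ?thesis
    by (intro measurable_completion) (simp add: borel_measurable_continuous_onI)
qed

text \<open>
  The values of the transform on the lattice of step \<open>1 / L\<close> shifted by \<open>\<theta>\<close> are the coefficients on
  the cube of side \<open>L\<close> of \<open>u\<close> times a unimodular function, so by Parseval their square sum does
  not depend on \<open>\<theta>\<close>. Integrating over \<open>\<theta>\<close> in the cube of side \<open>1 / L\<close> sweeps the whole space, and the
  volumes of the two cubes cancel.
\<close>
lemma plancherel_cube_support:
  fixes u :: "real ^ 'n \<Rightarrow> complex"
  assumes L: "L > 0" and [measurable]: "u \<in> borel_measurable lebesgue"
    and supp: "\<And>x. x \<notin> cube L \<Longrightarrow> u x = 0"
    and fin: "energy lebesgue u < \<infinity>"
  shows "energy lebesgue (fourier_integral u) = energy lebesgue u"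
proof -
  let ?E = "\<integral>\<^sup>+x. ennreal ((cmod (u x))\<^sup>2) \<partial>lebesgue"
  have int: "integrable lebesgue u" by (rule cube_parseval(1)[OF L _ supp fin]) auto
  have [measurable]: "fourier_integral u \<in> borel_measurable lebesgue"
    by (rule fourier_integral_measurable[OF int])
  have lattice_sum: "lattice_sum (\<lambda>m. ennreal ((cmod (fourier_integral u (\<theta> + (1 / L) *\<^sub>R m)))\<^sup>2))
      = ennreal (L ^ CARD('n)) * ?E" for \<theta>
  proof -
    let ?v = "\<lambda>x. cis (- 2 * pi * (x \<bullet> \<theta>)) * u x"
    have "wave_coeff L ?v m = fourier_integral u (\<theta> + (1 / L) *\<^sub>R m)" for m
      unfolding wave_coeff_def fourier_integral_def
    proof (intro Bochner_Integration.integral_cong refl)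
      fix x
      have "cis (- 2 * pi * (x \<bullet> \<theta>)) * cnj (wave L m x) = cis (- 2 * pi * (x \<bullet> (\<theta> + (1 / L) *\<^sub>R m)))"
        unfolding wave_def cis_cnj cis_mult
        by (intro arg_cong[where f=cis]) (simp add: inner_add_right inner_commute algebra_simps)
      then show "cis (- 2 * pi * (x \<bullet> \<theta>)) * u x * cnj (wave L m x) = cis (- 2 * pi * (x \<bullet> (\<theta> + (1 / L) *\<^sub>R m))) * u x"
        by (metis mult.assoc mult.commute)
    qed
    moreover have "lattice_sum (\<lambda>m. ennreal ((cmod (wave_coeff L ?v m))\<^sup>2))
        = ennreal (L ^ CARD('n)) * energy lebesgue (\<lambda>x. ?v x)"
    proof (rule cube_parseval(2)[OF L])
      show "?v \<in> borel_measurable lebesgue" by (rule fourier_integrand_measurable) simp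
    qed (use supp fin in \<open>simp_all add: norm_mult\<close>)
    ultimately show ?thesis by (simp add: norm_mult)
  qed
  have "energy lebesgue (fourier_integral u)
    = (\<integral>\<^sup>+\<theta>. lattice_sum (\<lambda>m. ennreal ((cmod (fourier_integral u (\<theta> + (1 / L) *\<^sub>R m)))\<^sup>2)) * indicator (cube (1 / L)) \<theta> \<partial>lebesgue)"
    using L by (intro nn_integral_tile) auto
  also have "\<dots> = ennreal (L ^ CARD('n)) * ?E * emeasure lebesgue (cube (1 / L) :: (real ^ 'n) set)"
    unfolding lattice_sum by (rule nn_integral_cmult_indicator) simp
  also have "\<dots> = ennreal (L ^ CARD('n) * (1 / L) ^ CARD('n)) * ?E"
    using L by (simp add: emeasure_cube ennreal_mult mult_ac del: emeasure_completion)
  also have "\<dots> = ?E" using L by (simp flip: power_mult_distrib)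
  finally show ?thesis .
qed

text \<open>
  Young's inequality with a parameter that tends to 0 takes the place of the triangle
  inequality for the norm, since the square integrals are only known as \<open>ennreal\<close> values.
\<close>
lemma L2_limit_le:
  fixes f :: "'a \<Rightarrow> complex" and g :: "'b \<Rightarrow> complex"
  assumes [measurable]: "\<And>n. f\<^sub>n n \<in> borel_measurable M" "f \<in> borel_measurable M"
    "\<And>n. g\<^sub>n n \<in> borel_measurable N" "g \<in> borel_measurable N"
    and df: "(\<lambda>n. \<integral>\<^sup>+x. ennreal ((cmod (f\<^sub>n n x - f x))\<^sup>2) \<partial>M) \<longlonglongrightarrow> 0"
    and dg: "(\<lambda>n. \<integral>\<^sup>+x. ennreal ((cmod (g\<^sub>n n x - g x))\<^sup>2) \<partial>N) \<longlonglongrightarrow> 0"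
    and eq: "\<And>n. energy M (f\<^sub>n n) = energy N (g\<^sub>n n)"
  shows "energy M f \<le> energy N g"
proof -
  have young: "energy R u
      \<le> ennreal (1 + \<epsilon>) * energy R v + ennreal (1 + 1 / \<epsilon>) * energy R (\<lambda>x. u x - v x)"
    if [measurable]: "u \<in> borel_measurable R" "v \<in> borel_measurable R" and e: "\<epsilon> > 0" for u v :: "'c \<Rightarrow> complex" and R and \<epsilon> :: real
  proof -
    have pt: "(cmod z)\<^sup>2 \<le> (1 + \<epsilon>) * (cmod w)\<^sup>2 + (1 + 1 / \<epsilon>) * (cmod (z - w))\<^sup>2" for z w
    proof -
      have "cmod z \<le> cmod w + cmod (z - w)" using norm_triangle_ineq[of w "z - w"] by simp
      then have "(cmod z)\<^sup>2 \<le> (cmod w + cmod (z - w))\<^sup>2" by (intro power_mono) auto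
      also have "\<dots> \<le> (1 + \<epsilon>) * (cmod w)\<^sup>2 + (1 + 1 / \<epsilon>) * (cmod (z - w))\<^sup>2"
      proof -
        have "(a + b)\<^sup>2 \<le> (1 + \<epsilon>) * a\<^sup>2 + (1 + 1 / \<epsilon>) * b\<^sup>2" for a b :: real
        proof -
          have "0 \<le> (\<epsilon> * a - b)\<^sup>2 / \<epsilon>" using e by simp
          also have "\<dots> = \<epsilon> * a\<^sup>2 - 2 * a * b + b\<^sup>2 / \<epsilon>"
            using e by (simp add: field_simps power2_eq_square)
          finally show ?thesis by (simp add: power2_sum algebra_simps)
        qed
        then show ?thesis .
      qed
      finally show ?thesis .
    qed
    have "energy R u
      \<le> (\<integral>\<^sup>+x. ennreal (1 + \<epsilon>) * ennreal ((cmod (v x))\<^sup>2) + ennreal (1 + 1 / \<epsilon>) * ennreal ((cmod (u x - v x))\<^sup>2) \<partial>R)"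
      using e pt by (intro nn_integral_mono) (simp flip: ennreal_mult ennreal_plus add: ennreal_leI)
    then show ?thesis by (simp add: nn_integral_add nn_integral_cmult)
  qed
  let ?X = "\<integral>\<^sup>+x. ennreal ((cmod (f x))\<^sup>2) \<partial>M" and ?Y = "\<integral>\<^sup>+x. ennreal ((cmod (g x))\<^sup>2) \<partial>N"
  have bound: "?X \<le> ennreal (1 + \<epsilon>) * (ennreal (1 + \<epsilon>) * ?Y)" if e: "\<epsilon> > 0" for \<epsilon> :: real
  proof (rule LIMSEQ_le_const)
    let ?df = "\<lambda>n. \<integral>\<^sup>+x. ennreal ((cmod (f\<^sub>n n x - f x))\<^sup>2) \<partial>M" and ?dg = "\<lambda>n. \<integral>\<^sup>+x. ennreal ((cmod (g\<^sub>n n x - g x))\<^sup>2) \<partial>N"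
    have "(\<lambda>n. ennreal (1 + \<epsilon>) * (ennreal (1 + \<epsilon>) * ?Y + ennreal (1 + 1 / \<epsilon>) * ?dg n) + ennreal (1 + 1 / \<epsilon>) * ?df n)
      \<longlonglongrightarrow> ennreal (1 + \<epsilon>) * (ennreal (1 + \<epsilon>) * ?Y + ennreal (1 + 1 / \<epsilon>) * 0) + ennreal (1 + 1 / \<epsilon>) * 0"
      by (intro tendsto_add tendsto_const ennreal_tendsto_cmult dg df) auto
    then show "(\<lambda>n. ennreal (1 + \<epsilon>) * (ennreal (1 + \<epsilon>) * ?Y + ennreal (1 + 1 / \<epsilon>) * ?dg n) + ennreal (1 + 1 / \<epsilon>) * ?df n)
      \<longlonglongrightarrow> ennreal (1 + \<epsilon>) * (ennreal (1 + \<epsilon>) * ?Y)" by simp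
    have "?X \<le> ennreal (1 + \<epsilon>) * (ennreal (1 + \<epsilon>) * ?Y + ennreal (1 + 1 / \<epsilon>) * ?dg n) + ennreal (1 + 1 / \<epsilon>) * ?df n" for n
    proof -
      have "?X \<le> ennreal (1 + \<epsilon>) * energy M (f\<^sub>n n) + ennreal (1 + 1 / \<epsilon>) * ?df n"
        using young[of f M "f\<^sub>n n" \<epsilon>] e by (simp add: norm_minus_commute)
      also have "\<dots> \<le> ennreal (1 + \<epsilon>) * (ennreal (1 + \<epsilon>) * ?Y + ennreal (1 + 1 / \<epsilon>) * ?dg n) + ennreal (1 + 1 / \<epsilon>) * ?df n"
        unfolding eq using young[of "g\<^sub>n n" N g \<epsilon>] e by (intro add_mono mult_left_mono) auto
      finally show ?thesis .
    qed
    then show "\<exists>N. \<forall>n\<ge>N. ?X \<le> ennreal (1 + \<epsilon>) * (ennreal (1 + \<epsilon>) * ?Y + ennreal (1 + 1 / \<epsilon>) * ?dg n) + ennreal (1 + 1 / \<epsilon>) * ?df n"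
      by blast
  qed
  show "?X \<le> ?Y"
  proof (cases ?Y)
    case (real y)
    have "(\<lambda>k. ennreal ((1 + inverse (real (Suc k))) * ((1 + inverse (real (Suc k))) * y))) \<longlonglongrightarrow> ennreal ((1 + 0) * ((1 + 0) * y))"
      by (intro tendsto_ennrealI tendsto_mult tendsto_add tendsto_const LIMSEQ_inverse_real_of_nat)
    then have "(\<lambda>k. ennreal ((1 + inverse (real (Suc k))) * ((1 + inverse (real (Suc k))) * y))) \<longlonglongrightarrow> ?Y"
      by (simp add: real)
    moreover have "?X \<le> ennreal ((1 + inverse (real (Suc k))) * ((1 + inverse (real (Suc k))) * y))" for k
      using bound[of "inverse (real (Suc k))"] real by (simp add: ennreal_mult)
    ultimately show ?thesis by (intro LIMSEQ_le_const) auto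
  qed auto
qed

lemma L2_isometry_limit:
  fixes f :: "'a \<Rightarrow> complex" and g :: "'b \<Rightarrow> complex"
  assumes "\<And>n. f\<^sub>n n \<in> borel_measurable M" "f \<in> borel_measurable M"
    "\<And>n. g\<^sub>n n \<in> borel_measurable N" "g \<in> borel_measurable N"
    and "(\<lambda>n. \<integral>\<^sup>+x. ennreal ((cmod (f\<^sub>n n x - f x))\<^sup>2) \<partial>M) \<longlonglongrightarrow> 0"
    and "(\<lambda>n. \<integral>\<^sup>+x. ennreal ((cmod (g\<^sub>n n x - g x))\<^sup>2) \<partial>N) \<longlonglongrightarrow> 0"
    and "\<And>n. energy M (f\<^sub>n n) = energy N (g\<^sub>n n)"
  shows "energy M f = energy N g"
  using L2_limit_le[of f\<^sub>n M f g\<^sub>n N g] L2_limit_le[of g\<^sub>n N g f\<^sub>n M f] assms by (intro antisym) auto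

text \<open>
  The side is \<open>k + 1\<close> so that it is positive for every \<open>k\<close>.
\<close>
definition truncate :: "nat \<Rightarrow> (real ^ 'n \<Rightarrow> complex) \<Rightarrow> real ^ 'n \<Rightarrow> complex" where
  "truncate k u x = (if x \<in> cube (real (Suc k)) then u x else 0)"

lemma cube_mono: "a \<le> b \<Longrightarrow> cube a \<subseteq> (cube b :: (real ^ 'n) set)"
proof
  fix x :: "real ^ 'n" assume *: "a \<le> b" "x \<in> cube a"
  have "- (b / 2) \<le> x $ i \<and> x $ i < b / 2" for i
  proof -
    have "- (a / 2) \<le> x $ i \<and> x $ i < a / 2" using * by (auto simp: cube_def)
    then show ?thesis using *(1) by linarith
  qed
  then show "x \<in> cube b" by (simp add: cube_def)
qed

lemma truncate_eventually: "\<forall>\<^sub>F k in sequentially. truncate k u x = u x"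
proof -
  obtain k0 :: nat where k0: "2 * norm x < real k0" using reals_Archimedean2 by blast
  have "truncate k u x = u x" if "k \<ge> k0" for k
  proof -
    have "norm x < real (Suc k) / 2" using k0 that by simp
    then show ?thesis by (simp add: truncate_def small_norm_in_cube)
  qed
  then show ?thesis by (auto simp: eventually_sequentially)
qed

lemma truncate_measurable [measurable]:
  "u \<in> borel_measurable lebesgue \<Longrightarrow> truncate k u \<in> borel_measurable lebesgue"
proof -
  assume [measurable]: "u \<in> borel_measurable lebesgue"
  have "truncate k u = (\<lambda>x. indicator (cube (real (Suc k))) x * u x)"
    by (auto simp: truncate_def fun_eq_iff)
  then show ?thesis by simp
qed

lemma truncate_L2_limit:
  fixes u :: "real ^ 'n \<Rightarrow> complex"
  assumes [measurable]: "u \<in> borel_measurable lebesgue" and fin: "energy lebesgue u < \<infinity>"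
  shows "(\<lambda>k. \<integral>\<^sup>+x. ennreal ((cmod (truncate k u x - u x))\<^sup>2) \<partial>lebesgue) \<longlonglongrightarrow> 0"
proof -
  have "(\<lambda>k. \<integral>\<^sup>+x. ennreal ((cmod (truncate k u x - u x))\<^sup>2) \<partial>lebesgue) \<longlonglongrightarrow> (\<integral>\<^sup>+x. 0 \<partial>(lebesgue :: (real ^ 'n) measure))"
  proof (rule nn_integral_dominated_convergence[where w="\<lambda>x. ennreal ((cmod (u x))\<^sup>2)"])
    show "AE x in lebesgue. (\<lambda>k. ennreal ((cmod (truncate k u x - u x))\<^sup>2)) \<longlonglongrightarrow> 0"
    proof (rule AE_I2)
      fix x
      have "\<forall>\<^sub>F k in sequentially. ennreal ((cmod (truncate k u x - u x))\<^sup>2) = 0"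
        using truncate_eventually[of u x] by eventually_elim simp
      then show "(\<lambda>k. ennreal ((cmod (truncate k u x - u x))\<^sup>2)) \<longlonglongrightarrow> 0" by (rule tendsto_eventually)
    qed
  qed (use fin in \<open>auto simp: truncate_def\<close>)
  then show ?thesis by simp
qed

lemma truncate_square_integrable:
  fixes u :: "real ^ 'n \<Rightarrow> complex"
  assumes [measurable]: "u \<in> borel_measurable lebesgue" and fin: "energy lebesgue u < \<infinity>"
  shows "energy lebesgue (truncate k u) < \<infinity>" and "integrable lebesgue (truncate k u)"
proof -
  have "energy lebesgue (truncate k u) \<le> energy lebesgue u"
    by (intro nn_integral_mono) (auto simp: truncate_def)
  then show fin': "energy lebesgue (truncate k u) < \<infinity>" using fin by (rule le_less_trans)
  show "integrable lebesgue (truncate k u)"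
    by (rule cube_parseval(1)[OF _ _ _ fin', of "real (Suc k)"]) (auto simp: truncate_def)
qed

lemma plancherel_truncate_diff:
  fixes u v :: "real ^ 'n \<Rightarrow> complex"
  assumes [measurable]: "u \<in> borel_measurable lebesgue" and fin: "energy lebesgue u < \<infinity>"
  shows "energy lebesgue (\<lambda>\<omega>. fourier_integral (truncate k u) \<omega> - fourier_integral (truncate l u) \<omega>)
     = energy lebesgue (\<lambda>x. truncate k u x - truncate l u x)"
proof -
  let ?w = "\<lambda>x. truncate k u x - truncate l u x"
  have "energy lebesgue (\<lambda>\<omega>. fourier_integral ?w \<omega>) = energy lebesgue (\<lambda>x. ?w x)"
  proof (rule plancherel_cube_support)
    show "?w x = 0" if "x \<notin> cube (real (Suc (max k l)))" for x
      using that cube_mono[of "real (Suc k)" "real (Suc (max k l))"] cube_mono[of "real (Suc l)" "real (Suc (max k l))"]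
      by (auto simp: truncate_def)
    have "energy lebesgue (\<lambda>x. ?w x) \<le> energy lebesgue u"
      by (intro nn_integral_mono) (auto simp: truncate_def)
    then show "energy lebesgue (\<lambda>x. ?w x) < \<infinity>" using fin by (rule le_less_trans)
  qed auto
  then show ?thesis
    using truncate_square_integrable(2)[OF _ fin] by (simp add: fourier_integral_diff)
qed

text \<open>
  The transforms of the truncations converge pointwise, since the truncations converge in \<open>L1\<close>, and they
  form a Cauchy sequence in \<open>L2\<close> by Plancherel on cubes. Fatou's lemma identifies the two limits.
\<close>
lemma plancherel_L1_L2:
  fixes u :: "real ^ 'n \<Rightarrow> complex"
  assumes int: "integrable lebesgue u" and fin: "energy lebesgue u < \<infinity>"
  shows "energy lebesgue (fourier_integral u) = energy lebesgue u"
proof -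
  have [measurable]: "u \<in> borel_measurable lebesgue" using int by auto
  note tr = truncate_square_integrable[OF _ fin]
  have [measurable]: "fourier_integral u \<in> borel_measurable lebesgue" "fourier_integral (truncate k u) \<in> borel_measurable lebesgue" for k
    using int tr(2) by (auto intro: fourier_integral_measurable)
  have pw: "(\<lambda>k. fourier_integral (truncate k u) \<omega>) \<longlonglongrightarrow> fourier_integral u \<omega>" for \<omega>
    unfolding fourier_integral_def
  proof (rule integral_dominated_convergence)
    show "integrable lebesgue (\<lambda>t. cmod (u t))" using int by simp
    show "AE t in lebesgue. (\<lambda>k. cis (- 2 * pi * (t \<bullet> \<omega>)) * truncate k u t) \<longlonglongrightarrow> cis (- 2 * pi * (t \<bullet> \<omega>)) * u t"
      by (intro AE_I2 tendsto_mult tendsto_const tendsto_eventually truncate_eventually)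
    show "AE t in lebesgue. cmod (cis (- 2 * pi * (t \<bullet> \<omega>)) * truncate k u t) \<le> cmod (u t)" for k
      by (simp add: norm_mult truncate_def)
    show "(\<lambda>t. cis (- 2 * pi * (t \<bullet> \<omega>)) * u t) \<in> borel_measurable lebesgue"
      "(\<lambda>t. cis (- 2 * pi * (t \<bullet> \<omega>)) * truncate k u t) \<in> borel_measurable lebesgue" for k
      by (intro fourier_integrand_measurable; measurable)+
  qed
  have le: "energy lebesgue (\<lambda>\<omega>. fourier_integral (truncate k u) \<omega> - fourier_integral u \<omega>)
      \<le> energy lebesgue (\<lambda>x. truncate k u x - u x)" for k
  proof -
    have "energy lebesgue (\<lambda>\<omega>. fourier_integral (truncate k u) \<omega> - fourier_integral u \<omega>)
      = (\<integral>\<^sup>+\<omega>. liminf (\<lambda>l. ennreal ((cmod (fourier_integral (truncate k u) \<omega> - fourier_integral (truncate l u) \<omega>))\<^sup>2)) \<partial>lebesgue)"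
    proof (intro nn_integral_cong lim_imp_Liminf[symmetric])
      fix \<omega>
      show "(\<lambda>l. ennreal ((cmod (fourier_integral (truncate k u) \<omega> - fourier_integral (truncate l u) \<omega>))\<^sup>2))
        \<longlonglongrightarrow> ennreal ((cmod (fourier_integral (truncate k u) \<omega> - fourier_integral u \<omega>))\<^sup>2)"
        by (intro tendsto_intros pw)
    qed auto
    also have "\<dots> \<le> liminf (\<lambda>l. \<integral>\<^sup>+\<omega>. ennreal ((cmod (fourier_integral (truncate k u) \<omega> - fourier_integral (truncate l u) \<omega>))\<^sup>2) \<partial>lebesgue)"
      by (rule nn_integral_liminf) measurable
    also have "\<dots> = liminf (\<lambda>l. \<integral>\<^sup>+x. ennreal ((cmod (truncate k u x - truncate l u x))\<^sup>2) \<partial>lebesgue)"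
      using fin by (subst plancherel_truncate_diff) auto
    also have "\<dots> \<le> limsup (\<lambda>l. \<integral>\<^sup>+x. ennreal ((cmod (truncate k u x - truncate l u x))\<^sup>2) \<partial>lebesgue)"
      by (rule Liminf_le_Limsup) simp
    also have "\<dots> \<le> energy lebesgue (\<lambda>x. truncate k u x - u x)"
    proof (rule Limsup_bounded)
      show "\<forall>\<^sub>F l in sequentially. energy lebesgue (\<lambda>x. truncate k u x - truncate l u x)
        \<le> energy lebesgue (\<lambda>x. truncate k u x - u x)"
        using eventually_ge_at_top[of k]
      proof eventually_elim
        case (elim l)
        then have "cube (real (Suc k)) \<subseteq> (cube (real (Suc l)) :: (real ^ 'n) set)" by (intro cube_mono) simp
        then show ?case by (intro nn_integral_mono) (auto simp: truncate_def)
      qed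
    qed
    finally show ?thesis .
  qed
  show ?thesis
  proof (rule L2_isometry_limit)
    show lim: "(\<lambda>k. \<integral>\<^sup>+x. ennreal ((cmod (truncate k u x - u x))\<^sup>2) \<partial>lebesgue) \<longlonglongrightarrow> 0"
      by (rule truncate_L2_limit[OF _ fin]) auto
    show "(\<lambda>k. \<integral>\<^sup>+\<omega>. ennreal ((cmod (fourier_integral (truncate k u) \<omega> - fourier_integral u \<omega>))\<^sup>2) \<partial>lebesgue) \<longlonglongrightarrow> 0"
      by (rule tendsto_sandwich[OF _ _ tendsto_const lim]) (use le in auto)
    show "energy lebesgue (\<lambda>\<omega>. fourier_integral (truncate k u) \<omega>) = energy lebesgue (truncate k u)" for k
      by (rule plancherel_cube_support[OF _ _ _ tr(1), of "real (Suc k)"]) (auto simp: truncate_def)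
  qed auto
qed

section \<open>The Fourier transform on square-integrable functions\<close>

lemma L2_iff: "f \<in> L2 \<longleftrightarrow> f \<in> borel_measurable lebesgue \<and> energy lebesgue f < \<infinity>"
  unfolding L2_def by (auto simp: integrable_iff_bounded)

lemma L2_measurable: "f \<in> L2 \<Longrightarrow> f \<in> borel_measurable lebesgue"
  and L2_finite: "f \<in> L2 \<Longrightarrow> energy lebesgue f < \<infinity>"
  by (auto simp: L2_iff)

lemma L2_nn_integral: "f \<in> L2 \<Longrightarrow> energy lebesgue f = ennreal (LINT x|lebesgue. (cmod (f x))\<^sup>2)"
  unfolding L2_def by (intro nn_integral_eq_integral) auto

lemma L2_dist_sq_triangle:
  assumes "u \<in> borel_measurable lebesgue" "v \<in> borel_measurable lebesgue" "w \<in> borel_measurable lebesgue"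
  shows "L2_dist_sq u w \<le> 2 * L2_dist_sq u v + 2 * L2_dist_sq v w"
  unfolding L2_dist_sq_def by (rule nn_integral_sq_triangle[OF assms])

lemma L2_scale: "f \<in> L2 \<Longrightarrow> (\<lambda>x. c * f x) \<in> L2"
  unfolding L2_def by (auto simp: norm_mult power_mult_distrib)

lemma L2_add:
  assumes f: "f \<in> L2" and g: "g \<in> L2"
  shows "(\<lambda>x. f x + g x) \<in> L2"
proof -
  have [measurable]: "f \<in> borel_measurable lebesgue" "g \<in> borel_measurable lebesgue"
    using f g by (auto simp: L2_iff)
  have "energy lebesgue (\<lambda>x. f x - (- g x))
      \<le> 2 * energy lebesgue (\<lambda>x. f x - 0) + 2 * energy lebesgue (\<lambda>x. 0 - (- g x))"
    by (rule nn_integral_sq_triangle) measurable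
  also have "\<dots> < \<infinity>" using L2_finite[OF f] L2_finite[OF g] by (simp add: ennreal_mult_less_top)
  finally show ?thesis by (simp add: L2_iff)
qed

lemma L2_mult_cnj_integrable:
  assumes f: "f \<in> L2" and g: "g \<in> L2"
  shows "integrable lebesgue (\<lambda>x. f x * cnj (g x))"
proof (rule Bochner_Integration.integrable_bound)
  have [measurable]: "f \<in> borel_measurable lebesgue" "g \<in> borel_measurable lebesgue"
    using f g by (auto simp: L2_iff)
  show "integrable lebesgue (\<lambda>x. (cmod (f x))\<^sup>2 + (cmod (g x))\<^sup>2)"
    using f g by (auto simp: L2_def)
  show "(\<lambda>x. f x * cnj (g x)) \<in> borel_measurable lebesgue" by measurable
  show "AE x in lebesgue. norm (f x * cnj (g x)) \<le> norm ((cmod (f x))\<^sup>2 + (cmod (g x))\<^sup>2)"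
  proof (rule AE_I2)
    fix x
    have "cmod (f x) * cmod (g x) \<le> (cmod (f x))\<^sup>2 + (cmod (g x))\<^sup>2"
      using sum_squares_bound[of "cmod (f x)" "cmod (g x)"]
        mult_nonneg_nonneg[OF norm_ge_zero norm_ge_zero, of "f x" "g x"] by linarith
    then show "norm (f x * cnj (g x)) \<le> norm ((cmod (f x))\<^sup>2 + (cmod (g x))\<^sup>2)"
      by (simp add: norm_mult)
  qed
qed

lemma L2_translate:
  fixes f :: "'a::euclidean_space \<Rightarrow> complex"
  assumes "f \<in> L2" shows "(\<lambda>x. f (x - a)) \<in> L2"
proof -
  have [measurable]: "f \<in> borel_measurable lebesgue" using assms by (auto simp: L2_iff)
  have "energy lebesgue (\<lambda>x. f (x + - a)) = energy lebesgue f"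
    by (rule nn_integral_lebesgue_shift) measurable
  then show ?thesis using assms by (simp add: L2_iff)
qed

lemma L2_modulate:
  fixes f :: "'a::euclidean_space \<Rightarrow> complex"
  assumes "f \<in> L2" shows "(\<lambda>x. cis (c * (x \<bullet> a)) * f x) \<in> L2"
  using assms fourier_integrand_measurable[of f c a] by (simp add: L2_iff norm_mult)

lemma fourier_integral_L2:
  fixes u :: "real ^ 'n \<Rightarrow> complex"
  assumes "integrable lebesgue u" "u \<in> L2"
  shows "fourier_integral u \<in> L2"
  using plancherel_L1_L2[OF assms(1) L2_finite[OF assms(2)]] L2_finite[OF assms(2)]
    fourier_integral_measurable[OF assms(1)] by (simp add: L2_iff)

lemma is_fourier_L2_isometry:
  fixes f :: "real ^ 'n \<Rightarrow> complex"
  assumes f: "f \<in> L2" and fg: "is_fourier_L2 f g"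
  shows "energy lebesgue g = energy lebesgue f"
proof -
  obtain u where u: "\<And>n. integrable lebesgue (u n)" "\<And>n. u n \<in> L2"
    "(\<lambda>n. L2_dist_sq (u n) f) \<longlonglongrightarrow> 0" "(\<lambda>n. L2_dist_sq (fourier_integral (u n)) g) \<longlonglongrightarrow> 0" "g \<in> L2"
    using fg unfolding is_fourier_L2_def by blast
  show ?thesis
    by (rule L2_isometry_limit[where f\<^sub>n="\<lambda>n. fourier_integral (u n)" and g\<^sub>n=u])
      (use u f in \<open>auto simp: L2_dist_sq_def L2_measurable intro: fourier_integral_measurable plancherel_L1_L2 L2_finite\<close>)
qed

lemma is_fourier_L2_add:
  fixes f :: "real ^ 'n \<Rightarrow> complex"
  assumes f: "f \<in> L2" "is_fourier_L2 f F" and g: "g \<in> L2" "is_fourier_L2 g G"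
  shows "is_fourier_L2 (\<lambda>x. f x + g x) (\<lambda>x. F x + G x)"
proof -
  obtain u where u: "\<And>n. integrable lebesgue (u n)" "\<And>n. u n \<in> L2"
    "(\<lambda>n. L2_dist_sq (u n) f) \<longlonglongrightarrow> 0" "(\<lambda>n. L2_dist_sq (fourier_integral (u n)) F) \<longlonglongrightarrow> 0" "F \<in> L2"
    using f(2) unfolding is_fourier_L2_def by blast
  obtain v where v: "\<And>n. integrable lebesgue (v n)" "\<And>n. v n \<in> L2"
    "(\<lambda>n. L2_dist_sq (v n) g) \<longlonglongrightarrow> 0" "(\<lambda>n. L2_dist_sq (fourier_integral (v n)) G) \<longlonglongrightarrow> 0" "G \<in> L2"
    using g(2) unfolding is_fourier_L2_def by blast
  have sum_lim: "(\<lambda>n. L2_dist_sq (\<lambda>x. a n x + b n x) (\<lambda>x. a' x + b' x)) \<longlonglongrightarrow> 0"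
    if a: "\<And>n. a n \<in> L2" "a' \<in> L2" "(\<lambda>n. L2_dist_sq (a n) a') \<longlonglongrightarrow> 0"
      and b: "\<And>n. b n \<in> L2" "b' \<in> L2" "(\<lambda>n. L2_dist_sq (b n) b') \<longlonglongrightarrow> 0" for a b a' b'
  proof (rule tendsto_sandwich[OF _ _ tendsto_const])
    note [measurable] = a(1,2)[THEN L2_measurable] b(1,2)[THEN L2_measurable]
    have "L2_dist_sq (\<lambda>x. a n x + b n x) (\<lambda>x. a' x + b' x) \<le> 2 * L2_dist_sq (a n) a' + 2 * L2_dist_sq (b n) b'" for n
      using L2_dist_sq_triangle[of "\<lambda>x. a n x + b n x" "\<lambda>x. a' x + b n x" "\<lambda>x. a' x + b' x"]
      by (simp add: L2_dist_sq_def)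
    then show "\<forall>\<^sub>F n in sequentially. L2_dist_sq (\<lambda>x. a n x + b n x) (\<lambda>x. a' x + b' x) \<le> 2 * L2_dist_sq (a n) a' + 2 * L2_dist_sq (b n) b'"
      by simp
    have "(\<lambda>n. 2 * L2_dist_sq (a n) a' + 2 * L2_dist_sq (b n) b') \<longlonglongrightarrow> 2 * 0 + 2 * 0"
      by (intro tendsto_add ennreal_tendsto_cmult a b) auto
    then show "(\<lambda>n. 2 * L2_dist_sq (a n) a' + 2 * L2_dist_sq (b n) b') \<longlonglongrightarrow> 0" by simp
  qed simp
  show ?thesis unfolding is_fourier_L2_def
  proof (intro conjI exI[of _ "\<lambda>n x. u n x + v n x"] allI)
    show "(\<lambda>n. L2_dist_sq (\<lambda>x. u n x + v n x) (\<lambda>x. f x + g x)) \<longlonglongrightarrow> 0"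
      using u v f g by (intro sum_lim)
    have "fourier_integral (\<lambda>x. u n x + v n x) = (\<lambda>x. fourier_integral (u n) x + fourier_integral (v n) x)" for n
      using u v by (intro ext fourier_integral_add)
    then show "(\<lambda>n. L2_dist_sq (fourier_integral (\<lambda>x. u n x + v n x)) (\<lambda>x. F x + G x)) \<longlonglongrightarrow> 0"
      using u v by (simp only:) (intro sum_lim fourier_integral_L2)
    show "(\<lambda>x. u n x + v n x) \<in> L2" for n by (rule L2_add[OF u(2) v(2)])
    show "(\<lambda>x. F x + G x) \<in> L2" by (rule L2_add[OF u(5) v(5)])
  qed (use u v in auto)
qed

lemma is_fourier_L2_scale:
  fixes f :: "'a::euclidean_space \<Rightarrow> complex"
  assumes f: "f \<in> L2" "is_fourier_L2 f F"
  shows "is_fourier_L2 (\<lambda>x. c * f x) (\<lambda>x. c * F x)"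
proof -
  obtain u where u: "\<And>n. integrable lebesgue (u n)" "\<And>n. u n \<in> L2"
    "(\<lambda>n. L2_dist_sq (u n) f) \<longlonglongrightarrow> 0" "(\<lambda>n. L2_dist_sq (fourier_integral (u n)) F) \<longlonglongrightarrow> 0" "F \<in> L2"
    using f(2) unfolding is_fourier_L2_def by blast
  have dist: "L2_dist_sq (\<lambda>x. c * a x) (\<lambda>x. c * b x) = ennreal ((cmod c)\<^sup>2) * L2_dist_sq a b"
    if [measurable]: "a \<in> borel_measurable lebesgue" "b \<in> borel_measurable lebesgue" for a b :: "'a \<Rightarrow> complex"
  proof -
    have "L2_dist_sq (\<lambda>x. c * a x) (\<lambda>x. c * b x) = (\<integral>\<^sup>+x. ennreal ((cmod c)\<^sup>2) * ennreal ((cmod (a x - b x))\<^sup>2) \<partial>lebesgue)"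
      unfolding L2_dist_sq_def
      by (intro nn_integral_cong) (simp add: norm_mult power_mult_distrib ennreal_mult' flip: right_diff_distrib)
    then show ?thesis unfolding L2_dist_sq_def by (simp add: nn_integral_cmult)
  qed
  have lim: "(\<lambda>n. ennreal ((cmod c)\<^sup>2) * a n) \<longlonglongrightarrow> 0" if "a \<longlonglongrightarrow> 0" for a
    using ennreal_tendsto_cmult[OF _ that, of "ennreal ((cmod c)\<^sup>2)"] by simp
  show ?thesis unfolding is_fourier_L2_def
  proof (intro conjI exI[of _ "\<lambda>n x. c * u n x"] allI)
    show "(\<lambda>n. L2_dist_sq (\<lambda>x. c * u n x) (\<lambda>x. c * f x)) \<longlonglongrightarrow> 0"
      using u f by (simp add: dist L2_measurable lim)
    have "fourier_integral (\<lambda>x. c * u n x) = (\<lambda>x. c * fourier_integral (u n) x)" for n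
      by (intro ext fourier_integral_scale)
    then show "(\<lambda>n. L2_dist_sq (fourier_integral (\<lambda>x. c * u n x)) (\<lambda>x. c * F x)) \<longlonglongrightarrow> 0"
      using u by (simp add: dist L2_measurable lim fourier_integral_measurable)
    show "(\<lambda>x. c * u n x) \<in> L2" for n by (rule L2_scale[OF u(2)])
    show "(\<lambda>x. c * F x) \<in> L2" by (rule L2_scale[OF u(5)])
  qed (use u in auto)
qed

lemma L2_dist_sq_translate:
  fixes u v :: "'a::euclidean_space \<Rightarrow> complex"
  assumes [measurable]: "u \<in> borel_measurable lebesgue" "v \<in> borel_measurable lebesgue"
  shows "L2_dist_sq (\<lambda>x. u (x - a)) (\<lambda>x. v (x - a)) = L2_dist_sq u v"
proof -
  have "(\<lambda>x. ennreal ((cmod (u x - v x))\<^sup>2)) \<in> borel_measurable lebesgue" by measurable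
  from nn_integral_lebesgue_shift[OF this, of "- a"] show ?thesis
    by (simp add: L2_dist_sq_def)
qed

lemma L2_dist_sq_modulate:
  assumes "\<And>x. cmod (c x) = 1"
  shows "L2_dist_sq (\<lambda>x. c x * u x) (\<lambda>x. c x * v x) = L2_dist_sq u v"
  unfolding L2_dist_sq_def using assms by (simp add: norm_mult flip: right_diff_distrib)

lemma is_fourier_L2_translation:
  fixes f :: "'a::euclidean_space \<Rightarrow> complex"
  assumes f: "f \<in> L2" "is_fourier_L2 f F"
  shows "is_fourier_L2 (translation a f) (\<lambda>\<omega>. cis (- 2 * pi * (\<omega> \<bullet> a)) * F \<omega>)"
proof -
  obtain u where u: "\<And>n. integrable lebesgue (u n)" "\<And>n. u n \<in> L2"
    "(\<lambda>n. L2_dist_sq (u n) f) \<longlonglongrightarrow> 0" "(\<lambda>n. L2_dist_sq (fourier_integral (u n)) F) \<longlonglongrightarrow> 0" "F \<in> L2"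
    using f(2) unfolding is_fourier_L2_def by blast
  show ?thesis unfolding is_fourier_L2_def
  proof (intro conjI exI[of _ "\<lambda>n. translation a (u n)"] allI)
    show "(\<lambda>n. L2_dist_sq (translation a (u n)) (translation a f)) \<longlonglongrightarrow> 0"
      using u f unfolding translation_def by (simp add: L2_dist_sq_translate L2_measurable)
    have "fourier_integral (translation a (u n)) = (\<lambda>\<omega>. cis (- 2 * pi * (\<omega> \<bullet> a)) * fourier_integral (u n) \<omega>)" for n
      using u by (intro ext) (subst fourier_integral_translation, auto simp: inner_commute)
    then show "(\<lambda>n. L2_dist_sq (fourier_integral (translation a (u n))) (\<lambda>\<omega>. cis (- 2 * pi * (\<omega> \<bullet> a)) * F \<omega>)) \<longlonglongrightarrow> 0"
      using u by (simp only:) (subst L2_dist_sq_modulate, auto)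
    show "(\<lambda>\<omega>. cis (- 2 * pi * (\<omega> \<bullet> a)) * F \<omega>) \<in> L2" using u(5) by (rule L2_modulate)
    show "integrable lebesgue (translation a (u n))" for n
      using integral_lebesgue_shift(1)[of "u n" "- a"] u(1)[of n]
      by (simp add: translation_def[abs_def] borel_measurable_integrable)
    show "translation a (u n) \<in> L2" for n
      using L2_translate[OF u(2)] by (simp add: translation_def[abs_def])
  qed
qed

lemma is_fourier_L2_modulation:
  fixes f :: "real ^ 'n \<Rightarrow> complex"
  assumes f: "f \<in> L2" "is_fourier_L2 f F"
  shows "is_fourier_L2 (\<lambda>t. cis (2 * pi * (\<eta> \<bullet> t)) * f t) (\<lambda>\<omega>. F (\<omega> - \<eta>))"
proof -
  obtain u where u: "\<And>n. integrable lebesgue (u n)" "\<And>n. u n \<in> L2"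
    "(\<lambda>n. L2_dist_sq (u n) f) \<longlonglongrightarrow> 0" "(\<lambda>n. L2_dist_sq (fourier_integral (u n)) F) \<longlonglongrightarrow> 0" "F \<in> L2"
    using f(2) unfolding is_fourier_L2_def by blast
  show ?thesis unfolding is_fourier_L2_def
  proof (intro conjI exI[of _ "\<lambda>n t. cis (2 * pi * (\<eta> \<bullet> t)) * u n t"] allI)
    show "(\<lambda>n. L2_dist_sq (\<lambda>t. cis (2 * pi * (\<eta> \<bullet> t)) * u n t) (\<lambda>t. cis (2 * pi * (\<eta> \<bullet> t)) * f t)) \<longlonglongrightarrow> 0"
      using u by (subst L2_dist_sq_modulate) auto
    have "fourier_integral (\<lambda>t. cis (2 * pi * (\<eta> \<bullet> t)) * u n t) = (\<lambda>\<omega>. fourier_integral (u n) (\<omega> - \<eta>))" for n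
      by (intro ext fourier_integral_modulation)
    then show "(\<lambda>n. L2_dist_sq (fourier_integral (\<lambda>t. cis (2 * pi * (\<eta> \<bullet> t)) * u n t)) (\<lambda>\<omega>. F (\<omega> - \<eta>))) \<longlonglongrightarrow> 0"
      using u by (simp only:) (subst L2_dist_sq_translate, auto simp: L2_measurable fourier_integral_measurable)
    show "(\<lambda>\<omega>. F (\<omega> - \<eta>)) \<in> L2" using u(5) by (rule L2_translate)
    show "integrable lebesgue (\<lambda>t. cis (2 * pi * (\<eta> \<bullet> t)) * u n t)" for n
      using fourier_integrand_integrable[OF u(1)[of n], of "2 * pi" \<eta>] by (simp only: inner_commute)
    show "(\<lambda>t. cis (2 * pi * (\<eta> \<bullet> t)) * u n t) \<in> L2" for n
      using L2_modulate[OF u(2)[of n], of "2 * pi" \<eta>] by (simp only: inner_commute)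
  qed
qed

text \<open>
  For an infinite index set both sums are 0, and the zero function is its own transform.
\<close>
lemma is_fourier_L2_sum:
  fixes f :: "'i \<Rightarrow> real ^ 'n \<Rightarrow> complex"
  assumes "\<And>i. i \<in> A \<Longrightarrow> f i \<in> L2" "\<And>i. i \<in> A \<Longrightarrow> is_fourier_L2 (f i) (F i)"
  shows "(\<lambda>x. \<Sum>i\<in>A. f i x) \<in> L2" and "is_fourier_L2 (\<lambda>x. \<Sum>i\<in>A. f i x) (\<lambda>x. \<Sum>i\<in>A. F i x)"
proof -
  have 0: "(\<lambda>x::real^'n. 0 :: complex) \<in> L2" by (simp add: L2_iff)
  have 1: "is_fourier_L2 (\<lambda>x::real^'n. 0) (\<lambda>x. 0)"
    unfolding is_fourier_L2_def using 0
    by (intro conjI exI[of _ "\<lambda>n x. 0"]) (auto simp: L2_dist_sq_def fourier_integral_def)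
  have "(\<lambda>x. \<Sum>i\<in>A. f i x) \<in> L2 \<and> is_fourier_L2 (\<lambda>x. \<Sum>i\<in>A. f i x) (\<lambda>x. \<Sum>i\<in>A. F i x)"
    using assms
    by (induction A rule: infinite_finite_induct) (auto intro: 0 1 L2_add is_fourier_L2_add)
  then show "(\<lambda>x. \<Sum>i\<in>A. f i x) \<in> L2" "is_fourier_L2 (\<lambda>x. \<Sum>i\<in>A. f i x) (\<lambda>x. \<Sum>i\<in>A. F i x)" by auto
qed

text \<open>
  Polarization of the isometry; the imaginary part is the real part after multiplying one factor by
  the imaginary unit.
\<close>
lemma L2_inner_fourier:
  fixes f g :: "real ^ 'n \<Rightarrow> complex"
  assumes f: "f \<in> L2" "is_fourier_L2 f F" and g: "g \<in> L2" "is_fourier_L2 g G"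
  shows "L2_inner f g = L2_inner F G"
proof -
  have norm: "(LINT x|lebesgue. (cmod (h x))\<^sup>2) = (LINT x|lebesgue. (cmod (H x))\<^sup>2)" "H \<in> L2"
    if "h \<in> L2" "is_fourier_L2 h H" for h H :: "real ^ 'n \<Rightarrow> complex"
  proof -
    show H: "H \<in> L2" using that(2) by (auto simp: is_fourier_L2_def)
    then show "(LINT x|lebesgue. (cmod (h x))\<^sup>2) = (LINT x|lebesgue. (cmod (H x))\<^sup>2)"
      using is_fourier_L2_isometry[OF that] that by (simp add: L2_nn_integral)
  qed
  have pol: "Re (L2_inner h k) = ((LINT x|lebesgue. (cmod (h x + k x))\<^sup>2) - (LINT x|lebesgue. (cmod (h x))\<^sup>2) - (LINT x|lebesgue. (cmod (k x))\<^sup>2)) / 2"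
    if hk: "h \<in> L2" "k \<in> L2" for h k :: "real ^ 'n \<Rightarrow> complex"
  proof -
    have "(cmod (z + w))\<^sup>2 = (cmod z)\<^sup>2 + (cmod w)\<^sup>2 + 2 * Re (z * cnj w)" for z w
      unfolding cmod_power2 by (simp add: power2_eq_square algebra_simps)
    then have "(LINT x|lebesgue. (cmod (h x + k x))\<^sup>2) = (LINT x|lebesgue. (cmod (h x))\<^sup>2 + (cmod (k x))\<^sup>2 + 2 * Re (h x * cnj (k x)))"
      by simp
    also have "\<dots> = (LINT x|lebesgue. (cmod (h x))\<^sup>2) + (LINT x|lebesgue. (cmod (k x))\<^sup>2) + 2 * (LINT x|lebesgue. Re (h x * cnj (k x)))"
      using hk integrable_Re[OF L2_mult_cnj_integrable[OF hk]] unfolding L2_def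
      by (subst Bochner_Integration.integral_add Bochner_Integration.integral_mult_right_zero; auto simp del: times_complex.sel)+
    also have "(LINT x|lebesgue. Re (h x * cnj (k x))) = Re (L2_inner h k)"
      unfolding L2_inner_def using L2_mult_cnj_integrable[OF hk] by (simp only: integral_Re)
    finally show ?thesis by simp
  qed
  have re: "Re (L2_inner f k) = Re (L2_inner F K)" if k: "k \<in> L2" "is_fourier_L2 k K" for k K
    using norm[OF f] norm[OF k] norm[OF L2_add[OF f(1) k(1)] is_fourier_L2_add[OF f k]] f(1) k(1)
    by (simp add: pol)
  have im: "Im (L2_inner h k) = Re (L2_inner h (\<lambda>x. \<i> * k x))" if hk: "h \<in> L2" "k \<in> L2" for h k :: "real ^ 'n \<Rightarrow> complex"
  proof -
    have "L2_inner h (\<lambda>x. \<i> * k x) = (LINT x|lebesgue. - \<i> * (h x * cnj (k x)))"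
      unfolding L2_inner_def by (simp add: mult_ac)
    also have "\<dots> = - \<i> * L2_inner h k" unfolding L2_inner_def by simp
    finally show ?thesis by simp
  qed
  have "Im (L2_inner f g) = Im (L2_inner F G)"
    using re[OF L2_scale[OF g(1)] is_fourier_L2_scale[OF g], of \<i>] f norm[OF f] norm[OF g] g by (simp add: im)
  then show ?thesis using re[OF g] by (simp add: complex_eq_iff)
qed

text \<open>
  The Riesz-Fischer argument for the transforms of truncations: along a fast subsequence the weighted
  square increments are summable almost everywhere, so the transforms converge pointwise, and Fatou's
  lemma makes this convergence in \<open>L2\<close>.
\<close>
lemma is_fourier_L2_exists:
  fixes f :: "real ^ 'n \<Rightarrow> complex"
  assumes f: "f \<in> L2"
  shows "\<exists>g. is_fourier_L2 f g"
proof -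
  have [measurable]: "f \<in> borel_measurable lebesgue" and fin: "energy lebesgue f < \<infinity>"
    using f by (auto simp: L2_iff)
  note tr = truncate_square_integrable[OF _ fin]
  \<comment> \<open>The rate \<open>1 / 8\<close> leaves a summable series after weighting the squared increments with \<open>2 ^ k\<close>,
    and that weight makes the increments themselves geometrically small.\<close>
  have "\<exists>r. L2_dist_sq (truncate r f) f < ennreal ((1 / 8) ^ k)" for k
  proof -
    have "\<forall>\<^sub>F r in sequentially. L2_dist_sq (truncate r f) f < ennreal ((1 / 8) ^ k)"
      unfolding L2_dist_sq_def by (rule order_tendstoD(2)[OF truncate_L2_limit[OF _ fin]]) auto
    then show ?thesis by (auto simp: eventually_sequentially)
  qed
  then obtain r where r: "\<And>k. L2_dist_sq (truncate (r k) f) f < ennreal ((1 / 8) ^ k)" by metis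
  define v where "v k = truncate (r k) f" for k
  have [measurable]: "v k \<in> borel_measurable lebesgue" for k unfolding v_def by measurable
  have v: "integrable lebesgue (v k)" "v k \<in> L2" for k
    unfolding v_def using tr by (auto simp: L2_iff)
  define w where "w k = fourier_integral (v k)" for k
  have [measurable]: "w k \<in> borel_measurable lebesgue" for k unfolding w_def using v by (intro fourier_integral_measurable)
  have dist: "energy lebesgue (\<lambda>\<omega>. w k \<omega> - w l \<omega>) \<le> ennreal (4 * (1 / 8) ^ k)" if "k \<le> l" for k l
  proof -
    have "energy lebesgue (\<lambda>\<omega>. w k \<omega> - w l \<omega>) = L2_dist_sq (v k) (v l)"
      unfolding w_def v_def L2_dist_sq_def by (rule plancherel_truncate_diff[OF _ fin]) measurable
    also have "\<dots> \<le> 2 * L2_dist_sq (v k) f + 2 * L2_dist_sq f (v l)"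
      by (rule L2_dist_sq_triangle) measurable
    also have "L2_dist_sq f (v l) = L2_dist_sq (v l) f" by (simp add: L2_dist_sq_def norm_minus_commute)
    also have "2 * L2_dist_sq (v k) f + 2 * L2_dist_sq (v l) f \<le> 2 * ennreal ((1 / 8) ^ k) + 2 * ennreal ((1 / 8) ^ k)"
    proof (intro add_mono mult_left_mono)
      show "L2_dist_sq (v k) f \<le> ennreal ((1 / 8) ^ k)" using r[of k] by (simp add: v_def)
      have "L2_dist_sq (v l) f \<le> ennreal ((1 / 8) ^ l)" using r[of l] by (simp add: v_def)
      also have "\<dots> \<le> ennreal ((1 / 8) ^ k)" using that by (intro ennreal_leI power_decreasing) auto
      finally show "L2_dist_sq (v l) f \<le> ennreal ((1 / 8) ^ k)" .
    qed auto
    also have "\<dots> = ennreal (4 * (1 / 8) ^ k)" by (simp flip: ennreal_plus ennreal_mult' ennreal_numeral)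
    finally show ?thesis .
  qed
  have "(\<integral>\<^sup>+\<omega>. (\<Sum>k. ennreal (2 ^ k) * ennreal ((cmod (w k \<omega> - w (Suc k) \<omega>))\<^sup>2)) \<partial>lebesgue)
     = (\<Sum>k. ennreal (2 ^ k) * energy lebesgue (\<lambda>\<omega>. w k \<omega> - w (Suc k) \<omega>))"
    by (subst nn_integral_suminf) (auto simp: nn_integral_cmult)
  also have "\<dots> \<le> (\<Sum>k. ennreal (2 ^ k) * ennreal (4 * (1 / 8) ^ k))"
    by (intro suminf_le mult_left_mono dist) auto
  also have "\<dots> = (\<Sum>k. ennreal (4 * (1 / 4) ^ k))"
  proof (intro suminf_cong)
    fix k :: nat
    have "(2 :: real) ^ k * (4 * (1 / 8) ^ k) = 4 * (2 * (1 / 8)) ^ k"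
      unfolding power_mult_distrib by simp
    then show "ennreal (2 ^ k) * ennreal (4 * (1 / 8) ^ k) = ennreal (4 * (1 / 4) ^ k)"
      by (simp flip: ennreal_mult)
  qed
  also have "\<dots> < \<infinity>"
    by (subst suminf_ennreal2) (auto intro!: summable_mult summable_geometric)
  finally have AE_fin: "AE \<omega> in lebesgue. (\<Sum>k. ennreal (2 ^ k) * ennreal ((cmod (w k \<omega> - w (Suc k) \<omega>))\<^sup>2)) \<noteq> \<infinity>"
    by (intro nn_integral_PInf_AE) auto
  have conv: "AE \<omega> in lebesgue. convergent (\<lambda>k. w k \<omega>)"
    using AE_fin
  proof eventually_elim
    case (elim \<omega>)
    then obtain S where S: "(\<Sum>k. ennreal (2 ^ k) * ennreal ((cmod (w k \<omega> - w (Suc k) \<omega>))\<^sup>2)) = ennreal S" "S \<ge> 0"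
      by (cases "\<Sum>k. ennreal (2 ^ k) * ennreal ((cmod (w k \<omega> - w (Suc k) \<omega>))\<^sup>2)") auto
    have "cmod (w (Suc k) \<omega> - w k \<omega>) \<le> sqrt S * (1 / sqrt 2) ^ k" for k
    proof -
      have "ennreal (2 ^ k * (cmod (w k \<omega> - w (Suc k) \<omega>))\<^sup>2) = (\<Sum>i\<in>{k}. ennreal (2 ^ i) * ennreal ((cmod (w i \<omega> - w (Suc i) \<omega>))\<^sup>2))"
        by (simp add: ennreal_mult)
      also have "\<dots> \<le> ennreal S" unfolding S(1)[symmetric] by (rule sum_le_suminf) auto
      finally have "2 ^ k * (cmod (w k \<omega> - w (Suc k) \<omega>))\<^sup>2 \<le> S" using S(2) by simp
      then have "(cmod (w k \<omega> - w (Suc k) \<omega>))\<^sup>2 \<le> S / 2 ^ k" by (simp add: field_simps)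
      then have "sqrt ((cmod (w k \<omega> - w (Suc k) \<omega>))\<^sup>2) \<le> sqrt (S / 2 ^ k)" by (rule real_sqrt_le_mono)
      then show ?thesis
        by (simp add: real_sqrt_divide real_sqrt_power power_divide norm_minus_commute)
    qed
    moreover have "summable (\<lambda>k. sqrt S * (1 / sqrt 2) ^ k)"
      by (intro summable_mult summable_geometric) simp
    ultimately have "summable (\<lambda>k. w (Suc k) \<omega> - w k \<omega>)"
      by (rule summable_comparison_test'[where N=0, rotated])
    then have "convergent (\<lambda>n. \<Sum>k<n. (w (Suc k) \<omega> - w k \<omega>))" by (simp only: summable_iff_convergent)
    then have "convergent (\<lambda>n. w n \<omega> - w 0 \<omega>)" by (simp only: sum_lessThan_telescope[of "\<lambda>k. w k \<omega>"])
    from convergent_add[OF this convergent_const[of "w 0 \<omega>"]]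
    show ?case by simp
  qed
  define g where "g \<omega> = lim (\<lambda>k. w k \<omega>)" for \<omega>
  have [measurable]: "g \<in> borel_measurable lebesgue"
    unfolding g_def by (intro borel_measurable_lim_metric) measurable
  have lim: "AE \<omega> in lebesgue. (\<lambda>k. w k \<omega>) \<longlonglongrightarrow> g \<omega>"
    using conv by eventually_elim (simp add: g_def convergent_LIMSEQ_iff)
  have le: "L2_dist_sq (w k) g \<le> ennreal (4 * (1 / 8) ^ k)" for k
  proof -
    have "L2_dist_sq (w k) g = (\<integral>\<^sup>+\<omega>. liminf (\<lambda>l. ennreal ((cmod (w k \<omega> - w l \<omega>))\<^sup>2)) \<partial>lebesgue)"
      unfolding L2_dist_sq_def using lim
    proof (intro nn_integral_cong_AE, eventually_elim)
      case (elim \<omega>)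
      then show ?case by (intro lim_imp_Liminf[symmetric] tendsto_intros) auto
    qed
    also have "\<dots> \<le> liminf (\<lambda>l. \<integral>\<^sup>+\<omega>. ennreal ((cmod (w k \<omega> - w l \<omega>))\<^sup>2) \<partial>lebesgue)"
      by (rule nn_integral_liminf) measurable
    also have "\<dots> \<le> limsup (\<lambda>l. \<integral>\<^sup>+\<omega>. ennreal ((cmod (w k \<omega> - w l \<omega>))\<^sup>2) \<partial>lebesgue)"
      by (rule Liminf_le_Limsup) simp
    also have "\<dots> \<le> ennreal (4 * (1 / 8) ^ k)"
      by (rule Limsup_bounded, rule eventually_mono[OF eventually_ge_at_top[of k]], rule dist)
    finally show ?thesis .
  qed
  have lim0: "(\<lambda>k. ennreal (c * (1 / 8) ^ k)) \<longlonglongrightarrow> 0" for c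
  proof -
    have "(\<lambda>k. ennreal (c * (1 / 8) ^ k)) \<longlonglongrightarrow> ennreal (c * 0)"
      by (intro tendsto_ennrealI tendsto_mult tendsto_const LIMSEQ_power_zero) simp
    then show ?thesis by simp
  qed
  have "is_fourier_L2 f g" unfolding is_fourier_L2_def
  proof (intro conjI exI[of _ v] allI)
    show "(\<lambda>k. L2_dist_sq (v k) f) \<longlonglongrightarrow> 0"
      by (rule tendsto_sandwich[OF _ _ tendsto_const lim0[of 1]])
        (use r in \<open>auto simp: v_def less_imp_le\<close>)
    show "(\<lambda>k. L2_dist_sq (fourier_integral (v k)) g) \<longlonglongrightarrow> 0"
      by (rule tendsto_sandwich[OF _ _ tendsto_const lim0[of 4]])
        (use le in \<open>auto simp: w_def\<close>)
    have "w 0 \<in> L2" unfolding w_def using v by (intro fourier_integral_L2)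
    have "L2_dist_sq g (\<lambda>x. 0) \<le> 2 * L2_dist_sq g (w 0) + 2 * L2_dist_sq (w 0) (\<lambda>x. 0)"
      by (rule L2_dist_sq_triangle) measurable
    also have "L2_dist_sq g (w 0) = L2_dist_sq (w 0) g" by (simp add: L2_dist_sq_def norm_minus_commute)
    also have "2 * L2_dist_sq (w 0) g + 2 * L2_dist_sq (w 0) (\<lambda>x. 0) < \<infinity>"
      using le[of 0] L2_finite[OF \<open>w 0 \<in> L2\<close>]
      by (auto simp: L2_dist_sq_def ennreal_mult_less_top intro: le_less_trans)
    finally show "g \<in> L2" by (simp add: L2_iff L2_dist_sq_def)
  qed (use v in auto)
  then show ?thesis by blast
qed

lemma is_fourier_L2_fourier_L2:
  fixes f :: "real ^ 'n \<Rightarrow> complex"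
  assumes "f \<in> L2" shows "is_fourier_L2 f (fourier_L2 f)"
  unfolding fourier_L2_def using is_fourier_L2_exists[OF assms] by (rule someI_ex)

section \<open>Lattice sums and the aliasing error\<close>

lemma nn_integral_count_space_Times:
  "(\<integral>\<^sup>+x. f x \<partial>count_space (A \<times> B)) = (\<integral>\<^sup>+a. \<integral>\<^sup>+b. f (a, b) \<partial>count_space B \<partial>count_space A)"
proof -
  have "(\<integral>\<^sup>+x. f x \<partial>count_space (A \<times> B)) = (\<integral>\<^sup>+x. f x * indicator (A \<times> B) x \<partial>count_space UNIV)"
    by (rule nn_integral_count_space_indicator) simp
  also have "\<dots> = (\<integral>\<^sup>+a. \<integral>\<^sup>+b. f (a, b) * indicator (A \<times> B) (a, b) \<partial>count_space UNIV \<partial>count_space UNIV)"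
    by (rule nn_integral_fst_count_space[symmetric])
  also have "\<dots> = (\<integral>\<^sup>+a. (\<integral>\<^sup>+b. f (a, b) * indicator B b \<partial>count_space UNIV) * indicator A a \<partial>count_space UNIV)"
    by (intro nn_integral_cong) (auto simp: indicator_def)
  also have "\<dots> = (\<integral>\<^sup>+a. \<integral>\<^sup>+b. f (a, b) \<partial>count_space B \<partial>count_space A)"
    by (simp add: nn_integral_count_space_indicator[of A] nn_integral_count_space_indicator[of B])
  finally show ?thesis .
qed

lemma nn_integral_scaled_lattice:
  assumes "\<nu> > 0"
  shows "(\<integral>\<^sup>+l. f l \<partial>count_space (scaled_lattice \<nu> :: (real ^ 'n) set)) = lattice_sum (\<lambda>m. f (\<nu> *\<^sub>R m))"
proof -
  have "bij_betw (\<lambda>x. \<nu> *\<^sub>R x) int_lattice (scaled_lattice \<nu> :: (real ^ 'n) set)"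
    using assms unfolding scaled_lattice_def by (auto simp: bij_betw_def inj_on_def)
  then show ?thesis by (rule nn_integral_bij_count_space[symmetric])
qed

lemma countable_scaled_lattice: "countable (scaled_lattice \<nu> :: (real ^ 'n) set)"
  unfolding scaled_lattice_def using countable_int_lattice by (rule countable_image)

text \<open>
  The power is dominated by a product of one-dimensional powers with exponent \<open>q = p / d\<close>, since each
  coordinate is at most the norm. A sum of products over a box of integer vectors factors, and
  \<open>q > 1\<close> makes each factor bounded.
\<close>
lemma lattice_power_sum_finite:
  assumes p: "p > real CARD('n)"
  shows "lattice_sum (\<lambda>m :: real ^ 'n. ennreal ((1 + norm m) powr (- p))) < \<infinity>"
proof -
  define q where "q = p / CARD('n)"
  have q: "q > 1" using p by (simp add: q_def)
  define g where "g k = (1 + \<bar>real_of_int k\<bar>) powr (- q)" for k :: int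
  have g0: "g k \<ge> 0" for k by (simp add: g_def)
  have summ: "summable (\<lambda>n. g (int n))"
  proof -
    have "summable (\<lambda>n. real (Suc n) powr (- q))"
      using q summable_real_powr_iff[of "- q"] by (subst summable_Suc_iff) simp
    then show ?thesis by (simp add: g_def add.commute)
  qed
  \<comment> \<open>The factor 2 accounts for the two signs of an integer.\<close>
  define S where "S = 2 * (\<Sum>n. g (int n))"
  have sum_le: "sum g Z \<le> S" if Z: "finite Z" for Z
  proof -
    obtain N where N: "\<forall>k\<in>Z. nat \<bar>k\<bar> < N"
      using finite_nat_set_iff_bounded[of "(\<lambda>k. nat \<bar>k\<bar>) ` Z"] Z by auto
    have "k \<in> int ` {..<N} \<union> (\<lambda>n. - int n) ` {..<N}" if "k \<in> Z" for k
    proof (cases "k \<ge> 0")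
      case True
      then show ?thesis using N that by (intro UnI1 image_eqI[of _ _ "nat k"]) auto
    next
      case False
      then show ?thesis using N that by (intro UnI2 image_eqI[of _ _ "nat (- k)"]) auto
    qed
    then have "sum g Z \<le> sum g (int ` {..<N} \<union> (\<lambda>n. - int n) ` {..<N})"
      using g0 by (intro sum_mono2) auto
    also have "\<dots> \<le> sum g (int ` {..<N}) + sum g ((\<lambda>n. - int n) ` {..<N})"
      using g0 by (subst sum.union_inter[symmetric]) (auto intro: sum_nonneg)
    also have "\<dots> = 2 * (\<Sum>n<N. g (int n))"
      by (subst (1 2) sum.reindex) (auto simp: inj_on_def g_def)
    also have "\<dots> \<le> S" unfolding S_def using summ g0 by (intro mult_left_mono sum_le_suminf) auto
    finally show ?thesis .
  qed
  have "lattice_sum (\<lambda>m :: real ^ 'n. ennreal ((1 + norm m) powr (- p))) \<le> ennreal (S ^ CARD('n))"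
  proof (rule nn_integral_count_space_leI[OF countable_int_lattice])
    fix F :: "(real ^ 'n) set" assume F: "finite F" "F \<subseteq> int_lattice"
    define \<iota> where "\<iota> m = (\<lambda>i. \<lfloor>m $ i\<rfloor>)" for m :: "real ^ 'n"
    have \<iota>: "of_int (\<iota> m i) = m $ i" if "m \<in> F" for m i
      using that F(2) by (auto simp: \<iota>_def int_lattice_def Ints_def)
    have inj: "inj_on \<iota> F"
      by (rule inj_onI) (metis \<iota> vec_eq_iff)
    define Z where "Z = (\<Union>m\<in>F. range (\<iota> m))"
    have Z: "finite Z" unfolding Z_def using F(1) by auto
    have "(\<Sum>m\<in>F. (1 + norm m) powr (- p)) \<le> (\<Sum>m\<in>F. \<Prod>i\<in>UNIV. g (\<iota> m i))"
    proof (rule sum_mono)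
      fix m assume m: "m \<in> F"
      have "(1 + norm m) powr (- p) = (\<Prod>i\<in>(UNIV :: 'n set). (1 + norm m) powr (- q))"
      proof -
        have "1 + norm m \<noteq> 0" using norm_ge_zero[of m] by linarith
        then show ?thesis by (simp add: q_def powr_power)
      qed
      also have "\<dots> \<le> (\<Prod>i\<in>UNIV. g (\<iota> m i))"
      proof (rule prod_mono, intro conjI)
        fix i
        show "(1 + norm m) powr (- q) \<le> g (\<iota> m i)"
          unfolding g_def \<iota>[OF m] using q component_le_norm_cart[of m i] by (intro powr_mono2') auto
      qed simp
      finally show "(1 + norm m) powr (- p) \<le> (\<Prod>i\<in>UNIV. g (\<iota> m i))" .
    qed
    also have "\<dots> = (\<Sum>h\<in>\<iota> ` F. \<Prod>i\<in>UNIV. g (h i))"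
      using inj by (simp add: sum.reindex)
    also have "\<dots> \<le> (\<Sum>h\<in>PiE (UNIV :: 'n set) (\<lambda>_. Z). \<Prod>i\<in>UNIV. g (h i))"
    proof (rule sum_mono2)
      show "finite (PiE (UNIV :: 'n set) (\<lambda>_. Z))" using Z by (intro finite_PiE) auto
    qed (use g0 in \<open>auto simp: Z_def intro!: prod_nonneg\<close>)
    also have "\<dots> = (\<Prod>i\<in>(UNIV :: 'n set). sum g Z)"
      using Z by (intro prod_sum_PiE[symmetric]) auto
    also have "\<dots> \<le> S ^ CARD('n)"
      using sum_le[OF Z] g0 by (simp add: power_mono sum_nonneg)
    finally show "(\<Sum>m\<in>F. ennreal ((1 + norm m) powr (- p))) \<le> ennreal (S ^ CARD('n))"
      by (subst sum_ennreal) (auto intro: ennreal_leI)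
  qed
  also have "\<dots> < \<infinity>" by simp
  finally show ?thesis .
qed

lemma norm_cube_translate:
  fixes x m :: "real ^ 'n"
  assumes L: "L > 0" and x: "x \<in> cube L" and m: "m \<in> int_lattice"
  shows "L / 2 * norm m \<le> norm (x + L *\<^sub>R m)"
proof -
  have "norm ((L / 2) *\<^sub>R m) \<le> norm (x + L *\<^sub>R m)"
  proof (rule norm_le_componentwise_cart)
    fix i
    have x': "\<bar>x $ i\<bar> \<le> L / 2"
    proof -
      have "- (L / 2) \<le> x $ i \<and> x $ i < L / 2" using x by (auto simp: cube_def)
      then show ?thesis by linarith
    qed
    obtain k where k: "m $ i = of_int k" using m unfolding int_lattice_def Ints_def by blast
    have "L / 2 * \<bar>of_int k\<bar> \<le> \<bar>x $ i + L * of_int k\<bar>"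
    proof (cases "k = 0")
      case False
      then have "1 \<le> \<bar>real_of_int k\<bar>" by linarith
      then have "L / 2 * 1 \<le> L / 2 * \<bar>real_of_int k\<bar>" using L by (intro mult_left_mono) auto
      moreover have "\<bar>L * of_int k\<bar> - \<bar>x $ i\<bar> \<le> \<bar>x $ i + L * of_int k\<bar>" by linarith
      moreover have "\<bar>L * of_int k\<bar> = L / 2 * \<bar>real_of_int k\<bar> + L / 2 * \<bar>real_of_int k\<bar>" using L by (simp add: abs_mult)
      ultimately show ?thesis using x' by linarith
    qed simp
    then show "norm (((L / 2) *\<^sub>R m) $ i) \<le> norm ((x + L *\<^sub>R m) $ i)"
      using L by (simp add: k abs_mult)
  qed
  then show ?thesis using L by simp
qed

text \<open>
  For a point \<open>x\<close> of the cube and \<open>m \<noteq> 0\<close>, the translate \<open>x + L *\<^sub>R m\<close> has norm at least \<open>L / 2 * norm m\<close>, which is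
  at least \<open>L / 4 * (1 + norm m)\<close> because \<open>norm m \<ge> 1\<close>. So the lattice sum of the tail scales
  with \<open>L\<close> like a single term.
\<close>
lemma alias_constant:
  fixes x :: "real ^ 'n"
  assumes L: "L > 0" and x: "x \<in> cube L" and \<beta>: "\<beta> \<ge> 0"
  shows "lattice_sum (\<lambda>m. ennreal ((if x + L *\<^sub>R m \<in> cube L then 0 else B * (1 + norm (x + L *\<^sub>R m)) powr (- \<beta>))\<^sup>2))
    \<le> ennreal (B\<^sup>2 * (L / 4) powr (- 2 * \<beta>)) * lattice_sum (\<lambda>m :: real ^ 'n. ennreal ((1 + norm m) powr (- 2 * \<beta>)))"
proof -
  have "lattice_sum (\<lambda>m. ennreal ((if x + L *\<^sub>R m \<in> cube L then 0 else B * (1 + norm (x + L *\<^sub>R m)) powr (- \<beta>))\<^sup>2))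
     \<le> lattice_sum (\<lambda>m :: real ^ 'n. ennreal (B\<^sup>2 * (L / 4) powr (- 2 * \<beta>)) * ennreal ((1 + norm m) powr (- 2 * \<beta>)))"
  proof (rule nn_integral_mono)
    fix m :: "real ^ 'n" assume "m \<in> space (count_space int_lattice)"
    then have m: "m \<in> int_lattice" by simp
    show "ennreal ((if x + L *\<^sub>R m \<in> cube L then 0 else B * (1 + norm (x + L *\<^sub>R m)) powr (- \<beta>))\<^sup>2)
      \<le> ennreal (B\<^sup>2 * (L / 4) powr (- 2 * \<beta>)) * ennreal ((1 + norm m) powr (- 2 * \<beta>))"
    proof (cases "x + L *\<^sub>R m \<in> cube L")
      case False
      then have "m \<noteq> 0" using x by auto
      then obtain i where "m $ i \<noteq> 0" by (auto simp: vec_eq_iff)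
      moreover obtain k where "m $ i = of_int k" using m unfolding int_lattice_def Ints_def by blast
      ultimately have "1 \<le> \<bar>m $ i\<bar>" by simp
      then have m1: "1 \<le> norm m" using component_le_norm_cart[of m i] by linarith
      have "L / 4 * (1 + norm m) \<le> L / 4 * (2 * norm m)" using L m1 by (intro mult_left_mono) auto
      also have "\<dots> \<le> 1 + norm (x + L *\<^sub>R m)" using norm_cube_translate[OF L x m] by simp
      finally have "(1 + norm (x + L *\<^sub>R m)) powr (- 2 * \<beta>) \<le> (L / 4 * (1 + norm m)) powr (- 2 * \<beta>)"
        using L \<beta> m1 by (intro powr_mono2') auto
      also have "\<dots> = (L / 4) powr (- 2 * \<beta>) * (1 + norm m) powr (- 2 * \<beta>)"
        by (rule powr_mult)
      finally have "B\<^sup>2 * (1 + norm (x + L *\<^sub>R m)) powr (- 2 * \<beta>) \<le> B\<^sup>2 * ((L / 4) powr (- 2 * \<beta>) * (1 + norm m) powr (- 2 * \<beta>))"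
        by (rule mult_left_mono) simp
      moreover have "((1 + norm (x + L *\<^sub>R m)) powr (- \<beta>))\<^sup>2 = (1 + norm (x + L *\<^sub>R m)) powr (- 2 * \<beta>)"
        by (simp add: powr_power add_nonneg_eq_0_iff)
      ultimately show ?thesis using False
        by (simp add: power_mult_distrib mult.assoc ennreal_leI flip: ennreal_mult)
    qed simp
  qed
  also have "\<dots> = ennreal (B\<^sup>2 * (L / 4) powr (- 2 * \<beta>)) * lattice_sum (\<lambda>m :: real ^ 'n. ennreal ((1 + norm m) powr (- 2 * \<beta>)))"
    by (rule nn_integral_cmult) simp
  finally show ?thesis .
qed

text \<open>
  Translating by a multiple of \<open>\<nu> / t\<close> multiplies the transform by a character of the torus of side
  \<open>t / \<nu>\<close>, with the opposite frequency; the sum over the lattice is symmetric.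
\<close>
lemma lattice_coefficients_eq_wave_coeff:
  fixes f g :: "real ^ 'n \<Rightarrow> complex"
  assumes f: "f \<in> L2" "is_fourier_L2 f F" and g: "g \<in> L2" "is_fourier_L2 g H" and \<nu>: "\<nu> > 0" "t > 0"
  shows "energy (count_space (scaled_lattice \<nu>)) (\<lambda>l. L2_inner f (translation (l /\<^sub>R t) g))
     = lattice_sum (\<lambda>n. ennreal ((cmod (wave_coeff (t / \<nu>) (\<lambda>\<omega>. F \<omega> * cnj (H \<omega>)) n))\<^sup>2))"
proof -
  have "L2_inner f (translation ((\<nu> *\<^sub>R m) /\<^sub>R t) g) = wave_coeff (t / \<nu>) (\<lambda>\<omega>. F \<omega> * cnj (H \<omega>)) (- m)" for m
  proof -
    let ?a = "(\<nu> *\<^sub>R m) /\<^sub>R t"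
    have tg: "translation ?a g \<in> L2" using L2_translate[OF g(1)] by (simp add: translation_def[abs_def])
    have "L2_inner f (translation ?a g) = L2_inner F (\<lambda>\<omega>. cis (- 2 * pi * (\<omega> \<bullet> ?a)) * H \<omega>)"
      by (rule L2_inner_fourier[OF f tg is_fourier_L2_translation[OF g]])
    also have "\<dots> = wave_coeff (t / \<nu>) (\<lambda>\<omega>. F \<omega> * cnj (H \<omega>)) (- m)"
      unfolding L2_inner_def wave_coeff_def
    proof (intro Bochner_Integration.integral_cong refl)
      fix \<omega>
      have "cnj (cis (- 2 * pi * (\<omega> \<bullet> ?a))) = cnj (wave (t / \<nu>) (- m) \<omega>)"
        using \<nu> by (simp add: wave_def inner_commute field_simps)
      then show "F \<omega> * cnj (cis (- 2 * pi * (\<omega> \<bullet> ?a)) * H \<omega>) = F \<omega> * cnj (H \<omega>) * cnj (wave (t / \<nu>) (- m) \<omega>)"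
        by (simp only: complex_cnj_mult mult_ac)
    qed
    finally show ?thesis .
  qed
  then show ?thesis
    using \<nu> by (simp add: nn_integral_scaled_lattice nn_integral_lattice_uminus[where f="\<lambda>n. ennreal ((cmod (wave_coeff (t / \<nu>) (\<lambda>\<omega>. F \<omega> * cnj (H \<omega>)) n))\<^sup>2)"])
qed

lemma weighted_measurable:
  fixes F :: "real ^ 'n \<Rightarrow> complex"
  assumes [measurable]: "F \<in> borel_measurable lebesgue"
  shows "(\<lambda>\<omega>. (1 + norm \<omega>) powr s * cmod (F \<omega>)) \<in> borel_measurable lebesgue"
proof -
  have [measurable]: "(\<lambda>\<omega>::real^'n. (1 + norm \<omega>) powr s) \<in> borel_measurable lebesgue"
    by (rule measurable_completion) measurable
  show ?thesis by measurable
qed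

text \<open>
  The main term \<open>M\<close> comes from the part of \<open>F * cnj \<Psi>\<close> inside the cube, for which Parseval is exact,
  and the error \<open>R\<close> from the part outside, for which only the aliasing bound is available. Bounding the
  square of a sum by twice the sum of the squares, in both directions, gives the two inequalities. In the
  error the tail of \<open>F * cnj \<Psi>\<close> is written as the weighted transform of \<open>f\<close>, which is square-integrable,
  times a decaying factor.
\<close>
lemma sampling_energy:
  fixes F \<Psi> :: "real ^ 'n \<Rightarrow> complex" and s \<epsilon> :: real
  assumes L: "L > 0" and F: "F \<in> L2" and \<Psi>: "\<Psi> \<in> L2"
    and bdd: "AE x in lebesgue. cmod (\<Psi> x) \<le> C"
    and B: "B \<ge> 0" and \<beta>: "\<beta> \<ge> 0" and \<epsilon>: "B\<^sup>2 * (L / 4) powr (- 2 * \<beta>) \<le> \<epsilon>"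
    and tail: "AE x in lebesgue. x \<notin> cube L \<longrightarrow> cmod (F x) * cmod (\<Psi> x) \<le> (1 + norm x) powr s * cmod (F x) * (B * (1 + norm x) powr (- \<beta>))"
  defines "T \<equiv> lattice_sum (\<lambda>n. ennreal ((cmod (wave_coeff L (\<lambda>x. F x * cnj (\<Psi> x)) n))\<^sup>2))"
    and "M \<equiv> (\<integral>\<^sup>+x. ennreal ((cmod (F x) * cmod (\<Psi> x))\<^sup>2) * indicator (cube L) x \<partial>lebesgue)"
    and "R \<equiv> ennreal \<epsilon> * lattice_sum (\<lambda>m :: real ^ 'n. ennreal ((1 + norm m) powr (- 2 * \<beta>))) * (\<integral>\<^sup>+x. ennreal (((1 + norm x) powr s * cmod (F x))\<^sup>2) \<partial>lebesgue)"
  shows "T \<le> ennreal (L ^ CARD('n)) * (2 * M + 2 * R)" "ennreal (L ^ CARD('n)) * M \<le> 2 * T + ennreal (L ^ CARD('n)) * (2 * R)"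
proof -
  define G where "G x = (1 + norm x) powr s * cmod (F x)" for x
  have [measurable]: "G \<in> borel_measurable lebesgue" unfolding G_def by (rule weighted_measurable[OF L2_measurable[OF F]])
  define h where "h x = F x * cnj (\<Psi> x)" for x
  define h1 where "h1 x = (if x \<in> cube L then h x else 0)" for x
  define h2 where "h2 x = (if x \<in> cube L then 0 else h x)" for x
  have [measurable]: "F \<in> borel_measurable lebesgue" "\<Psi> \<in> borel_measurable lebesgue"
    using F \<Psi> by (auto simp: L2_iff)
  have [measurable]: "h \<in> borel_measurable lebesgue" unfolding h_def by measurable
  have h1_eq: "h1 = (\<lambda>x. indicator (cube L) x * h x)" by (auto simp: h1_def fun_eq_iff)
  have [measurable]: "h1 \<in> borel_measurable lebesgue" unfolding h1_eq by measurable
  have h: "integrable lebesgue h" unfolding h_def using F \<Psi> by (rule L2_mult_cnj_integrable)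
  have M: "energy lebesgue h1 = M"
    unfolding M_def by (intro nn_integral_cong) (auto simp: h1_def h_def norm_mult indicator_def)
  have Mfin: "M < \<infinity>"
  proof -
    have "M \<le> (\<integral>\<^sup>+x. ennreal (C\<^sup>2) * ennreal ((cmod (F x))\<^sup>2) \<partial>lebesgue)"
      unfolding M_def
    proof (intro nn_integral_mono_AE, use bdd in eventually_elim)
      case (elim x)
      then have "(cmod (F x) * cmod (\<Psi> x))\<^sup>2 \<le> (cmod (F x) * C)\<^sup>2" by (intro power_mono mult_left_mono) auto
      then show ?case by (auto simp: indicator_def power_mult_distrib mult.commute ennreal_leI simp flip: ennreal_mult)
    qed
    also have "\<dots> < \<infinity>" using L2_finite[OF F] by (simp add: nn_integral_cmult ennreal_mult_less_top)
    finally show ?thesis .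
  qed
  note parseval = cube_parseval[OF L \<open>h1 \<in> borel_measurable lebesgue\<close> _ Mfin[folded M]]
  have h1: "integrable lebesgue h1" by (rule parseval) (simp add: h1_def)
  have T1: "lattice_sum (\<lambda>n. ennreal ((cmod (wave_coeff L h1 n))\<^sup>2)) = ennreal (L ^ CARD('n)) * M"
    unfolding M[symmetric] by (rule parseval(2)) (simp add: h1_def)
  have h2_eq: "h2 = (\<lambda>x. h x - h1 x)" by (auto simp: h1_def h2_def)
  then have h2: "integrable lebesgue h2" using h h1 by simp
  define b where "b x = (if x \<in> cube L then 0 else B * (1 + norm x) powr (- \<beta>))" for x :: "real ^ 'n"
  have [measurable]: "b \<in> borel_measurable lebesgue"
  proof -
    have "(\<lambda>x::real^'n. (1 + norm x) powr (- \<beta>)) \<in> borel_measurable lebesgue"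
      by (rule measurable_completion) measurable
    moreover have "b = (\<lambda>x. indicator (- cube L) x * (B * (1 + norm x) powr (- \<beta>)))"
      by (auto simp: b_def fun_eq_iff)
    ultimately show ?thesis by simp
  qed
  have T2: "lattice_sum (\<lambda>n. ennreal ((cmod (wave_coeff L h2 n))\<^sup>2)) \<le> ennreal (L ^ CARD('n)) * R"
  proof -
    have "lattice_sum (\<lambda>n. ennreal ((cmod (wave_coeff L h2 n))\<^sup>2))
      \<le> ennreal (L ^ CARD('n)) * (ennreal (B\<^sup>2 * (L / 4) powr (- 2 * \<beta>)) * lattice_sum (\<lambda>m :: real ^ 'n. ennreal ((1 + norm m) powr (- 2 * \<beta>)))) * (\<integral>\<^sup>+x. ennreal ((G x)\<^sup>2) \<partial>lebesgue)"
    proof (rule alias_bessel[OF L h2, of G b])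
      show "AE x in lebesgue. cmod (h2 x) \<le> G x * b x"
        using tail by eventually_elim (auto simp: h2_def h_def b_def G_def norm_mult)
      show "b x \<ge> 0" for x using B by (simp add: b_def)
    qed (use alias_constant[OF L _ \<beta>] in \<open>auto simp: b_def G_def\<close>)
    also have "\<dots> \<le> ennreal (L ^ CARD('n)) * R"
      unfolding R_def G_def mult.assoc using \<epsilon> by (intro mult_left_mono mult_right_mono ennreal_leI) auto
    finally show ?thesis .
  qed
  have sum: "wave_coeff L h2 n = wave_coeff L h n - wave_coeff L h1 n" for n
    unfolding h2_eq by (rule wave_coeff_diff[OF h h1])
  have "T \<le> 2 * lattice_sum (\<lambda>n. ennreal ((cmod (wave_coeff L h1 n))\<^sup>2))
      + 2 * lattice_sum (\<lambda>n. ennreal ((cmod (wave_coeff L h2 n))\<^sup>2))"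
    using nn_integral_sq_triangle[of "wave_coeff L h" "count_space int_lattice" "wave_coeff L h2" "\<lambda>_. 0"]
    unfolding T_def h_def[symmetric] by (simp add: sum add.commute)
  also have "\<dots> \<le> 2 * (ennreal (L ^ CARD('n)) * M) + 2 * (ennreal (L ^ CARD('n)) * R)"
    unfolding T1 by (intro add_left_mono mult_left_mono T2) simp
  finally show "T \<le> ennreal (L ^ CARD('n)) * (2 * M + 2 * R)" by (simp add: distrib_left mult_ac)
  have "ennreal (L ^ CARD('n)) * M \<le> 2 * T + 2 * lattice_sum (\<lambda>n. ennreal ((cmod (wave_coeff L h2 n))\<^sup>2))"
    using nn_integral_sq_triangle[of "\<lambda>n. - wave_coeff L h1 n" "count_space int_lattice" "\<lambda>n. - wave_coeff L h n" "\<lambda>_. 0"]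
    unfolding T1[symmetric] T_def h_def[symmetric] by (simp add: sum add.commute)
  also have "\<dots> \<le> 2 * T + 2 * (ennreal (L ^ CARD('n)) * R)"
    by (intro add_left_mono mult_left_mono T2) simp
  finally show "ennreal (L ^ CARD('n)) * M \<le> 2 * T + ennreal (L ^ CARD('n)) * (2 * R)" by (simp add: mult_ac)
qed

section \<open>Size of the symbols\<close>

lemma le_infdistI:
  assumes "A \<noteq> {}" "\<And>y. y \<in> A \<Longrightarrow> r \<le> dist x y"
  shows "r \<le> infdist x A"
  using assms by (auto simp: infdist_notempty intro!: cINF_greatest)

text \<open>
  At frequencies beyond twice the outer radius of the annulus that contains \<open>J\<close>, the distance to
  \<open>J\<close> is at least half the norm.
\<close>
lemma symbol_tail_bound:
  fixes \<omega> :: "'a::real_normed_vector" and d :: real and j :: nat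
  assumes C: "C > 0" and s: "s \<ge> 0" and \<alpha>: "\<alpha> > 0"
    and J: "J \<noteq> {}" "\<And>y. y \<in> J \<Longrightarrow> norm y < cmax * 2 ^ j"
    and far: "\<omega> \<notin> J \<Longrightarrow> z \<le> C * 2 powr (real j * d / 2) * (1 + infdist \<omega> J) powr (- (\<alpha> + s))"
    and \<omega>: "2 * cmax * 2 ^ j \<le> norm \<omega>" and cmax: "cmax > 0"
  shows "2 powr (real j * s) * z \<le> C * 2 powr (\<alpha> + s) * 2 powr (real j * (s + d / 2)) * (1 + norm \<omega>) powr (- (\<alpha> + s))"
proof -
  have pos: "cmax * 2 ^ j > 0" using cmax by simp
  have "\<omega> \<notin> J" using J(2)[of \<omega>] \<omega> pos by linarith
  note z = far[OF this]
  have "norm \<omega> / 2 \<le> infdist \<omega> J"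
  proof (rule le_infdistI[OF J(1)])
    fix y assume "y \<in> J"
    then have "norm y \<le> norm \<omega> / 2" using J(2)[of y] \<omega> by linarith
    then show "norm \<omega> / 2 \<le> dist \<omega> y" using norm_triangle_ineq2[of \<omega> y] by (simp add: dist_norm)
  qed
  then have "(1 + norm \<omega>) / 2 \<le> 1 + infdist \<omega> J" by simp
  then have "(1 + infdist \<omega> J) powr (- (\<alpha> + s)) \<le> ((1 + norm \<omega>) / 2) powr (- (\<alpha> + s))"
    using \<alpha> s by (intro powr_mono2') (auto intro: add_pos_nonneg)
  also have "\<dots> = 2 powr (\<alpha> + s) * (1 + norm \<omega>) powr (- (\<alpha> + s))"
    unfolding powr_divide powr_minus[of 2 "\<alpha> + s"] by (simp add: divide_inverse)
  finally have "C * 2 powr (real j * d / 2) * (1 + infdist \<omega> J) powr (- (\<alpha> + s))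
      \<le> C * 2 powr (real j * d / 2) * (2 powr (\<alpha> + s) * (1 + norm \<omega>) powr (- (\<alpha> + s)))"
    using C by (intro mult_left_mono) auto
  with z have "z \<le> C * 2 powr (real j * d / 2) * (2 powr (\<alpha> + s) * (1 + norm \<omega>) powr (- (\<alpha> + s)))" by linarith
  then have "2 powr (real j * s) * z \<le> 2 powr (real j * s) * (C * 2 powr (real j * d / 2) * (2 powr (\<alpha> + s) * (1 + norm \<omega>) powr (- (\<alpha> + s))))"
    by (rule mult_left_mono) simp
  also have "\<dots> = C * 2 powr (\<alpha> + s) * (2 powr (real j * s) * 2 powr (real j * d / 2)) * (1 + norm \<omega>) powr (- (\<alpha> + s))"
    by (simp only: mult_ac)
  also have "2 powr (real j * s) * 2 powr (real j * d / 2) = 2 powr (real j * (s + d / 2))"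
    by (simp add: algebra_simps flip: powr_add)
  finally show ?thesis .
qed

lemma two_power_powr: "(2 ^ j) powr x = (2 :: real) powr (real j * x)"
  by (simp add: powr_powr flip: powr_realpow)

text \<open>
  In the middle range \<open>2 ^ j\<close> is comparable to the norm of \<open>\<omega>\<close>, and only the uniform bound is used.
  Below and above it the distance from \<open>\<omega>\<close> to \<open>J\<close> is at least a constant times \<open>2 ^ j\<close>, so the
  decay beats the growth \<open>2 powr (j * d / 2)\<close> of the constant by a geometric factor, since
  \<open>\<alpha> > d / 2\<close>.
\<close>
lemma symbol_multiplier_bound:
  fixes \<omega> :: "'a::real_normed_vector" and d :: real and j :: nat
  assumes C: "C > 0" and s: "s \<ge> 0" and \<alpha>: "\<alpha> > 0"
    and J: "J \<noteq> {}" "\<And>y. y \<in> J \<Longrightarrow> cmin * 2 ^ j < norm y" "\<And>y. y \<in> J \<Longrightarrow> norm y < cmax * 2 ^ j"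
    and far: "\<omega> \<notin> J \<Longrightarrow> z \<le> C * 2 powr (real j * d / 2) * (1 + infdist \<omega> J) powr (- (\<alpha> + s))"
    and bdd: "z \<le> C" and z0: "z \<ge> 0"
    and cmin: "cmin > 0" and cmax: "cmax > 0"
  shows "2 powr (real j * s) * z \<le>
    (if cmin / 2 * 2 ^ j < norm \<omega> \<and> norm \<omega> < 2 * cmax * 2 ^ j then C * (2 / cmin) powr s
     else C * (min (cmin / 2) cmax) powr (- (\<alpha> + s)) * 2 powr (- (\<alpha> - d / 2) * real j)) * (1 + norm \<omega>) powr s"
proof (cases "cmin / 2 * 2 ^ j < norm \<omega> \<and> norm \<omega> < 2 * cmax * 2 ^ j")
  case True
  have "2 ^ j \<le> 2 / cmin * (1 + norm \<omega>)" using True cmin by (simp add: field_simps)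
  then have "(2 ^ j) powr s \<le> (2 / cmin * (1 + norm \<omega>)) powr s" using s by (intro powr_mono2) auto
  also have "\<dots> = (2 / cmin) powr s * (1 + norm \<omega>) powr s" by (rule powr_mult)
  also have "(2 ^ j) powr s = 2 powr (real j * s)" by (rule two_power_powr)
  finally have "2 powr (real j * s) * z \<le> ((2 / cmin) powr s * (1 + norm \<omega>) powr s) * C"
    using bdd C z0 by (intro mult_mono') auto
  then show ?thesis using True by (simp add: mult_ac)
next
  case False
  define c where "c = min (cmin / 2) cmax"
  have c: "c > 0" "c \<le> cmin / 2" "c \<le> cmax" using cmin cmax by (auto simp: c_def)
  have p2: "(2 :: real) ^ j > 0" by simp
  have c': "c * 2 ^ j \<le> cmin / 2 * 2 ^ j" "c * 2 ^ j \<le> cmax * 2 ^ j" "c * 2 ^ j > 0"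
    using c by (auto intro!: mult_right_mono)
  have dist: "c * 2 ^ j \<le> dist \<omega> y" if "y \<in> J" for y
  proof -
    have y: "cmin * 2 ^ j < norm y" "norm y < cmax * 2 ^ j" using J that by auto
    from False consider "norm \<omega> \<le> cmin / 2 * 2 ^ j" | "2 * cmax * 2 ^ j \<le> norm \<omega>" by linarith
    then show ?thesis
    proof cases
      case 1
      have "norm y - norm \<omega> \<le> dist \<omega> y" using norm_triangle_ineq2[of y \<omega>] by (simp add: dist_norm norm_minus_commute)
      then show ?thesis using y c' 1 by linarith
    next
      case 2
      have "norm \<omega> - norm y \<le> dist \<omega> y" using norm_triangle_ineq2[of \<omega> y] by (simp add: dist_norm)
      then show ?thesis using y c' 2 by linarith
    qed
  qed
  have "\<omega> \<notin> J" using dist[of \<omega>] c' by auto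
  note z = far[OF this]
  have "c * 2 ^ j \<le> infdist \<omega> J" by (rule le_infdistI[OF J(1) dist])
  then have "(1 + infdist \<omega> J) powr (- (\<alpha> + s)) \<le> (c * 2 ^ j) powr (- (\<alpha> + s))"
    using \<alpha> s c'(3) by (intro powr_mono2') auto
  also have "\<dots> = c powr (- (\<alpha> + s)) * (2 ^ j) powr (- (\<alpha> + s))" by (rule powr_mult)
  also have "(2 ^ j) powr (- (\<alpha> + s)) = (2 :: real) powr (- (real j * (\<alpha> + s)))"
    unfolding two_power_powr by (simp add: algebra_simps)
  finally have "z \<le> C * 2 powr (real j * d / 2) * (c powr (- (\<alpha> + s)) * 2 powr (- (real j * (\<alpha> + s))))"
    using z C by (smt (verit) mult_left_mono mult_nonneg_nonneg powr_ge_zero)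
  then have "2 powr (real j * s) * z \<le> 2 powr (real j * s) * (C * 2 powr (real j * d / 2) * (c powr (- (\<alpha> + s)) * 2 powr (- (real j * (\<alpha> + s)))))"
    by (rule mult_left_mono) simp
  also have "\<dots> = C * c powr (- (\<alpha> + s)) * (2 powr (real j * s) * 2 powr (real j * d / 2) * 2 powr (- (real j * (\<alpha> + s))))"
    by (simp only: mult_ac)
  also have "2 powr (real j * s) * 2 powr (real j * d / 2) * 2 powr (- (real j * (\<alpha> + s))) = (2 :: real) powr (- (\<alpha> - d / 2) * real j)"
    by (simp add: algebra_simps flip: powr_add)
  also have "C * c powr (- (\<alpha> + s)) * 2 powr (- (\<alpha> - d / 2) * real j) \<le> C * c powr (- (\<alpha> + s)) * 2 powr (- (\<alpha> - d / 2) * real j) * (1 + norm \<omega>) powr s"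
  proof -
    have "1 \<le> (1 + norm \<omega>) powr s" using s by (intro ge_one_powr_ge_zero) auto
    then have "C * c powr (- (\<alpha> + s)) * 2 powr (- (\<alpha> - d / 2) * real j) * 1 \<le> C * c powr (- (\<alpha> + s)) * 2 powr (- (\<alpha> - d / 2) * real j) * (1 + norm \<omega>) powr s"
      using C by (intro mult_left_mono) auto
    then show ?thesis by simp
  qed
  finally show ?thesis unfolding c_def if_not_P[OF False] .
qed

lemma powr_minus_less_one: "0 < \<delta> \<Longrightarrow> (2 :: real) powr (- \<delta>) < 1"
  using powr_less_cancel_iff[of 2 "- \<delta>" 0] by simp

lemma nn_integral_geometric:
  assumes "0 < \<delta>"
  shows "(\<integral>\<^sup>+j. ennreal (2 powr (- \<delta> * real j)) \<partial>count_space UNIV) = ennreal (1 / (1 - 2 powr (- \<delta>)))"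
proof -
  have q: "0 < (2 :: real) powr (- \<delta>)" "(2 :: real) powr (- \<delta>) < 1" using assms by (auto simp: powr_minus_less_one)
  have "2 powr (- \<delta> * real j) = (2 powr (- \<delta>)) ^ j" for j by (simp add: powr_powr flip: powr_realpow)
  then have "(\<integral>\<^sup>+j. ennreal (2 powr (- \<delta> * real j)) \<partial>count_space UNIV) = (\<Sum>j. ennreal ((2 powr (- \<delta>)) ^ j))"
    by (simp add: nn_integral_count_space_nat)
  also have "\<dots> = ennreal (\<Sum>j. (2 powr (- \<delta>)) ^ j)"
    using q by (intro suminf_ennreal2 summable_geometric) auto
  also have "(\<Sum>j. (2 powr (- \<delta>)) ^ j) = 1 / (1 - 2 powr (- \<delta>))"
    using q by (intro suminf_geometric) auto
  finally show ?thesis .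
qed

text \<open>
  Two exponents in the window differ by less than \<open>p\<close>, since \<open>a * 2 ^ j < x < b * 2 ^ j0\<close>.
\<close>
lemma card_dyadic_window:
  fixes a b x :: real
  assumes a: "0 < a" and b: "b \<le> a * 2 ^ p"
  shows "finite {j :: nat. a * 2 ^ j < x \<and> x < b * 2 ^ j}" and "card {j :: nat. a * 2 ^ j < x \<and> x < b * 2 ^ j} \<le> p"
proof -
  let ?J = "{j :: nat. a * 2 ^ j < x \<and> x < b * 2 ^ j}"
  have "\<exists>j0. ?J \<subseteq> {j0..<j0 + p}"
  proof (cases "?J = {}")
    case False
    define j0 where "j0 = (LEAST j. j \<in> ?J)"
    have j0: "j0 \<in> ?J" unfolding j0_def by (rule LeastI_ex) (use False in blast)
    have "j \<in> {j0..<j0 + p}" if j: "j \<in> ?J" for j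
    proof -
      have le: "j0 \<le> j" unfolding j0_def using j by (rule Least_le)
      have "a * 2 ^ j < b * 2 ^ j0" using j j0 by simp
      also have "\<dots> \<le> a * 2 ^ p * 2 ^ j0" using b by (intro mult_right_mono) auto
      finally have "a * 2 ^ j < a * 2 ^ (p + j0)" by (simp add: power_add)
      then have "(2 :: real) ^ j < 2 ^ (p + j0)" using a by simp
      then have "j < p + j0" by (rule power_less_imp_less_exp[rotated]) simp
      then show ?thesis using le by simp
    qed
    then show ?thesis by blast
  qed auto
  then obtain j0 where j0: "?J \<subseteq> {j0..<j0 + p}" ..
  then show "finite ?J" by (rule finite_subset) simp
  show "card ?J \<le> p" using card_mono[OF _ j0] by simp
qed

lemma dyadic_multiplier_sum:
  fixes a b x :: real
  assumes a: "0 < a" and b: "b \<le> a * 2 ^ p" and \<delta>: "\<delta> > 0" and M: "M\<^sub>1 \<ge> 0" "M\<^sub>2 \<ge> 0"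
  shows "(\<integral>\<^sup>+j. ennreal ((if a * 2 ^ j < x \<and> x < b * 2 ^ j then M\<^sub>1 else M\<^sub>2 * 2 powr (- \<delta> * real j))\<^sup>2) \<partial>count_space UNIV)
     \<le> ennreal (M\<^sub>1\<^sup>2 * real p + M\<^sub>2\<^sup>2 / (1 - 2 powr (- (2 * \<delta>))))"
proof -
  let ?J = "{j :: nat. a * 2 ^ j < x \<and> x < b * 2 ^ j}"
  have "(\<integral>\<^sup>+j. ennreal ((if a * 2 ^ j < x \<and> x < b * 2 ^ j then M\<^sub>1 else M\<^sub>2 * 2 powr (- \<delta> * real j))\<^sup>2) \<partial>count_space UNIV)
    \<le> (\<integral>\<^sup>+j. ennreal (M\<^sub>1\<^sup>2) * indicator ?J j + ennreal (M\<^sub>2\<^sup>2) * ennreal (2 powr (- (2 * \<delta>) * real j)) \<partial>count_space UNIV)"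
  proof (rule nn_integral_mono)
    fix j
    have "(2 powr (- \<delta> * real j))\<^sup>2 = (2 :: real) powr (- (2 * \<delta>) * real j)"
      by (simp add: power2_eq_square mult.assoc flip: powr_add)
    then show "ennreal ((if a * 2 ^ j < x \<and> x < b * 2 ^ j then M\<^sub>1 else M\<^sub>2 * 2 powr (- \<delta> * real j))\<^sup>2)
      \<le> ennreal (M\<^sub>1\<^sup>2) * indicator ?J j + ennreal (M\<^sub>2\<^sup>2) * ennreal (2 powr (- (2 * \<delta>) * real j))"
      by (auto simp: indicator_def power_mult_distrib simp flip: ennreal_mult)
  qed
  also have "\<dots> = ennreal (M\<^sub>1\<^sup>2) * emeasure (count_space UNIV) ?J + ennreal (M\<^sub>2\<^sup>2) * ennreal (1 / (1 - 2 powr (- (2 * \<delta>))))"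
    using nn_integral_geometric[of "2 * \<delta>"] \<delta> by (simp add: nn_integral_add nn_integral_cmult)
  also have "emeasure (count_space UNIV) ?J = ennreal (real (card ?J))"
    using card_dyadic_window(1)[OF a b, of x] by (simp add: emeasure_count_space ennreal_of_nat_eq_real_of_nat)
  also have "ennreal (M\<^sub>1\<^sup>2) * ennreal (real (card ?J)) + ennreal (M\<^sub>2\<^sup>2) * ennreal (1 / (1 - 2 powr (- (2 * \<delta>))))
    = ennreal (M\<^sub>1\<^sup>2 * real (card ?J) + M\<^sub>2\<^sup>2 / (1 - 2 powr (- (2 * \<delta>))))"
    using \<delta> by (simp add: powr_minus_less_one less_imp_le flip: ennreal_mult ennreal_plus)
  also have "\<dots> \<le> ennreal (M\<^sub>1\<^sup>2 * real p + M\<^sub>2\<^sup>2 / (1 - 2 powr (- (2 * \<delta>))))"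
    using card_dyadic_window(2)[OF a b, of x] by (intro ennreal_leI add_right_mono mult_left_mono) auto
  finally show ?thesis .
qed

section \<open>Coefficients of one frequency level\<close>

lemma packet_transform:
  fixes \<phi> :: "real ^ 'n \<Rightarrow> complex" and I :: "nat \<Rightarrow> 'k \<Rightarrow> (real ^ 'n) set" and j :: nat and k :: 'k
  assumes \<phi>: "\<phi> \<in> L2"
  defines "g \<equiv> \<lambda>t. complex_of_real (1 / 2 powr (real j * real CARD('n) / 2)) *
        (\<Sum>\<eta> \<in> I j k \<inter> int_lattice. cis (2 * pi * (\<eta> \<bullet> t)) * \<phi> t)"
  shows "g \<in> L2"
    and "is_fourier_L2 g (\<lambda>\<omega>. complex_of_real (1 / 2 powr (real j * real CARD('n) / 2)) * packet_symbol I \<phi> j k \<omega>)"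
    and "packet_symbol I \<phi> j k \<in> L2"
proof -
  have tr: "is_fourier_L2 (\<lambda>t. cis (2 * pi * (\<eta> \<bullet> t)) * \<phi> t) (\<lambda>\<omega>. fourier_L2 \<phi> (\<omega> - \<eta>))" for \<eta>
    by (rule is_fourier_L2_modulation[OF \<phi> is_fourier_L2_fourier_L2[OF \<phi>]])
  have mod: "(\<lambda>t. cis (2 * pi * (\<eta> \<bullet> t)) * \<phi> t) \<in> L2" for \<eta>
    using L2_modulate[OF \<phi>, of "2 * pi" \<eta>] by (simp only: inner_commute)
  note sum = is_fourier_L2_sum[of "I j k \<inter> int_lattice" "\<lambda>\<eta> t. cis (2 * pi * (\<eta> \<bullet> t)) * \<phi> t"
      "\<lambda>\<eta> \<omega>. fourier_L2 \<phi> (\<omega> - \<eta>)", OF mod tr]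
  show "g \<in> L2" unfolding g_def by (rule L2_scale[OF sum(1)])
  show "is_fourier_L2 g (\<lambda>\<omega>. complex_of_real (1 / 2 powr (real j * real CARD('n) / 2)) * packet_symbol I \<phi> j k \<omega>)"
    unfolding g_def packet_symbol_def by (rule is_fourier_L2_scale[OF sum])
  show "packet_symbol I \<phi> j k \<in> L2"
    using sum(2) unfolding is_fourier_L2_def packet_symbol_def[abs_def] by blast
qed

text \<open>
  The Sobolev weight \<open>2 powr (2 * j * s)\<close> is moved into the symbol, and the normalization of the
  packet comes out as \<open>1 / (2 ^ j) ^ CARD('n)\<close>; it cancels the \<open>j\<close>-dependence of the volume of the cube.
\<close>
lemma packet_coefficients:
  fixes f \<phi> :: "real ^ 'n \<Rightarrow> complex"
  assumes f: "f \<in> L2" and \<phi>: "\<phi> \<in> L2" and \<nu>: "\<nu> > 0"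
  shows "(\<integral>\<^sup>+l. ennreal (2 powr (2 * real j * s) * (cmod (L2_inner f (packet I \<phi> j k l)))\<^sup>2) \<partial>count_space (scaled_lattice \<nu>))
    = ennreal (1 / (2 ^ j) ^ CARD('n)) *
      lattice_sum (\<lambda>n. ennreal ((cmod (wave_coeff (2 ^ j / \<nu>) (\<lambda>\<omega>. fourier_L2 f \<omega> * cnj (complex_of_real (2 powr (real j * s)) * packet_symbol I \<phi> j k \<omega>)) n))\<^sup>2))"
proof -
  let ?c = "1 / 2 powr (real j * real CARD('n) / 2) :: real" and ?b = "2 powr (real j * s) :: real"
  let ?W = "wave_coeff (2 ^ j / \<nu>) (\<lambda>\<omega>. fourier_L2 f \<omega> * cnj (packet_symbol I \<phi> j k \<omega>))"
  have scale: "wave_coeff L (\<lambda>\<omega>. F \<omega> * cnj (complex_of_real r * P \<omega>)) n = of_real r * wave_coeff L (\<lambda>\<omega>. F \<omega> * cnj (P \<omega>)) n"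
    for L r n and F P :: "real ^ 'n \<Rightarrow> complex"
  proof -
    have "F \<omega> * cnj (complex_of_real r * P \<omega>) * cnj (wave L n \<omega>) = of_real r * (F \<omega> * cnj (P \<omega>) * cnj (wave L n \<omega>))" for \<omega>
      by simp
    then show ?thesis unfolding wave_coeff_def by (simp only: integral_mult_right_zero)
  qed
  have swap: "ennreal (b\<^sup>2) * energy (count_space A) (\<lambda>n. of_real c * w n)
    = ennreal (c\<^sup>2) * energy (count_space A) (\<lambda>n. of_real b * w n)" for b c :: real and w :: "real ^ 'n \<Rightarrow> complex" and A
    by (subst (1 2) nn_integral_cmult[symmetric])
      (auto intro!: nn_integral_cong simp: norm_mult power_mult_distrib mult_ac simp flip: ennreal_mult)
  have b2: "2 powr (2 * real j * s) = ?b\<^sup>2" by (simp add: power2_eq_square mult_ac flip: powr_add)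
  have c2: "?c\<^sup>2 = 1 / (2 ^ j) ^ CARD('n)"
    by (simp add: power2_eq_square powr_mult_base powr_realpow[symmetric] powr_powr flip: powr_add)
  have "energy (count_space (scaled_lattice \<nu>)) (\<lambda>l. L2_inner f (packet I \<phi> j k l))
    = lattice_sum (\<lambda>n. ennreal ((cmod (of_real ?c * ?W n))\<^sup>2))"
    unfolding packet_def scale[symmetric]
    by (rule lattice_coefficients_eq_wave_coeff[OF f is_fourier_L2_fourier_L2[OF f] packet_transform(1,2)[OF \<phi>] \<nu>]) simp
  then have "(\<integral>\<^sup>+l. ennreal (2 powr (2 * real j * s)) * ennreal ((cmod (L2_inner f (packet I \<phi> j k l)))\<^sup>2) \<partial>count_space (scaled_lattice \<nu>))
    = ennreal (?b\<^sup>2) * lattice_sum (\<lambda>n. ennreal ((cmod (of_real ?c * ?W n))\<^sup>2))"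
    unfolding b2 by (subst nn_integral_cmult) auto
  also have "\<dots> = ennreal (?c\<^sup>2) * lattice_sum (\<lambda>n. ennreal ((cmod (of_real ?b * ?W n))\<^sup>2))"
    by (rule swap)
  finally show ?thesis unfolding c2 scale by (simp add: ennreal_mult)
qed

lemma two_mult_ennreal: "2 * ennreal y = ennreal (2 * y)"
  by (simp add: ennreal_mult')

lemma sobolev_weighted_energy:
  fixes f :: "real ^ 'n \<Rightarrow> complex"
  assumes "f \<in> sobolev s"
  shows "f \<in> L2" and "(\<integral>\<^sup>+\<omega>. ennreal (((1 + norm \<omega>) powr s * cmod (fourier_L2 f \<omega>))\<^sup>2) \<partial>lebesgue) = ennreal ((sobolev_norm s f)\<^sup>2)"
proof -
  let ?g = "\<lambda>\<omega>. complex_of_real ((1 + norm \<omega>) powr s) * fourier_L2 f \<omega>"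
  show "f \<in> L2" using assms by (simp add: sobolev_def)
  have g: "?g \<in> L2" using assms by (simp add: sobolev_def)
  have "(LINT \<omega>|lebesgue. (cmod (?g \<omega>))\<^sup>2) \<ge> 0" by simp
  then have "(sobolev_norm s f)\<^sup>2 = (LINT \<omega>|lebesgue. (cmod (?g \<omega>))\<^sup>2)"
    unfolding sobolev_norm_def by (rule real_sqrt_pow2)
  then show "(\<integral>\<^sup>+\<omega>. ennreal (((1 + norm \<omega>) powr s * cmod (fourier_L2 f \<omega>))\<^sup>2) \<partial>lebesgue) = ennreal ((sobolev_norm s f)\<^sup>2)"
    using L2_nn_integral[OF g] by (simp add: norm_mult)
qed

section \<open>The frame inequalities\<close>

text \<open>
  The lower bound on the main term survives the error because \<open>2 * T\<close> is at most half of \<open>A\<close>. If \<open>S\<close>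
  is infinite the lower bound is trivial, and otherwise the error can be subtracted.
\<close>
lemma frame_bounds_from_energy:
  fixes S M R :: ennreal
  assumes V: "V > 0" and A: "A > 0" and B: "B \<ge> 0" and T: "T \<ge> 0" "T \<le> A / 4" and e: "e \<ge> 0"
    and upper: "S \<le> ennreal V * (2 * M + 2 * R)" and lower: "ennreal V * M \<le> 2 * S + ennreal V * (2 * R)"
    and R: "R \<le> ennreal (T * e)" and M: "M \<le> ennreal (B * e)" "ennreal (A * e) \<le> M"
  shows "ennreal (V * A / 4 * e) \<le> S" and "S \<le> ennreal (V * (2 * B + 2 * T) * e)"
proof -
  have "S \<le> ennreal V * (2 * ennreal (B * e) + 2 * ennreal (T * e))"
    using upper M(1) R by (meson add_mono mult_left_mono order_trans zero_le)
  also have "\<dots> = ennreal (V * (2 * B + 2 * T) * e)"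
  proof -
    have "2 * ennreal (B * e) + 2 * ennreal (T * e) = ennreal ((2 * B + 2 * T) * e)"
      unfolding two_mult_ennreal using B T e by (simp add: distrib_right mult.assoc flip: ennreal_plus)
    then show ?thesis using V B T e by (simp add: mult.assoc ennreal_mult)
  qed
  finally show "S \<le> ennreal (V * (2 * B + 2 * T) * e)" .
  show "ennreal (V * A / 4 * e) \<le> S"
  proof (cases S)
    case (real x)
    have "ennreal (V * (A * e)) = ennreal V * ennreal (A * e)" using V by (simp add: ennreal_mult')
    also have "\<dots> \<le> ennreal V * M" using M(2) by (rule mult_left_mono) simp
    also have "\<dots> \<le> 2 * S + ennreal V * (2 * R)" by (rule lower)
    also have "\<dots> \<le> 2 * S + ennreal V * (2 * ennreal (T * e))"
      using R by (intro add_left_mono mult_left_mono) auto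
    also have "\<dots> = ennreal (2 * x + V * (2 * (T * e)))"
      unfolding real two_mult_ennreal using real V T e by (simp flip: ennreal_mult ennreal_plus)
    finally have "ennreal (V * (A * e)) \<le> ennreal (2 * x + V * (2 * (T * e)))" .
    moreover have "0 \<le> 2 * x + V * (2 * (T * e))" using real V T e by simp
    ultimately have "V * (A * e) \<le> 2 * x + V * (2 * (T * e))" by (simp only: ennreal_le_iff)
    moreover have "V * (2 * (T * e)) \<le> V * (2 * (A / 4 * e))"
      using V T e by (intro mult_left_mono mult_right_mono) auto
    ultimately have "V * (A * e) \<le> 2 * x + V * (A * e) / 2" by simp
    then have "V * A / 4 * e \<le> x" by simp
    then show ?thesis using real by (simp add: ennreal_leI)
  qed simp
qed


lemma powr_minus_le_one:
  fixes x \<alpha> :: real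
  assumes "x \<ge> 1" "\<alpha> \<ge> 0"
  shows "x powr (- \<alpha>) \<le> 1"
  using powr_mono[of "- \<alpha>" 0 x] assms by simp

text \<open>
  The aliasing constant is a power of \<open>4 * \<nu>\<close> with exponent \<open>2 * \<alpha> > CARD('n) \<ge> 1\<close>, hence at most
  \<open>4 * \<nu>\<close>.
\<close>
lemma coarse_energy:
  fixes f \<phi>\<^sub>0 :: "real ^ 'n \<Rightarrow> complex" and s \<nu> \<alpha> C :: real and E :: ennreal
  assumes f: "f \<in> L2" and \<phi>\<^sub>0: "\<phi>\<^sub>0 \<in> L2" and \<nu>: "\<nu> > 0" "4 * \<nu> \<le> 1" and C: "C > 0" and s: "s \<ge> 0"
    and \<alpha>: "\<alpha> > real CARD('n) / 2"
    and decay: "AE \<omega> in lebesgue. cmod (fourier_L2 \<phi>\<^sub>0 \<omega>) \<le> C * (1 + norm \<omega>) powr (- \<alpha>)"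
  defines "E \<equiv> (\<integral>\<^sup>+\<omega>. ennreal (((1 + norm \<omega>) powr s * cmod (fourier_L2 f \<omega>))\<^sup>2) \<partial>lebesgue)"
    and "S \<equiv> energy (count_space (scaled_lattice \<nu>)) (\<lambda>l. L2_inner f (translation l \<phi>\<^sub>0))"
    and "M \<equiv> (\<integral>\<^sup>+\<omega>. ennreal ((cmod (fourier_L2 f \<omega>) * cmod (fourier_L2 \<phi>\<^sub>0 \<omega>))\<^sup>2) * indicator (cube (1 / \<nu>)) \<omega> \<partial>lebesgue)"
    and "R \<equiv> ennreal (C\<^sup>2 * (4 * \<nu>)) * lattice_sum (\<lambda>m :: real ^ 'n. ennreal ((1 + norm m) powr (- 2 * \<alpha>))) * E"
  shows "S \<le> ennreal ((1 / \<nu>) ^ CARD('n)) * (2 * M + 2 * R)" and "ennreal ((1 / \<nu>) ^ CARD('n)) * M \<le> 2 * S + ennreal ((1 / \<nu>) ^ CARD('n)) * (2 * R)"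
proof -
  let ?F = "fourier_L2 f" and ?H = "fourier_L2 \<phi>\<^sub>0"
  have card: "real CARD('n) \<ge> 1" by (simp add: Suc_leI)
  then have \<alpha>1: "2 * \<alpha> \<ge> 1" using \<alpha> by linarith
  have F: "?F \<in> L2" and H: "?H \<in> L2"
    using is_fourier_L2_fourier_L2[OF f] is_fourier_L2_fourier_L2[OF \<phi>\<^sub>0] by (auto simp: is_fourier_L2_def)
  have S: "S = lattice_sum (\<lambda>n. ennreal ((cmod (wave_coeff (1 / \<nu>) (\<lambda>\<omega>. ?F \<omega> * cnj (?H \<omega>)) n))\<^sup>2))"
    using lattice_coefficients_eq_wave_coeff[OF f is_fourier_L2_fourier_L2[OF f] \<phi>\<^sub>0 is_fourier_L2_fourier_L2[OF \<phi>\<^sub>0] \<nu>(1), of 1]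
    by (simp add: S_def)
  have bdd: "AE \<omega> in lebesgue. cmod (?H \<omega>) \<le> C"
    using decay
  proof eventually_elim
    case (elim \<omega>)
    have "(1 + norm \<omega>) powr (- \<alpha>) \<le> 1" by (rule powr_minus_le_one) (use \<alpha>1 in auto)
    then have "C * (1 + norm \<omega>) powr (- \<alpha>) \<le> C * 1" using C by (intro mult_left_mono) auto
    then show ?case using elim by simp
  qed
  have tail: "AE \<omega> in lebesgue. \<omega> \<notin> cube (1 / \<nu>) \<longrightarrow>
      cmod (?F \<omega>) * cmod (?H \<omega>) \<le> (1 + norm \<omega>) powr s * cmod (?F \<omega>) * (C * (1 + norm \<omega>) powr (- \<alpha>))"
    using decay
  proof eventually_elim
    case (elim \<omega>)
    have "1 * cmod (?F \<omega>) \<le> (1 + norm \<omega>) powr s * cmod (?F \<omega>)"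
      using s by (intro mult_right_mono ge_one_powr_ge_zero) auto
    then show ?case
      using elim by (intro impI mult_mono) (auto intro: order_trans[OF norm_ge_zero])
  qed
  have "C\<^sup>2 * (1 / \<nu> / 4) powr (- 2 * \<alpha>) \<le> C\<^sup>2 * (4 * \<nu>)"
  proof (rule mult_left_mono)
    have "(1 / \<nu> / 4) powr (- 2 * \<alpha>) = (4 * \<nu>) powr (2 * \<alpha>)"
      using \<nu> by (simp add: powr_minus powr_divide powr_mult field_simps)
    also have "\<dots> \<le> (4 * \<nu>) powr 1" using \<nu> \<alpha>1 by (intro powr_mono') auto
    finally show "(1 / \<nu> / 4) powr (- 2 * \<alpha>) \<le> 4 * \<nu>" using \<nu> by simp
  qed simp
  from sampling_energy[OF _ F H bdd _ _ this tail] \<nu>(1) C \<alpha>1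
  show "S \<le> ennreal ((1 / \<nu>) ^ CARD('n)) * (2 * M + 2 * R)" "ennreal ((1 / \<nu>) ^ CARD('n)) * M \<le> 2 * S + ennreal ((1 / \<nu>) ^ CARD('n)) * (2 * R)"
    unfolding S M_def R_def E_def by simp_all
qed

text \<open>
  The cube has side \<open>L = 2 ^ j / \<nu>\<close>, and the points outside lie beyond twice the outer radius of the annulus because
  \<open>4 * cmax * \<nu> \<le> 1\<close>. There the weighted symbol decays with exponent \<open>\<alpha> + 2 * s\<close>: once \<open>s\<close> from the
  hypothesis on the symbol and once from writing \<open>F\<close> through its weighted version. In the aliasing constant the powers
  of \<open>2 ^ j\<close> combine to a geometric decay in \<open>j\<close>, which makes the errors summable over all levels.
\<close>
lemma packet_energy:
  fixes f \<phi> :: "real ^ 'n \<Rightarrow> complex" and s \<nu> \<alpha> C cmax :: real and E :: ennreal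
    and I :: "nat \<Rightarrow> 'k \<Rightarrow> (real ^ 'n) set" and j :: nat and k :: 'k
  assumes f: "f \<in> L2" and \<phi>: "\<phi> \<in> L2" and \<nu>: "\<nu> > 0" "4 * \<nu> \<le> 1" "4 * cmax * \<nu> \<le> 1" and C: "C > 0" and s: "s \<ge> 0"
    and \<alpha>: "\<alpha> > real CARD('n) / 2" and cmax: "cmax > 0"
    and J: "I j k \<noteq> {}" "\<And>y. y \<in> I j k \<Longrightarrow> norm y < cmax * 2 ^ j"
    and far: "AE \<omega> in lebesgue. \<omega> \<notin> I j k \<longrightarrow> cmod (packet_symbol I \<phi> j k \<omega>)
             \<le> C * 2 powr (real j * real CARD('n) / 2) * (1 + infdist \<omega> (I j k)) powr (- (\<alpha> + s))"
    and bdd: "AE \<omega> in lebesgue. cmod (packet_symbol I \<phi> j k \<omega>) \<le> C"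
  defines "E \<equiv> (\<integral>\<^sup>+\<omega>. ennreal (((1 + norm \<omega>) powr s * cmod (fourier_L2 f \<omega>))\<^sup>2) \<partial>lebesgue)"
    and "S \<equiv> (\<integral>\<^sup>+l. ennreal (2 powr (2 * real j * s) * (cmod (L2_inner f (packet I \<phi> j k l)))\<^sup>2) \<partial>count_space (scaled_lattice \<nu>))"
    and "M \<equiv> (\<integral>\<^sup>+\<omega>. ennreal ((cmod (fourier_L2 f \<omega>) * (2 powr (real j * s) * cmod (packet_symbol I \<phi> j k \<omega>)))\<^sup>2) * indicator (cube (2 ^ j / \<nu>)) \<omega> \<partial>lebesgue)"
    and "R \<equiv> ennreal (C\<^sup>2 * 4 powr (\<alpha> + s) * (4 * \<nu>) * 2 powr (- (2 * \<alpha> - real CARD('n)) * real j))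
       * lattice_sum (\<lambda>m :: real ^ 'n. ennreal ((1 + norm m) powr (- 2 * (\<alpha> + 2 * s)))) * E"
  shows "S \<le> ennreal ((1 / \<nu>) ^ CARD('n)) * (2 * M + 2 * R)" and "ennreal ((1 / \<nu>) ^ CARD('n)) * M \<le> 2 * S + ennreal ((1 / \<nu>) ^ CARD('n)) * (2 * R)"
proof -
  let ?F = "fourier_L2 f" and ?V = "(1 / \<nu>) ^ CARD('n)" and ?d = "real CARD('n)"
  let ?L = "2 ^ j / \<nu>" and ?\<beta> = "\<alpha> + 2 * s"
  let ?B = "C * 2 powr (\<alpha> + s) * 2 powr (real j * (s + ?d / 2))"
  define \<Psi> where "\<Psi> \<omega> = complex_of_real (2 powr (real j * s)) * packet_symbol I \<phi> j k \<omega>" for \<omega>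
  have \<Psi>n: "cmod (\<Psi> \<omega>) = 2 powr (real j * s) * cmod (packet_symbol I \<phi> j k \<omega>)" for \<omega>
    by (simp add: \<Psi>_def norm_mult)
  define T where "T = lattice_sum (\<lambda>n. ennreal ((cmod (wave_coeff ?L (\<lambda>\<omega>. ?F \<omega> * cnj (\<Psi> \<omega>)) n))\<^sup>2))"
  have card: "?d \<ge> 1" by (simp add: Suc_leI)
  then have \<alpha>1: "2 * \<alpha> \<ge> 1" using \<alpha> by linarith
  have F: "?F \<in> L2"
    using is_fourier_L2_fourier_L2[OF f] by (auto simp: is_fourier_L2_def)
  have \<Psi>: "\<Psi> \<in> L2" unfolding \<Psi>_def by (rule L2_scale[OF packet_transform(3)[OF \<phi>]])
  have S: "S = ennreal (1 / (2 ^ j) ^ CARD('n)) * T"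
    unfolding S_def T_def \<Psi>_def by (rule packet_coefficients[OF f \<phi> \<nu>(1)])
  have M: "M = (\<integral>\<^sup>+\<omega>. ennreal ((cmod (?F \<omega>) * cmod (\<Psi> \<omega>))\<^sup>2) * indicator (cube ?L) \<omega> \<partial>lebesgue)"
    by (simp add: M_def \<Psi>n)
  have bdd\<Psi>: "AE \<omega> in lebesgue. cmod (\<Psi> \<omega>) \<le> 2 powr (real j * s) * C"
    using bdd by eventually_elim (simp add: \<Psi>n)
  have tail: "AE \<omega> in lebesgue. \<omega> \<notin> cube ?L \<longrightarrow>
      cmod (?F \<omega>) * cmod (\<Psi> \<omega>) \<le> (1 + norm \<omega>) powr s * cmod (?F \<omega>) * (?B * (1 + norm \<omega>) powr (- ?\<beta>))"
    using far
  proof eventually_elim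
    case (elim \<omega>)
    show ?case
    proof
      assume "\<omega> \<notin> cube ?L"
      then have "?L / 2 \<le> norm \<omega>" using small_norm_in_cube[of \<omega> ?L] by linarith
      moreover have "2 * cmax * 2 ^ j \<le> ?L / 2"
      proof -
        have "4 * cmax * \<nu> * 2 ^ j \<le> 1 * 2 ^ j" using \<nu>(3) by (rule mult_right_mono) simp
        then show ?thesis using \<nu>(1) by (simp add: field_simps)
      qed
      ultimately have far': "2 * cmax * 2 ^ j \<le> norm \<omega>" by linarith
      have "cmod (\<Psi> \<omega>) \<le> ?B * (1 + norm \<omega>) powr (- (\<alpha> + s))"
        unfolding \<Psi>n using elim card \<alpha> by (intro symbol_tail_bound[OF C s _ J _ far' cmax]) auto
      then have "cmod (?F \<omega>) * cmod (\<Psi> \<omega>) \<le> cmod (?F \<omega>) * (?B * (1 + norm \<omega>) powr (- (\<alpha> + s)))"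
        by (rule mult_left_mono) simp
      also have "(1 + norm \<omega>) powr (- (\<alpha> + s)) = (1 + norm \<omega>) powr s * (1 + norm \<omega>) powr (- ?\<beta>)"
        by (simp add: algebra_simps flip: powr_add)
      finally show "cmod (?F \<omega>) * cmod (\<Psi> \<omega>) \<le> (1 + norm \<omega>) powr s * cmod (?F \<omega>) * (?B * (1 + norm \<omega>) powr (- ?\<beta>))"
        by (simp only: mult_ac)
    qed
  qed
  have \<epsilon>: "?B\<^sup>2 * (?L / 4) powr (- 2 * ?\<beta>) \<le> C\<^sup>2 * 4 powr (\<alpha> + s) * (4 * \<nu>) * 2 powr (- (2 * \<alpha> - ?d) * real j)"
  proof -
    have "(?L / 4) powr (- 2 * ?\<beta>) = (2 ^ j) powr (- 2 * ?\<beta>) * (1 / (4 * \<nu>)) powr (- 2 * ?\<beta>)"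
      by (simp add: mult.commute flip: powr_mult)
    also have "(1 / (4 * \<nu>)) powr (- 2 * ?\<beta>) = (4 * \<nu>) powr (2 * ?\<beta>)"
    proof -
      have "(1 / x) powr (- y) = x powr y" if "x > 0" for x y :: real
        using that by (simp add: powr_minus powr_divide)
      from this[of "4 * \<nu>" "2 * ?\<beta>"] show ?thesis using \<nu>(1) by (simp only: mult_minus_left zero_less_mult_iff) simp
    qed
    also have "(2 ^ j) powr (- 2 * ?\<beta>) * (4 * \<nu>) powr (2 * ?\<beta>) \<le> (2 ^ j) powr (- 2 * ?\<beta>) * (4 * \<nu>)"
    proof (rule mult_left_mono)
      have "(4 * \<nu>) powr (2 * ?\<beta>) \<le> (4 * \<nu>) powr 1" using \<nu> \<alpha>1 s by (intro powr_mono') auto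
      then show "(4 * \<nu>) powr (2 * ?\<beta>) \<le> 4 * \<nu>" using \<nu> by simp
    qed simp
    also have "(2 ^ j) powr (- 2 * ?\<beta>) = 2 powr (real j * (- 2 * ?\<beta>))" by (rule two_power_powr)
    finally have "?B\<^sup>2 * (?L / 4) powr (- 2 * ?\<beta>) \<le> ?B\<^sup>2 * (2 powr (real j * (- 2 * ?\<beta>)) * (4 * \<nu>))"
      by (rule mult_left_mono) simp
    also have "\<dots> = C\<^sup>2 * (2 powr (\<alpha> + s))\<^sup>2 * (4 * \<nu>) * ((2 powr (real j * (s + ?d / 2)))\<^sup>2 * 2 powr (real j * (- 2 * ?\<beta>)))"
      by (simp only: power_mult_distrib mult_ac)
    also have "(2 powr (\<alpha> + s))\<^sup>2 = (4 :: real) powr (\<alpha> + s)"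
      by (simp add: power2_eq_square flip: powr_mult)
    also have "(2 powr (real j * (s + ?d / 2)))\<^sup>2 * 2 powr (real j * (- 2 * ?\<beta>)) = (2 :: real) powr (- (2 * \<alpha> - ?d) * real j - 2 * s * real j)"
      by (simp add: power2_eq_square algebra_simps flip: powr_add)
    also have "C\<^sup>2 * 4 powr (\<alpha> + s) * (4 * \<nu>) * 2 powr (- (2 * \<alpha> - ?d) * real j - 2 * s * real j)
      \<le> C\<^sup>2 * 4 powr (\<alpha> + s) * (4 * \<nu>) * 2 powr (- (2 * \<alpha> - ?d) * real j)"
      using \<nu>(1) s by (intro mult_left_mono powr_mono) auto
    finally show ?thesis .
  qed
  have *: "T \<le> ennreal (?L ^ CARD('n)) * (2 * M + 2 * R)" "ennreal (?L ^ CARD('n)) * M \<le> 2 * T + ennreal (?L ^ CARD('n)) * (2 * R)"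
    using sampling_energy[OF _ F \<Psi> bdd\<Psi> _ _ \<epsilon> tail] \<nu>(1) C \<alpha>1 s unfolding T_def M R_def E_def by simp_all
  have VL: "ennreal (1 / (2 ^ j) ^ CARD('n)) * ennreal (?L ^ CARD('n)) = ennreal ?V"
    using \<nu>(1) by (simp add: power_divide flip: ennreal_mult)
  have "S \<le> ennreal (1 / (2 ^ j) ^ CARD('n)) * (ennreal (?L ^ CARD('n)) * (2 * M + 2 * R))"
    unfolding S using *(1) by (rule mult_left_mono) simp
  then show "S \<le> ennreal ?V * (2 * M + 2 * R)" by (simp add: VL flip: mult.assoc)
  have "ennreal (1 / (2 ^ j) ^ CARD('n)) * (ennreal (?L ^ CARD('n)) * M)
    \<le> ennreal (1 / (2 ^ j) ^ CARD('n)) * (2 * T + ennreal (?L ^ CARD('n)) * (2 * R))"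
    using *(2) by (rule mult_left_mono) simp
  also have "\<dots> = 2 * S + ennreal ?V * (2 * R)"
    unfolding S VL[symmetric] by (simp add: distrib_left mult_ac)
  finally show "ennreal ?V * M \<le> 2 * S + ennreal ?V * (2 * R)" by (simp add: VL flip: mult.assoc)
qed

text \<open>
  With Tonelli's theorem, the main terms of all levels together are bounded by the supremum over the frequencies of the
  sum of the squared multipliers.
\<close>
lemma packet_multiplier_energy:
  fixes F :: "real ^ 'n \<Rightarrow> complex" and \<Psi> :: "nat \<Rightarrow> 'k \<Rightarrow> real ^ 'n \<Rightarrow> real" and r :: "nat \<Rightarrow> real ^ 'n \<Rightarrow> real"
  assumes K: "finite K" and F: "F \<in> borel_measurable lebesgue" and r: "\<And>j. r j \<in> borel_measurable lebesgue"
    and r0: "\<And>j \<omega>. r j \<omega> \<ge> 0"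
    and le: "\<And>j k. k \<in> K \<Longrightarrow> AE \<omega> in lebesgue. 0 \<le> \<Psi> j k \<omega> \<and> \<Psi> j k \<omega> \<le> r j \<omega> * (1 + norm \<omega>) powr s"
    and sum: "\<And>\<omega>. (\<integral>\<^sup>+j. ennreal ((r j \<omega>)\<^sup>2) \<partial>count_space UNIV) \<le> ennreal B" and B: "B \<ge> 0"
  shows "(\<integral>\<^sup>+j. \<integral>\<^sup>+k. (\<integral>\<^sup>+\<omega>. ennreal ((cmod (F \<omega>) * \<Psi> j k \<omega>)\<^sup>2) * indicator (Q j) \<omega> \<partial>lebesgue) \<partial>count_space K \<partial>count_space UNIV)
    \<le> ennreal (real (card K) * B) * (\<integral>\<^sup>+\<omega>. ennreal (((1 + norm \<omega>) powr s * cmod (F \<omega>))\<^sup>2) \<partial>lebesgue)"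
proof -
  define G where "G \<omega> = (1 + norm \<omega>) powr s * cmod (F \<omega>)" for \<omega>
  have [measurable]: "G \<in> borel_measurable lebesgue" unfolding G_def by (rule weighted_measurable[OF F])
  note [measurable] = r
  have "(\<integral>\<^sup>+j. \<integral>\<^sup>+k. (\<integral>\<^sup>+\<omega>. ennreal ((cmod (F \<omega>) * \<Psi> j k \<omega>)\<^sup>2) * indicator (Q j) \<omega> \<partial>lebesgue) \<partial>count_space K \<partial>count_space UNIV)
    \<le> (\<integral>\<^sup>+j. \<integral>\<^sup>+k. (\<integral>\<^sup>+\<omega>. ennreal ((r j \<omega>)\<^sup>2) * ennreal ((G \<omega>)\<^sup>2) \<partial>lebesgue) \<partial>count_space K \<partial>count_space UNIV)"
  proof (rule nn_integral_mono, rule nn_integral_mono, rule nn_integral_mono_AE)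
    fix j :: nat and k assume "k \<in> space (count_space K)"
    then have "k \<in> K" by simp
    from le[OF this, of j] show "AE \<omega> in lebesgue. ennreal ((cmod (F \<omega>) * \<Psi> j k \<omega>)\<^sup>2) * indicator (Q j) \<omega> \<le> ennreal ((r j \<omega>)\<^sup>2) * ennreal ((G \<omega>)\<^sup>2)"
    proof eventually_elim
      case (elim \<omega>)
      then have "cmod (F \<omega>) * \<Psi> j k \<omega> \<le> cmod (F \<omega>) * (r j \<omega> * (1 + norm \<omega>) powr s)" by (intro mult_left_mono) auto
      also have "\<dots> = r j \<omega> * G \<omega>" by (simp add: G_def)
      finally have "(cmod (F \<omega>) * \<Psi> j k \<omega>)\<^sup>2 \<le> (r j \<omega> * G \<omega>)\<^sup>2" using elim by (intro power_mono) auto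
      then show ?case by (auto simp: indicator_def power_mult_distrib ennreal_leI simp flip: ennreal_mult)
    qed
  qed
  also have "\<dots> = of_nat (card K) * (\<integral>\<^sup>+j. (\<integral>\<^sup>+\<omega>. ennreal ((r j \<omega>)\<^sup>2) * ennreal ((G \<omega>)\<^sup>2) \<partial>lebesgue) \<partial>count_space UNIV)"
    using K by (simp add: nn_integral_count_space_finite nn_integral_multc, simp only: mult.commute)
  also have "(\<integral>\<^sup>+j. (\<integral>\<^sup>+\<omega>. ennreal ((r j \<omega>)\<^sup>2) * ennreal ((G \<omega>)\<^sup>2) \<partial>lebesgue) \<partial>count_space UNIV)
      = (\<integral>\<^sup>+\<omega>. \<integral>\<^sup>+j. ennreal ((r j \<omega>)\<^sup>2) * ennreal ((G \<omega>)\<^sup>2) \<partial>count_space UNIV \<partial>lebesgue)"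
    by (rule nn_integral_count_space_nn_integral[symmetric]) auto
  also have "\<dots> = (\<integral>\<^sup>+\<omega>. (\<integral>\<^sup>+j. ennreal ((r j \<omega>)\<^sup>2) \<partial>count_space UNIV) * ennreal ((G \<omega>)\<^sup>2) \<partial>lebesgue)"
    by (simp add: nn_integral_multc)
  also have "of_nat (card K) * \<dots> \<le> of_nat (card K) * (\<integral>\<^sup>+\<omega>. ennreal B * ennreal ((G \<omega>)\<^sup>2) \<partial>lebesgue)"
    using sum by (intro mult_left_mono nn_integral_mono mult_right_mono) auto
  also have "\<dots> = ennreal (real (card K) * B) * (\<integral>\<^sup>+\<omega>. ennreal ((G \<omega>)\<^sup>2) \<partial>lebesgue)"
    using B by (simp add: nn_integral_cmult ennreal_mult ennreal_of_nat_eq_real_of_nat mult.assoc)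
  finally show ?thesis unfolding G_def .
qed

text \<open>
  With \<open>t = 1 + norm \<omega>\<close> and \<open>u\<close> the modulus of the transform, this covers both cases of the covering
  property: near the origin with \<open>y = 1\<close> and \<open>x\<close> a bound for \<open>t\<close>, and on level \<open>j\<close> with \<open>y = 2 ^ j\<close>.
\<close>
lemma weighted_lower_bound:
  fixes t u x y z s a A :: real
  assumes "x > 0" "y > 0" "t \<ge> 0" "t \<le> x * y" "s \<ge> 0" "a > 0" "u \<ge> 0"
    and z: "a * y powr s \<le> z" and A: "A \<ge> 0" "A \<le> a\<^sup>2 * x powr (- 2 * s)"
  shows "A * (t powr s * u)\<^sup>2 \<le> (u * z)\<^sup>2"
proof -
  have x: "x powr (- 2 * s) * (x powr s)\<^sup>2 = 1"
    using assms(1) by (simp add: power2_eq_square flip: powr_add)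
  have "t powr s \<le> (x * y) powr s" using assms by (intro powr_mono2) auto
  then have "t powr s * u \<le> x powr s * y powr s * u" using assms by (intro mult_right_mono) (auto simp: powr_mult)
  then have "(t powr s * u)\<^sup>2 \<le> (x powr s * y powr s * u)\<^sup>2" using assms by (intro power_mono) auto
  then have "A * (t powr s * u)\<^sup>2 \<le> (a\<^sup>2 * x powr (- 2 * s)) * (x powr s * y powr s * u)\<^sup>2"
    using A by (intro mult_mono) auto
  also have "\<dots> = (x powr (- 2 * s) * (x powr s)\<^sup>2) * (u * (a * y powr s))\<^sup>2"
    by (simp only: power_mult_distrib mult_ac)
  also have "\<dots> = (u * (a * y powr s))\<^sup>2" unfolding x by simp
  also have "\<dots> \<le> (u * z)\<^sup>2" using assms by (intro power_mono mult_left_mono) auto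
  finally show ?thesis .
qed

theorem theorem1:
  fixes K :: "'k set"
    and I :: "nat \<Rightarrow> 'k \<Rightarrow> (real ^ 'n) set"
    and I\<^sub>0 :: "(real ^ 'n) set"
    and s :: real
    and \<phi>\<^sub>0 \<phi> :: "real ^ 'n \<Rightarrow> complex"
  assumes "admissible_partition K I I\<^sub>0"
    and "s \<ge> 0"
    and "\<phi>\<^sub>0 \<in> L2" and "\<phi> \<in> L2"
    and "s_admissible s K I I\<^sub>0 \<phi>\<^sub>0 \<phi>"
  shows "\<exists>\<nu>\<^sub>0>0. \<forall>\<nu>\<in>{0<..<\<nu>\<^sub>0}. \<exists>A>0. \<exists>B>0. \<forall>f\<in>sobolev s.
    (let S = (\<Sum>\<^sub>\<infinity>l\<in>scaled_lattice \<nu>.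
                ennreal ((cmod (L2_inner f (translation l \<phi>\<^sub>0)))\<^sup>2))
           + (\<Sum>\<^sub>\<infinity>(j, k, l)\<in>UNIV \<times> K \<times> scaled_lattice \<nu>.
                ennreal (2 powr (2 * real j * s) * (cmod (L2_inner f (packet I \<phi> j k l)))\<^sup>2))
     in ennreal (A * (sobolev_norm s f)\<^sup>2) \<le> S \<and> S \<le> ennreal (B * (sobolev_norm s f)\<^sup>2))"
proof -
  let ?d = "real CARD('n)"
  note s = \<open>s \<ge> 0\<close>
  have K: "finite K" and ne: "\<And>j k. k \<in> K \<Longrightarrow> I j k \<noteq> {}"
    using assms(1) unfolding admissible_partition_def by auto
  have "\<exists>cmin>0. \<exists>cmax>0. \<forall>j. \<forall>k\<in>K. \<forall>\<omega>\<in>I j k. cmin < norm \<omega> / 2 ^ j \<and> norm \<omega> / 2 ^ j < cmax"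
    using assms(1) unfolding admissible_partition_def by (elim conjE)
  then obtain cmin cmax where c: "cmin > 0" "cmax > 0"
    and ratio: "\<And>j k \<omega>. k \<in> K \<Longrightarrow> \<omega> \<in> I j k \<Longrightarrow> cmin < norm \<omega> / 2 ^ j \<and> norm \<omega> / 2 ^ j < cmax"
    by metis
  have annulus: "cmin * 2 ^ j < norm \<omega>" "norm \<omega> < cmax * 2 ^ j" if "k \<in> K" "\<omega> \<in> I j k" for j k \<omega>
    using ratio[OF that] by (auto simp: field_simps)
  from assms(5) obtain \<alpha> C a where \<alpha>: "\<alpha> > ?d / 2" and C: "C > 0" and a: "a > 0"
    and decay\<^sub>0: "AE \<omega> in lebesgue. cmod (fourier_L2 \<phi>\<^sub>0 \<omega>) \<le> C * (1 + norm \<omega>) powr (- \<alpha>)"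
    and far: "\<And>j k. k \<in> K \<Longrightarrow> AE \<omega> in lebesgue. \<omega> \<notin> I j k \<longrightarrow> cmod (packet_symbol I \<phi> j k \<omega>)
             \<le> C * 2 powr (real j * ?d / 2) * (1 + infdist \<omega> (I j k)) powr (- (\<alpha> + s))"
    and bdd: "\<And>j k. k \<in> K \<Longrightarrow> AE \<omega> in lebesgue. cmod (packet_symbol I \<phi> j k \<omega>) \<le> C"
    and lower: "AE \<omega> in lebesgue.
        if \<omega> \<in> I\<^sub>0 then a \<le> cmod (fourier_L2 \<phi>\<^sub>0 \<omega>)
        else (\<exists>j. \<exists>k\<in>K. \<omega> \<in> I j k \<and> a \<le> cmod (packet_symbol I \<phi> j k \<omega>))"
    unfolding s_admissible_def by blast
  have \<alpha>0: "\<alpha> > 0" using \<alpha> by (rule le_less_trans[rotated]) simp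
  define \<delta> where "\<delta> = \<alpha> - ?d / 2"
  have \<delta>: "\<delta> > 0" using \<alpha> by (simp add: \<delta>_def)
  \<comment> \<open>At most \<open>p\<close> levels have their middle range at a given frequency.\<close>
  obtain p where "4 * cmax / cmin < 2 ^ p" using real_arch_pow[of 2 "4 * cmax / cmin"] by auto
  then have p: "2 * cmax \<le> cmin / 2 * 2 ^ p" using c by (simp add: field_simps)
  define M\<^sub>1 where "M\<^sub>1 = C * (2 / cmin) powr s"
  define M\<^sub>2 where "M\<^sub>2 = C * (min (cmin / 2) cmax) powr (- (\<alpha> + s))"
  have M0: "M\<^sub>1 \<ge> 0" "M\<^sub>2 \<ge> 0" using C by (auto simp: M\<^sub>1_def M\<^sub>2_def)
  \<comment> \<open>The bound for the weighted symbols of level \<open>j\<close>, relative to the Sobolev weight.\<close>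
  define r where "r j \<omega> = (if cmin / 2 * 2 ^ j < norm \<omega> \<and> norm \<omega> < 2 * cmax * 2 ^ j then M\<^sub>1
      else M\<^sub>2 * 2 powr (- \<delta> * real j))" for j :: nat and \<omega> :: "real ^ 'n"
  define q where "q = 1 / (1 - 2 powr (- (2 * \<delta>)))"
  have q: "q > 0" using \<delta> powr_minus_less_one[of "2 * \<delta>"] by (simp add: q_def)
  define B where "B = C\<^sup>2 + real (card K) * (M\<^sub>1\<^sup>2 * real p + M\<^sub>2\<^sup>2 * q)"
  have B: "B > 0" unfolding B_def using C q by (intro add_pos_nonneg) auto
  \<comment> \<open>The transform of \<open>\<phi>\<^sub>0\<close> has modulus at least \<open>a\<close> on \<open>I\<^sub>0\<close> and at most \<open>C * (1 + norm \<omega>) powr (- \<alpha>)\<close>,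
    so up to a null set \<open>I\<^sub>0\<close> lies in the region where \<open>1 + norm \<omega> \<le> \<rho>\<close>.\<close>
  define \<rho> where "\<rho> = (C / a) powr (1 / \<alpha>)"
  have \<rho>: "\<rho> > 0" using C a by (simp add: \<rho>_def)
  \<comment> \<open>Lower bounds for the multiplier relative to the weight: on \<open>I\<^sub>0\<close>, and on the annuli, where
    \<open>1 + norm \<omega> \<le> (1 + cmax) * 2 ^ j\<close>.\<close>
  define A where "A = min (a\<^sup>2 * \<rho> powr (- 2 * s)) (a\<^sup>2 * (1 + cmax) powr (- 2 * s))"
  have A: "A > 0" using a \<rho> c by (auto simp: A_def)
  have "\<exists>\<sigma>\<ge>0. lattice_sum (\<lambda>m :: real ^ 'n. ennreal ((1 + norm m) powr (- 2 * \<beta>))) = ennreal \<sigma>" if "\<beta> \<ge> \<alpha>" for \<beta>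
  proof -
    have "lattice_sum (\<lambda>m :: real ^ 'n. ennreal ((1 + norm m) powr (- (2 * \<beta>)))) < \<infinity>"
      by (rule lattice_power_sum_finite) (use \<alpha> that in linarith)
    then show ?thesis by (cases "\<integral>\<^sup>+m. ennreal ((1 + norm m) powr (- (2 * \<beta>))) \<partial>count_space (int_lattice :: (real ^ 'n) set)") auto
  qed
  from this[of \<alpha>] this[of "\<alpha> + 2 * s"] s obtain \<sigma>\<^sub>0 \<sigma>\<^sub>1 where \<sigma>0: "\<sigma>\<^sub>0 \<ge> 0" "\<sigma>\<^sub>1 \<ge> 0"
    and \<sigma>: "lattice_sum (\<lambda>m :: real ^ 'n. ennreal ((1 + norm m) powr (- 2 * \<alpha>))) = ennreal \<sigma>\<^sub>0"
      "lattice_sum (\<lambda>m :: real ^ 'n. ennreal ((1 + norm m) powr (- 2 * (\<alpha> + 2 * s)))) = ennreal \<sigma>\<^sub>1"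
    by auto
  \<comment> \<open>The total aliasing error is \<open>T * \<nu>\<close> times the squared Sobolev norm, up to the common factor \<open>V\<close> below.\<close>
  define T where "T = C\<^sup>2 * 4 * \<sigma>\<^sub>0 + real (card K) * (C\<^sup>2 * 4 powr (\<alpha> + s) * 4 * \<sigma>\<^sub>1 * q)"
  have T: "T \<ge> 0" unfolding T_def using \<sigma>0 q by (intro add_nonneg_nonneg mult_nonneg_nonneg) auto
  \<comment> \<open>The first two bounds make the aliasing estimates applicable, the third puts \<open>I\<^sub>0\<close> into the cube
    of side \<open>1 / \<nu>\<close>, and the last makes the total error at most a quarter of the lower bound.\<close>
  define \<nu>\<^sub>0 where "\<nu>\<^sub>0 = min (min (1 / 4) (1 / (4 * cmax))) (min (1 / (2 * \<rho>)) (A / (4 * (T + 1))))"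
  have "\<nu>\<^sub>0 > 0" using c \<rho> A T by (simp add: \<nu>\<^sub>0_def)
  define S where "S \<nu> f = (\<Sum>\<^sub>\<infinity>l\<in>scaled_lattice \<nu>.
                ennreal ((cmod (L2_inner f (translation l \<phi>\<^sub>0)))\<^sup>2))
           + (\<Sum>\<^sub>\<infinity>(j, k, l)\<in>UNIV \<times> K \<times> scaled_lattice \<nu>.
                ennreal (2 powr (2 * real j * s) * (cmod (L2_inner f (packet I \<phi> j k l)))\<^sup>2))" for \<nu> f
  have "\<exists>A>0. \<exists>B>0. \<forall>f\<in>sobolev s.
      ennreal (A * (sobolev_norm s f)\<^sup>2) \<le> S \<nu> f \<and> S \<nu> f \<le> ennreal (B * (sobolev_norm s f)\<^sup>2)"
    if \<nu>: "\<nu> \<in> {0<..<\<nu>\<^sub>0}" for \<nu>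
  proof -
    have \<nu>1: "\<nu> > 0" "4 * \<nu> \<le> 1" "4 * cmax * \<nu> \<le> 1" "2 * \<rho> * \<nu> < 1" "T * \<nu> \<le> A / 4"
    proof -
      have *: "0 < \<nu>" "\<nu> < 1 / 4" "\<nu> < 1 / (4 * cmax)" "\<nu> < 1 / (2 * \<rho>)" "\<nu> < A / (4 * (T + 1))"
        using \<nu> by (auto simp: \<nu>\<^sub>0_def)
      then show "\<nu> > 0" "4 * \<nu> \<le> 1" "4 * cmax * \<nu> \<le> 1" "2 * \<rho> * \<nu> < 1"
        using c \<rho> by (auto simp: field_simps)
      have "(T + 1) * \<nu> \<le> A / 4" using *(5) T by (simp add: field_simps)
      then show "T * \<nu> \<le> A / 4" using *(1) by (simp add: distrib_right)
    qed
    define V where "V = (1 / \<nu>) ^ CARD('n)"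
    have V: "V > 0" using \<nu>1 by (simp add: V_def)
    have bounds: "ennreal (V * A / 4 * (sobolev_norm s f)\<^sup>2) \<le> S \<nu> f \<and>
        S \<nu> f \<le> ennreal (V * (2 * B + 2 * (T * \<nu>)) * (sobolev_norm s f)\<^sup>2)"
      if f: "f \<in> sobolev s" for f
    proof -
      let ?F = "fourier_L2 f" and ?e = "(sobolev_norm s f)\<^sup>2"
      note fL2 = sobolev_weighted_energy(1)[OF f]
      note energy = sobolev_weighted_energy(2)[OF f]
      have FL2: "?F \<in> L2" "fourier_L2 \<phi>\<^sub>0 \<in> L2"
        using is_fourier_L2_fourier_L2[OF fL2] is_fourier_L2_fourier_L2[OF \<open>\<phi>\<^sub>0 \<in> L2\<close>] by (auto simp: is_fourier_L2_def)
      note [measurable] = FL2[THEN L2_measurable] packet_transform(3)[OF \<open>\<phi> \<in> L2\<close>, THEN L2_measurable]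
      define P where "P j k \<omega> = 2 powr (real j * s) * cmod (packet_symbol I \<phi> j k \<omega>)" for j k \<omega>
      have [measurable]: "P j k \<in> borel_measurable lebesgue" for j k unfolding P_def by measurable
      define G where "G \<omega> = (1 + norm \<omega>) powr s * cmod (?F \<omega>)" for \<omega>
      have [measurable]: "G \<in> borel_measurable lebesgue" unfolding G_def by (rule weighted_measurable) simp
      have E: "(\<integral>\<^sup>+\<omega>. ennreal ((G \<omega>)\<^sup>2) \<partial>lebesgue) = ennreal ?e" unfolding G_def by (rule energy)
      \<comment> \<open>For the coarse functions and for each level: the sum \<open>S\<close> of squared coefficients, the main term \<open>M\<close>
        of the exact Parseval identity, and the aliasing error \<open>R\<close>.\<close>
      define S0 where "S0 = energy (count_space (scaled_lattice \<nu>)) (\<lambda>l. L2_inner f (translation l \<phi>\<^sub>0))"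
      define S1 where "S1 j k = (\<integral>\<^sup>+l. ennreal (2 powr (2 * real j * s) * (cmod (L2_inner f (packet I \<phi> j k l)))\<^sup>2) \<partial>count_space (scaled_lattice \<nu>))" for j k
      define M0 where "M0 = (\<integral>\<^sup>+\<omega>. ennreal ((cmod (?F \<omega>) * cmod (fourier_L2 \<phi>\<^sub>0 \<omega>))\<^sup>2) * indicator (cube (1 / \<nu>)) \<omega> \<partial>lebesgue)"
      define M1 where "M1 j k = (\<integral>\<^sup>+\<omega>. ennreal ((cmod (?F \<omega>) * P j k \<omega>)\<^sup>2) * indicator (cube (2 ^ j / \<nu>)) \<omega> \<partial>lebesgue)" for j k
      define R0 where "R0 = ennreal (C\<^sup>2 * (4 * \<nu>)) * ennreal \<sigma>\<^sub>0 * ennreal ?e"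
      define R1 where "R1 j = ennreal (C\<^sup>2 * 4 powr (\<alpha> + s) * (4 * \<nu>) * 2 powr (- (2 * \<delta>) * real j)) * ennreal \<sigma>\<^sub>1 * ennreal ?e" for j :: nat
      let ?\<Sigma> = "\<lambda>X :: nat \<Rightarrow> 'k \<Rightarrow> ennreal. \<integral>\<^sup>+j. \<integral>\<^sup>+k. X j k \<partial>count_space K \<partial>count_space UNIV"
      have lin: "?\<Sigma> (\<lambda>j k. c * X j k + c' * Y j k) = c * ?\<Sigma> X + c' * ?\<Sigma> Y" for c c' X Y
        by (simp add: nn_integral_add nn_integral_cmult)
      have mono: "?\<Sigma> X \<le> ?\<Sigma> Y" if "\<And>j k. k \<in> K \<Longrightarrow> X j k \<le> Y j k" for X Y
        using that by (intro nn_integral_mono) auto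
      have S_eq: "S \<nu> f = S0 + ?\<Sigma> S1"
      proof -
        have "countable ((UNIV :: nat set) \<times> K \<times> (scaled_lattice \<nu> :: (real ^ 'n) set))"
          using K by (intro countable_SIGMA countable_scaled_lattice) (auto intro: countable_finite)
        then have "(\<Sum>\<^sub>\<infinity>(j, k, l)\<in>UNIV \<times> K \<times> scaled_lattice \<nu>.
                ennreal (2 powr (2 * real j * s) * (cmod (L2_inner f (packet I \<phi> j k l)))\<^sup>2)) = ?\<Sigma> S1"
          by (simp add: infsum_ennreal_eq_nn_integral nn_integral_count_space_Times S1_def)
        then show ?thesis
          unfolding S_def S0_def by (simp add: infsum_ennreal_eq_nn_integral countable_scaled_lattice)
      qed
      have c0: "S0 \<le> ennreal V * (2 * M0 + 2 * R0)" "ennreal V * M0 \<le> 2 * S0 + ennreal V * (2 * R0)"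
        using coarse_energy[OF fL2 \<open>\<phi>\<^sub>0 \<in> L2\<close> \<nu>1(1,2) C s \<alpha> decay\<^sub>0]
        unfolding S0_def M0_def R0_def V_def \<sigma> energy by blast+
      have c1: "S1 j k \<le> ennreal V * (2 * M1 j k + 2 * R1 j)" "ennreal V * M1 j k \<le> 2 * S1 j k + ennreal V * (2 * R1 j)"
        if k: "k \<in> K" for j k
      proof -
        have "2 * \<alpha> - ?d = 2 * \<delta>" by (simp add: \<delta>_def)
        then show "S1 j k \<le> ennreal V * (2 * M1 j k + 2 * R1 j)" "ennreal V * M1 j k \<le> 2 * S1 j k + ennreal V * (2 * R1 j)"
          using packet_energy[OF fL2 \<open>\<phi> \<in> L2\<close> \<nu>1(1,2,3) C s \<alpha> c(2) ne[OF k] annulus(2)[OF k] far[OF k] bdd[OF k], of j]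
          unfolding S1_def M1_def R1_def P_def V_def \<sigma> energy by simp_all
      qed
      let ?M = "M0 + ?\<Sigma> M1" and ?R = "R0 + ?\<Sigma> (\<lambda>j k. R1 j)"
      have upper: "S \<nu> f \<le> ennreal V * (2 * ?M + 2 * ?R)"
      proof -
        have "?\<Sigma> S1 \<le> ?\<Sigma> (\<lambda>j k. (ennreal V * 2) * M1 j k + (ennreal V * 2) * R1 j)"
          by (rule mono) (use c1(1) in \<open>simp add: distrib_left mult.assoc\<close>)
        also have "\<dots> = (ennreal V * 2) * ?\<Sigma> M1 + (ennreal V * 2) * ?\<Sigma> (\<lambda>j k. R1 j)" by (rule lin)
        finally have "S \<nu> f \<le> ennreal V * (2 * M0 + 2 * R0) + ((ennreal V * 2) * ?\<Sigma> M1 + (ennreal V * 2) * ?\<Sigma> (\<lambda>j k. R1 j))"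
          unfolding S_eq by (rule add_mono[OF c0(1)])
        then show ?thesis by (simp add: distrib_left mult.assoc add_ac)
      qed
      have lower': "ennreal V * ?M \<le> 2 * S \<nu> f + ennreal V * (2 * ?R)"
      proof -
        have "?\<Sigma> (\<lambda>j k. ennreal V * M1 j k + 0 * M1 j k) \<le> ?\<Sigma> (\<lambda>j k. 2 * S1 j k + (ennreal V * 2) * R1 j)"
          by (rule mono) (use c1(2) in \<open>simp add: mult.assoc\<close>)
        then have "ennreal V * ?\<Sigma> M1 \<le> 2 * ?\<Sigma> S1 + (ennreal V * 2) * ?\<Sigma> (\<lambda>j k. R1 j)"
          unfolding lin by simp
        then have "ennreal V * M0 + ennreal V * ?\<Sigma> M1 \<le> (2 * S0 + ennreal V * (2 * R0)) + (2 * ?\<Sigma> S1 + (ennreal V * 2) * ?\<Sigma> (\<lambda>j k. R1 j))"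
          by (rule add_mono[OF c0(2)])
        then show ?thesis unfolding S_eq by (simp add: distrib_left mult.assoc add_ac)
      qed
      have R: "?R \<le> ennreal (T * \<nu> * ?e)"
      proof -
        have "?\<Sigma> (\<lambda>j k. R1 j) = of_nat (card K) * (\<integral>\<^sup>+j. R1 j \<partial>count_space UNIV)"
          using K by (simp add: nn_integral_count_space_finite nn_integral_multc, simp only: mult.commute)
        also have "(\<integral>\<^sup>+j. R1 j \<partial>count_space UNIV)
          = (\<integral>\<^sup>+j. (ennreal (C\<^sup>2 * 4 powr (\<alpha> + s) * (4 * \<nu>)) * ennreal \<sigma>\<^sub>1 * ennreal ?e) * ennreal (2 powr (- (2 * \<delta>) * real j)) \<partial>count_space UNIV)"
          unfolding R1_def using \<nu>1(1) by (intro nn_integral_cong) (simp add: ennreal_mult mult_ac)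
        also have "\<dots> = (ennreal (C\<^sup>2 * 4 powr (\<alpha> + s) * (4 * \<nu>)) * ennreal \<sigma>\<^sub>1 * ennreal ?e) * ennreal q"
          using nn_integral_geometric[of "2 * \<delta>"] \<delta> by (simp add: nn_integral_cmult q_def)
        finally have "?\<Sigma> (\<lambda>j k. R1 j) = ennreal (real (card K) * (C\<^sup>2 * 4 powr (\<alpha> + s) * (4 * \<nu>) * \<sigma>\<^sub>1 * ?e * q))"
          using \<nu>1(1) \<sigma>0 q by (simp add: ennreal_of_nat_eq_real_of_nat ennreal_mult)
        moreover have "R0 = ennreal (C\<^sup>2 * (4 * \<nu>) * \<sigma>\<^sub>0 * ?e)"
          unfolding R0_def using \<nu>1(1) \<sigma>0 by (simp add: ennreal_mult)
        ultimately have "?R = ennreal (C\<^sup>2 * (4 * \<nu>) * \<sigma>\<^sub>0 * ?e + real (card K) * (C\<^sup>2 * 4 powr (\<alpha> + s) * (4 * \<nu>) * \<sigma>\<^sub>1 * ?e * q))"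
          using \<nu>1(1) \<sigma>0 q by (simp only:) (rule ennreal_plus[symmetric], auto)
        also have "C\<^sup>2 * (4 * \<nu>) * \<sigma>\<^sub>0 * ?e + real (card K) * (C\<^sup>2 * 4 powr (\<alpha> + s) * (4 * \<nu>) * \<sigma>\<^sub>1 * ?e * q) = T * \<nu> * ?e"
          by (simp add: T_def algebra_simps)
        finally show ?thesis by simp
      qed
      have Mupper: "?M \<le> ennreal (B * ?e)"
      proof -
        have "M0 \<le> (\<integral>\<^sup>+\<omega>. ennreal (C\<^sup>2) * ennreal ((G \<omega>)\<^sup>2) \<partial>lebesgue)"
          unfolding M0_def
        proof (intro nn_integral_mono_AE, use decay\<^sub>0 in eventually_elim)
          case (elim \<omega>)
          have "C * (1 + norm \<omega>) powr (- \<alpha>) \<le> C * 1"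
            using C \<alpha>0 powr_minus_le_one[of "1 + norm \<omega>" \<alpha>] by (intro mult_left_mono) auto
          then have "cmod (fourier_L2 \<phi>\<^sub>0 \<omega>) \<le> C" using elim by simp
          moreover have "1 * cmod (?F \<omega>) \<le> G \<omega>" unfolding G_def using s by (intro mult_right_mono ge_one_powr_ge_zero) auto
          ultimately have "cmod (?F \<omega>) * cmod (fourier_L2 \<phi>\<^sub>0 \<omega>) \<le> G \<omega> * C"
            by (intro mult_mono) (auto intro: order_trans[OF norm_ge_zero])
          then have "(cmod (?F \<omega>) * cmod (fourier_L2 \<phi>\<^sub>0 \<omega>))\<^sup>2 \<le> (G \<omega> * C)\<^sup>2" by (rule power_mono) simp
          then show ?case
            by (auto simp: indicator_def power_mult_distrib mult.commute ennreal_leI simp flip: ennreal_mult)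
        qed
        also have "\<dots> = ennreal (C\<^sup>2 * ?e)" using E by (simp add: nn_integral_cmult ennreal_mult)
        finally have "M0 \<le> ennreal (C\<^sup>2 * ?e)" .
        moreover have "?\<Sigma> M1 \<le> ennreal (real (card K) * (M\<^sub>1\<^sup>2 * real p + M\<^sub>2\<^sup>2 * q)) * ennreal ?e"
          unfolding M1_def energy[symmetric]
        proof (rule packet_multiplier_energy[OF K, where r=r])
          show "(\<integral>\<^sup>+j. ennreal ((r j \<omega>)\<^sup>2) \<partial>count_space UNIV) \<le> ennreal (M\<^sub>1\<^sup>2 * real p + M\<^sub>2\<^sup>2 * q)" for \<omega>
            unfolding r_def q_def using dyadic_multiplier_sum[of "cmin / 2" "2 * cmax" p \<delta> M\<^sub>1 M\<^sub>2 "norm \<omega>"] c p \<delta> M0 by simp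
          show "r j \<in> borel_measurable lebesgue" for j
            by (rule measurable_completion) (unfold r_def[abs_def], measurable)
          show "AE \<omega> in lebesgue. 0 \<le> P j k \<omega> \<and> P j k \<omega> \<le> r j \<omega> * (1 + norm \<omega>) powr s" if k: "k \<in> K" for j k
            using far[OF k, of j] bdd[OF k, of j]
          proof eventually_elim
            case (elim \<omega>)
            have "P j k \<omega> \<le> r j \<omega> * (1 + norm \<omega>) powr s"
              unfolding P_def r_def M\<^sub>1_def M\<^sub>2_def \<delta>_def
              by (rule symbol_multiplier_bound[OF C s \<alpha>0 ne[OF k] annulus(1)[OF k] annulus(2)[OF k]]) (use elim c in auto)
            then show ?case by (simp add: P_def)
          qed
        qed (use M0 q in \<open>auto simp: r_def\<close>)
        ultimately have "?M \<le> ennreal (C\<^sup>2 * ?e) + ennreal (real (card K) * (M\<^sub>1\<^sup>2 * real p + M\<^sub>2\<^sup>2 * q)) * ennreal ?e"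
          by (rule add_mono)
        also have "\<dots> = ennreal (B * ?e)"
          unfolding B_def using q by (simp add: distrib_right flip: ennreal_mult ennreal_plus)
        finally show ?thesis .
      qed
      have Mlower: "ennreal (A * ?e) \<le> ?M"
      proof -
        let ?m0 = "\<lambda>\<omega>. ennreal ((cmod (?F \<omega>) * cmod (fourier_L2 \<phi>\<^sub>0 \<omega>))\<^sup>2) * indicator (cube (1 / \<nu>)) \<omega>"
        let ?m1 = "\<lambda>j k \<omega>. ennreal ((cmod (?F \<omega>) * P j k \<omega>)\<^sup>2) * indicator (cube (2 ^ j / \<nu>)) \<omega>"
        have meas_k: "(\<lambda>\<omega>. \<integral>\<^sup>+k. ?m1 j k \<omega> \<partial>count_space K) \<in> borel_measurable lebesgue" for j
          by (rule measurable_nn_integral_count_space[OF countable_finite[OF K]]) measurable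
        have "AE \<omega> in lebesgue. ennreal (A * (G \<omega>)\<^sup>2) \<le> ?m0 \<omega> + ?\<Sigma> (\<lambda>j k. ?m1 j k \<omega>)"
          using lower decay\<^sub>0
        proof eventually_elim
          case (elim \<omega>)
          show ?case
          proof (cases "\<omega> \<in> I\<^sub>0")
            case True
            then have lo: "a \<le> cmod (fourier_L2 \<phi>\<^sub>0 \<omega>)" using elim(1) by simp
            have "1 + norm \<omega> \<le> \<rho>"
            proof -
              have "a * (1 + norm \<omega>) powr \<alpha> \<le> C * (1 + norm \<omega>) powr (- \<alpha>) * (1 + norm \<omega>) powr \<alpha>"
                using lo elim(2) by (intro mult_right_mono) auto
              also have "\<dots> = C"
              proof -
                have "1 + norm \<omega> \<noteq> 0" using norm_ge_zero[of \<omega>] by linarith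
                then show ?thesis by (simp add: mult.assoc flip: powr_add)
              qed
              finally have "(1 + norm \<omega>) powr \<alpha> \<le> C / a" using a by (simp add: field_simps)
              then have "((1 + norm \<omega>) powr \<alpha>) powr (1 / \<alpha>) \<le> \<rho>"
                unfolding \<rho>_def using \<alpha>0 by (intro powr_mono2) auto
              then show ?thesis using \<alpha>0 norm_ge_zero[of \<omega>] by (simp add: powr_powr)
            qed
            moreover have "\<omega> \<in> cube (1 / \<nu>)"
            proof (rule small_norm_in_cube)
              have "2 * \<rho> * \<nu> < 1" by (rule \<nu>1(4))
              then have "\<rho> < 1 / \<nu> / 2" using \<nu>1(1) by (simp add: field_simps)
              then show "norm \<omega> < 1 / \<nu> / 2" using \<open>1 + norm \<omega> \<le> \<rho>\<close> by linarith
            qed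
            moreover have "A * (G \<omega>)\<^sup>2 \<le> (cmod (?F \<omega>) * cmod (fourier_L2 \<phi>\<^sub>0 \<omega>))\<^sup>2"
              unfolding G_def
              by (rule weighted_lower_bound[where x=\<rho> and y=1 and a=a])
                (use \<rho> A a s lo \<open>1 + norm \<omega> \<le> \<rho>\<close> in \<open>auto simp: A_def\<close>)
            ultimately have "ennreal (A * (G \<omega>)\<^sup>2) \<le> ?m0 \<omega>" by (simp add: ennreal_leI)
            then show ?thesis by (rule add_increasing2[rotated]) simp
          next
            case False
            then obtain j k where jk: "k \<in> K" "\<omega> \<in> I j k" and lo: "a \<le> cmod (packet_symbol I \<phi> j k \<omega>)"
              using elim(1) by auto
            have up: "norm \<omega> < cmax * 2 ^ j" using annulus(2)[OF jk] .
            have two: "(1 :: real) \<le> 2 ^ j" by simp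
            have "1 + norm \<omega> \<le> (1 + cmax) * 2 ^ j" using up two unfolding distrib_right by linarith
            moreover have "a * (2 ^ j) powr s \<le> P j k \<omega>"
              unfolding P_def two_power_powr using lo by (simp add: mult.commute)
            ultimately have "A * (G \<omega>)\<^sup>2 \<le> (cmod (?F \<omega>) * P j k \<omega>)\<^sup>2"
              unfolding G_def
              by (intro weighted_lower_bound[where x="1 + cmax" and y="2 ^ j" and a=a])
                (use c A a s in \<open>auto simp: A_def\<close>)
            moreover have "\<omega> \<in> cube (2 ^ j / \<nu>)"
            proof (rule small_norm_in_cube)
              have "4 * cmax * \<nu> * 2 ^ j \<le> 1 * 2 ^ j" using \<nu>1(3) by (rule mult_right_mono) simp
              then have "cmax * 2 ^ j \<le> 2 ^ j / \<nu> / 4" using \<nu>1(1) by (simp add: field_simps)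
              also have "\<dots> \<le> 2 ^ j / \<nu> / 2" using \<nu>1(1) by (simp add: field_simps)
              finally show "norm \<omega> < 2 ^ j / \<nu> / 2" using up by linarith
            qed
            ultimately have "ennreal (A * (G \<omega>)\<^sup>2) \<le> ?m1 j k \<omega>" by (simp add: ennreal_leI)
            also have "\<dots> \<le> (\<integral>\<^sup>+k. ?m1 j k \<omega> \<partial>count_space K)"
              by (rule term_le_nn_integral_count_space[OF jk(1)])
            also have "\<dots> \<le> ?\<Sigma> (\<lambda>j k. ?m1 j k \<omega>)"
              by (rule term_le_nn_integral_count_space[OF UNIV_I])
            finally show ?thesis by (rule add_increasing[rotated]) simp
          qed
        qed
        then have "(\<integral>\<^sup>+\<omega>. ennreal (A * (G \<omega>)\<^sup>2) \<partial>lebesgue) \<le> (\<integral>\<^sup>+\<omega>. ?m0 \<omega> + ?\<Sigma> (\<lambda>j k. ?m1 j k \<omega>) \<partial>lebesgue)"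
          by (rule nn_integral_mono_AE)
        also have "(\<integral>\<^sup>+\<omega>. ennreal (A * (G \<omega>)\<^sup>2) \<partial>lebesgue) = ennreal (A * ?e)"
          using A E by (simp add: ennreal_mult nn_integral_cmult)
        also have "(\<integral>\<^sup>+\<omega>. ?m0 \<omega> + ?\<Sigma> (\<lambda>j k. ?m1 j k \<omega>) \<partial>lebesgue) = M0 + (\<integral>\<^sup>+\<omega>. ?\<Sigma> (\<lambda>j k. ?m1 j k \<omega>) \<partial>lebesgue)"
          unfolding M0_def
          by (rule nn_integral_add) (use meas_k in \<open>auto intro: measurable_nn_integral_count_space\<close>)
        also have "(\<integral>\<^sup>+\<omega>. ?\<Sigma> (\<lambda>j k. ?m1 j k \<omega>) \<partial>lebesgue) = (\<integral>\<^sup>+j. \<integral>\<^sup>+\<omega>. (\<integral>\<^sup>+k. ?m1 j k \<omega> \<partial>count_space K) \<partial>lebesgue \<partial>count_space UNIV)"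
          by (rule nn_integral_count_space_nn_integral) (use meas_k in auto)
        also have "\<dots> = ?\<Sigma> M1"
          unfolding M1_def
          by (intro nn_integral_cong nn_integral_count_space_nn_integral countable_finite[OF K]) measurable
        finally show ?thesis .
      qed
      show ?thesis
        using frame_bounds_from_energy[OF V A less_imp_le[OF B] _ \<nu>1(5) _ upper lower' R Mupper Mlower] T \<nu>1(1) by simp
    qed
    have "V * A / 4 > 0" "V * (2 * B + 2 * (T * \<nu>)) > 0"
      using V A B T \<nu>1(1) by (auto intro!: mult_pos_pos add_pos_nonneg)
    then show ?thesis using bounds by blast
  qed
  with \<open>\<nu>\<^sub>0 > 0\<close> show ?thesis unfolding S_def Let_def by blast
qed

end
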